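(* Let $\mathcal{M}=(K_{i(e)},w_e,p_e)_{e\in E}$ be a countable Markov system on the complete metric space $(K,d)$ which is contractive with a contraction rate $0<a<1$ and uniformly continuous, with $b<\infty$. Then the following holds true. (i) If $\mathcal{M}$ has a dominating Markov chain, and $x_0\in K$ is such that the sequence $(\alpha^{x_0}_n)_{n\in\mathbb{N}}$ is uniformly tight, then there exists $M\in\tilde E(\mathcal{M})$ such that for every $i\in N$ with $M(T_i)>0$ and every $n\in\mathbb{N}$ there exist $k\geq n$ and a path $(e_1,\dots,e_k)$ with $t(e_k)=i$ such that $P_{x_0}({}_1[e_1,\dots,e_k]^+)>0$. (ii) $E(\mathcal{M})\subset\Phi(P(\mathcal{M}))\subset\tilde E(\mathcal{M})$, and $F(\Phi(\mu))=\mu$ for all $\mu\in P(\mathcal{M})$. (iii) There exists a sequence of Borel sets $Q_1\subset Q_2\subset\dots\subset\Sigma_G$ with $$\sum_{k\geq n}\Phi(\mu)(\bar\Sigma\setminus Q_k)\leq \frac{1}{1-\sqrt{a}}\,a^{n/2}\quad\text{for all }\mu\in P(\mathcal{M})\text{ and }n\in\mathbb{N}$$ such that for each $k\in\mathbb{N}$ $$d(F(\sigma),F(\sigma'))\leq\frac{8b}{(1-\sqrt a)(1-a)}\,d'(\sigma,\sigma')^{\frac{\log\sqrt a}{\log(1/2)}}$$ whenever $\sigma,\sigma'\in Q_k$ with $d'(\sigma,\sigma')\leq(1/2)^{k+1}$; i.e. $F|_{Q_k}$ is locally Hölder-continuous with the same Hölder-constants for all $k\in\mathbb{N}$.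
   Context: Setting. $(K,d)$ is a complete metric space; $P(X)$ denotes the Borel probability measures on $X$. A countable Markov system $\mathcal{M}=(K_{i(e)},w_e,p_e)_{e\in E}$ on $K$ consists of: a set $N\subset\mathbb{N}$ with $1\in N$; a partition $(K_j)_{j\in N}$ of $K$ into non-empty Borel sets; an at most countable set $E$; a surjective map $i:E\to N$ and a map $t:E\to N$; for each $e\in E$, Borel measurable $w_e:K_{i(e)}\to K_{t(e)}$ and $p_e:K_{i(e)}\to[0,1]$ with $p_e\not\equiv 0$, such that $\sum_{e\in E,\,i(e)=j}p_e(x)=1$ for all $x\in K_j$, $j\in N$. Each $p_e$ is extended to $K$ by zero and each $w_e$ is extended to a Borel map $K\to K$ arbitrarily. For Borel $f:K\to[0,\infty)$, $Uf:=\sum_{e\in E}p_e\,f\circ w_e$; for $\nu\in P(K)$, $U^*\nu(f):=\int Uf\,d\nu$ for bounded such $f$. $P(\mathcal{M}):=\{\mu\in P(K): U^*\mu=\mu\}$ (invariant measures). $\mathcal{M}$ is contractive with contraction rate $0<a<1$ iff $\sum_{e\in E,\,i(e)=j}p_e(x)d(w_ex,w_ey)\le a\,d(x,y)$ for all $x,y\in K_j$, $j\in N$. $\mathcal{M}$ is uniformly continuous iff $w_e|_{K_{i(e)}}$ and $p_e|_{K_{i(e)}}$ are uniformly continuous for each $e\in E$. Code space. $\bar E:=E\cup\{\infty\}$ is the one-point compactification of discrete $E$; $w_\infty:=\mathrm{id}$, $p_\infty:=0$, $i(\infty)=t(\infty):=1$. $\bar\Sigma:=\bar E^{\mathbb{Z}}$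 with the product topology; $(S\sigma)_{i-1}=\sigma_i$ is the left shift; $P_S(\bar\Sigma)$ is the set of shift-invariant Borel probability measures. Cylinders: ${}_m[e_m,\dots,e_n]:=\{\sigma\in\bar\Sigma:\sigma_i=e_i,\ m\le i\le n\}$. $\mathcal{F}$ is the $\sigma$-algebra generated by all cylinders ${}_m[e_m,\dots,e_0]$, $m\le 0$. A sequence $(e_1,\dots,e_n)$ in $E$ is a path iff $i(e_{k+1})=t(e_k)$ for all $k$. $\Sigma_G:=\{\sigma\in\bar\Sigma: \sigma_n\in E,\ i(\sigma_{n+1})=t(\sigma_n)\ \forall n\in\mathbb{Z}\}$, with metric $d'(\sigma,\sigma'):=2^{-k}$, where $k\ge 0$ is the largest integer with $\sigma_i=\sigma'_i$ for all $|i|<k$ ($d'=0$ if $\sigma=\sigma'$). $\bar\Sigma^+:=\bar E^{\mathbb{N}}$ with cylinders ${}_1[e_1,\dots,e_n]^+$; for $x\in K$, $P_x$ is the Borel probability measure on $\bar\Sigma^+$ with $P_x({}_1[e_1,\dots,e_n]^+)=p_{e_1}(x)p_{e_2}(w_{e_1}x)\cdots p_{e_n}(w_{e_{n-1}}\circ\dots\circ w_{e_1}x)$. Coding map. Fix $x_i\in K_i$ for each $i\in N$. $D:=\{\sigma\in\Sigma_G:\lim_{m\to-\infty}w_{\sigma_0}\circ\dots\circ w_{\sigma_m}(x_{i(\sigma_m)})\text{ exists}\}$; $F:\bar\Sigma\to K$ is this limit on $D$, and $F(\sigma):=x_{t(\sigma_0)}$ for $\sigma\notin D$. For a measure $\Lambda$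 on $\bar\Sigma$, $F(\Lambda):=\Lambda\circ F^{-1}$. $b:=\sup_{i\in N}\sup_{x\in K_i}\sum_{e\in E,\,i(e)=i}p_e(x)\,d(w_e(x_{i(e)}),x_{t(e)})$. $E(\mathcal{M})$ is the set of $\Lambda\in P_S(\bar\Sigma)$ with $\Lambda(D)=1$ and $E_\Lambda(1_{{}_1[e]}|\mathcal{F})=p_e\circ F$ $\Lambda$-a.e. for all $e\in E$ (equilibrium states). $T_j:=\{\sigma\in\Sigma_G:t(\sigma_0)=j\}$. $\bar p_e$ is the continuous extension of $p_e|_{K_{i(e)}}$ to the closure $\bar K_{i(e)}$, extended by zero to $K$. $\tilde E(\mathcal{M})$ is the set of $\Lambda\in P_S(\bar\Sigma)$ with $\Lambda(D)=1$ and $E_\Lambda(1_{{}_1[e]}|\mathcal{F})=(\bar p_e\circ F)\,1_{T_{i(e)}}$ $\Lambda$-a.e. for all $e\in E$ (asymptotic states). For $\mu\in P(\mathcal{M})$, $\Phi(\mu)\in P_S(\bar\Sigma)$ is the unique Borel probability measure with $\Phi(\mu)({}_m[e_m,\dots,e_n])=\int p_{e_m}(x)p_{e_{m+1}}(w_{e_m}x)\cdots p_{e_n}(w_{e_{n-1}}\circ\dots\circ w_{e_m}x)\,d\mu(x)$ for all $m\le 0$, $n\ge m$, $e_m,\dots,e_n\in\bar E$. $\mathcal{M}$ has a dominating Markov chain iff $\xi_i:=\sum_{e\in E,\,i(e)=i}\sup_{x\in K_i}p_e(x)<\infty$ for every $i\in N$. For $x\in K$, $\alpha^x_n(\{j\}):=\frac1n\sum_{k=1}^n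 {U^*}^k\delta_x(K_j)$, $j\in N$, a probability measure on $N$. $(\alpha^{x}_n)_n$ is uniformly tight iff for every $\epsilon>0$ there is a finite $V\subset N$ with $\alpha^{x}_n(N\setminus V)<\epsilon$ for all $n\in\mathbb{N}$. *)

theory Defs
  imports "HOL-Probability.Probability"
begin

section \<open>Countable Markov systems\<close>

text \<open>
  The complete metric space \<open>K\<close> is the type \<open>'k\<close> and the (non-empty, at most countable) edge set
  \<open>E\<close> is the type \<open>'e\<close>.  The maps \<open>wmap e\<close> and the probabilities \<open>wprob e\<close> are the total versions:
  \<open>wmap e\<close> is the arbitrary Borel extension of \<open>w_e\<close>, \<open>wprob e\<close> the extension of \<open>p_e\<close> by zero.
\<close>

record ('k, 'e) markov_system =
  vert :: "nat set"
  cell :: "nat \<Rightarrow> 'k set"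
  ini :: "'e \<Rightarrow> nat"
  ter :: "'e \<Rightarrow> nat"
  wmap :: "'e \<Rightarrow> 'k \<Rightarrow> 'k"
  wprob :: "'e \<Rightarrow> 'k \<Rightarrow> real"

definition countable_markov_system ::
    "('k::complete_space, 'e::countable) markov_system \<Rightarrow> bool" where
  "countable_markov_system M \<longleftrightarrow>
     1 \<in> vert M \<and>
     (\<forall>j\<in>vert M. cell M j \<noteq> {} \<and> cell M j \<in> sets borel) \<and>
     disjoint_family_on (cell M) (vert M) \<and> (\<Union>j\<in>vert M. cell M j) = UNIV \<and>
     range (ini M) = vert M \<and> range (ter M) \<subseteq> vert M \<and>
     (\<forall>e. wmap M e \<in> borel \<rightarrow>\<^sub>M borel \<and> wmap M e ` cell M (ini M e) \<subseteq> cell M (ter M e)) \<and>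
     (\<forall>e. wprob M e \<in> borel_measurable borel \<and>
          (\<forall>x\<in>cell M (ini M e). 0 \<le> wprob M e x \<and> wprob M e x \<le> 1) \<and>
          (\<exists>x\<in>cell M (ini M e). wprob M e x \<noteq> 0) \<and>
          (\<forall>x. x \<notin> cell M (ini M e) \<longrightarrow> wprob M e x = 0)) \<and>
     (\<forall>j\<in>vert M. \<forall>x\<in>cell M j. (\<Sum>\<^sub>\<infinity>e\<in>{e. ini M e = j}. ennreal (wprob M e x)) = 1)"

definition contractive :: "('k::complete_space, 'e::countable) markov_system \<Rightarrow> real \<Rightarrow> bool" where
  "contractive M a \<longleftrightarrow> 0 < a \<and> a < 1 \<and>
     (\<forall>j\<in>vert M. \<forall>x\<in>cell M j. \<forall>y\<in>cell M j.
        (\<Sum>\<^sub>\<infinity>e\<in>{e. ini M e = j}. ennreal (wprob M e x * dist (wmap M e x) (wmap M e y)))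
          \<le> ennreal (a * dist x y))"

definition uniformly_continuous_system ::
    "('k::complete_space, 'e::countable) markov_system \<Rightarrow> bool" where
  "uniformly_continuous_system M \<longleftrightarrow>
     (\<forall>e. uniformly_continuous_on (cell M (ini M e)) (wmap M e) \<and>
          uniformly_continuous_on (cell M (ini M e)) (wprob M e))"

definition dominating_chain :: "('k::complete_space, 'e::countable) markov_system \<Rightarrow> bool" where
  "dominating_chain M \<longleftrightarrow>
     (\<forall>j\<in>vert M. (\<Sum>\<^sub>\<infinity>e\<in>{e. ini M e = j}. SUP x\<in>cell M j. ennreal (wprob M e x)) < \<infinity>)"

definition bconst ::
    "('k::complete_space, 'e::countable) markov_system \<Rightarrow> (nat \<Rightarrow> 'k) \<Rightarrow> ennreal" where
  "bconst M xs =
     (SUP j\<in>vert M. SUP x\<in>cell M j.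
        \<Sum>\<^sub>\<infinity>e\<in>{e. ini M e = j}.
          ennreal (wprob M e x * dist (wmap M e (xs (ini M e))) (xs (ter M e))))"


section \<open>The Markov operator and invariant measures\<close>

definition markov_op ::
    "('k::complete_space, 'e::countable) markov_system \<Rightarrow> ('k \<Rightarrow> ennreal) \<Rightarrow> 'k \<Rightarrow> ennreal" where
  "markov_op M f x = (\<Sum>\<^sub>\<infinity>e. ennreal (wprob M e x) * f (wmap M e x))"

definition dual_op ::
    "('k::complete_space, 'e::countable) markov_system \<Rightarrow> 'k measure \<Rightarrow> 'k measure" where
  "dual_op M \<nu> = measure_of UNIV (sets borel) (\<lambda>A. \<integral>\<^sup>+x. markov_op M (indicator A) x \<partial>\<nu>)"

lemma infsum_eq_nn_integral_count_space:
  fixes f :: "'a \<Rightarrow> ennreal"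
  assumes "countable A"
  shows "infsum f A = (\<integral>\<^sup>+x. f x \<partial>count_space A)"
proof -
  have *: "(\<Sum>\<^sub>\<infinity>x\<in>B. g x) = (\<integral>\<^sup>+x. g x \<partial>count_space B)" for g :: "nat \<Rightarrow> ennreal" and B
  proof -
    have "(\<Sum>\<^sub>\<infinity>x\<in>B. g x) = (\<Sum>\<^sub>\<infinity>x. g x * indicator B x)"
      by (rule infsum_cong_neutral) (auto simp: indicator_def)
    also have "\<dots> = (\<Sum>x. g x * indicator B x)"
      by (rule sums_unique[OF has_sum_imp_sums[OF has_sum_infsum]])
         (rule nonneg_summable_on_complete, simp)
    also have "\<dots> = (\<integral>\<^sup>+x. g x * indicator B x \<partial>count_space UNIV)"
      by (simp add: nn_integral_count_space_nat)
    also have "\<dots> = (\<integral>\<^sup>+x. g x \<partial>count_space B)"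
      by (simp add: nn_integral_count_space_indicator)
    finally show ?thesis .
  qed
  have bij: "bij_betw (to_nat_on A) A (to_nat_on A ` A)"
    using assms by (simp add: inj_on_imp_bij_betw inj_on_to_nat_on)
  have "infsum f A = infsum (\<lambda>n. f (from_nat_into A n)) (to_nat_on A ` A)"
    using assms by (subst infsum_reindex) (auto simp: inj_on_to_nat_on o_def intro!: infsum_cong)
  also have "\<dots> = (\<integral>\<^sup>+n. f (from_nat_into A n) \<partial>count_space (to_nat_on A ` A))"
    by (rule *)
  also have "\<dots> = (\<integral>\<^sup>+x. f (from_nat_into A (to_nat_on A x)) \<partial>count_space A)"
    by (rule nn_integral_bij_count_space[OF bij, symmetric])
  also have "\<dots> = (\<integral>\<^sup>+x. f x \<partial>count_space A)"
    using assms by (intro nn_integral_cong) simp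
  finally show ?thesis .
qed

text \<open>The dual operator is determined by its values on sets, and the duality holds for all
  Borel functions.\<close>

lemma nn_integral_dual_op:
  assumes M: "countable_markov_system M" and \<nu>: "sets \<nu> = sets borel"
    and f: "f \<in> borel_measurable borel"
  shows "(\<integral>\<^sup>+x. f x \<partial>dual_op M \<nu>) = (\<integral>\<^sup>+x. markov_op M f x \<partial>\<nu>)"
proof -
  have w: "wmap M e \<in> borel \<rightarrow>\<^sub>M borel" and p: "wprob M e \<in> borel_measurable borel" for e
    using M by (auto simp: countable_markov_system_def)
  note [measurable] = w p and [measurable_cong] = \<nu>
  have sp: "space \<nu> = UNIV" using sets_eq_imp_space_eq[OF \<nu>] by simp
  have eq: "(\<integral>\<^sup>+x. markov_op M g x \<partial>\<nu>) =
      (\<integral>\<^sup>+e. (\<integral>\<^sup>+x. ennreal (wprob M e x) * g (wmap M e x) \<partial>\<nu>) \<partial>count_space UNIV)"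
    if [measurable]: "g \<in> borel_measurable borel" for g
    unfolding markov_op_def
    by (subst infsum_eq_nn_integral_count_space)
       (auto intro!: nn_integral_count_space_nn_integral)
  have s_borel: "sigma_sets UNIV (sets (borel :: 'a measure)) = sets borel"
    using sets.sigma_sets_eq[of "borel :: 'a measure"] by simp
  have em: "emeasure (dual_op M \<nu>) A = (\<integral>\<^sup>+x. markov_op M (indicator A) x \<partial>\<nu>)"
    if A: "A \<in> sets borel" for A
    unfolding dual_op_def
  proof (rule emeasure_measure_of_sigma[OF _ _ _ A])
    show "sigma_algebra UNIV (sets (borel :: 'a measure))"
      by (metis sets.sigma_algebra_axioms space_borel)
    show "positive (sets borel) (\<lambda>A. \<integral>\<^sup>+x. markov_op M (indicator A) x \<partial>\<nu>)"
      by (simp add: positive_def markov_op_def)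
    show "countably_additive (sets borel) (\<lambda>A. \<integral>\<^sup>+x. markov_op M (indicator A) x \<partial>\<nu>)"
    proof (rule countably_additiveI)
      fix B :: "nat \<Rightarrow> 'a set"
      assume B: "range B \<subseteq> sets borel" "disjoint_family B"
      have [measurable]: "B n \<in> sets borel" for n using B(1) by auto
      have "(\<integral>\<^sup>+x. markov_op M (indicator (\<Union>n. B n)) x \<partial>\<nu>)
          = (\<integral>\<^sup>+e. (\<integral>\<^sup>+x. (\<Sum>n. ennreal (wprob M e x) * indicator (B n) (wmap M e x)) \<partial>\<nu>)
               \<partial>count_space UNIV)"
        by (subst eq) (simp_all add: suminf_indicator[OF B(2), symmetric])
      also have "\<dots> = (\<Sum>n. \<integral>\<^sup>+x. markov_op M (indicator (B n)) x \<partial>\<nu>)"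
        by (simp add: eq nn_integral_suminf del: ennreal_suminf_cmult)
      finally show "(\<Sum>n. \<integral>\<^sup>+x. markov_op M (indicator (B n)) x \<partial>\<nu>)
          = (\<integral>\<^sup>+x. markov_op M (indicator (\<Union>n. B n)) x \<partial>\<nu>)" by simp
    qed
  qed
  have [measurable_cong]: "sets (dual_op M \<nu>) = sets borel"
    by (simp add: dual_op_def sets_measure_of s_borel)
  show ?thesis
    using f
  proof (induction rule: borel_measurable_induct)
    case (cong f g)
    then have "f = g" by (intro ext) simp
    then show ?case using cong by simp
  next
    case (set A)
    then show ?case by (simp add: em)
  next
    case (mult u c)
    note [measurable] = mult(2)
    have "(\<integral>\<^sup>+x. markov_op M (\<lambda>x. c * u x) x \<partial>\<nu>) =
        (\<integral>\<^sup>+e. (\<integral>\<^sup>+x. c * (ennreal (wprob M e x) * u (wmap M e x)) \<partial>\<nu>) \<partial>count_space UNIV)"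
      by (subst eq) (simp_all add: ac_simps)
    also have "\<dots> = c * (\<integral>\<^sup>+x. markov_op M u x \<partial>\<nu>)"
      by (simp add: nn_integral_cmult eq)
    finally show ?case using mult by (simp add: nn_integral_cmult)
  next
    case (add u v)
    note [measurable] = add.hyps(1,2,3)
    show ?case using add.IH
      by (subst nn_integral_add) (simp_all add: eq nn_integral_add distrib_left)
  next
    case (seq U)
    note [measurable] = seq(1)
    have inc: "incseq U" by fact
    have inc': "incseq (\<lambda>i x. ennreal (wprob M e x) * U i (wmap M e x))" for e
      using inc by (auto simp: incseq_def le_fun_def intro!: mult_left_mono)
    have sup: "(SUP i. U i) = (\<lambda>x. SUP i. U i x)" by (auto simp: fun_eq_iff image_image)
    have [measurable]: "(\<lambda>x. SUP i. U i x) \<in> borel_measurable borel" by measurable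
    have "(\<integral>\<^sup>+x. (SUP i. U i x) \<partial>dual_op M \<nu>) = (SUP i. \<integral>\<^sup>+x. U i x \<partial>dual_op M \<nu>)"
      by (rule nn_integral_monotone_convergence_SUP[OF inc]) measurable
    also have "\<dots> = (SUP i. \<integral>\<^sup>+x. markov_op M (U i) x \<partial>\<nu>)"
      using seq by simp
    also have "\<dots> = (SUP i. \<integral>\<^sup>+e. (\<integral>\<^sup>+x. ennreal (wprob M e x) * U i (wmap M e x) \<partial>\<nu>)
        \<partial>count_space UNIV)"
      by (simp add: eq)
    also have "\<dots> = (\<integral>\<^sup>+e. (SUP i. \<integral>\<^sup>+x. ennreal (wprob M e x) * U i (wmap M e x) \<partial>\<nu>)
        \<partial>count_space UNIV)"
      using inc'
      by (intro nn_integral_monotone_convergence_SUP[symmetric])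
         (auto simp: incseq_def le_fun_def intro!: nn_integral_mono)
    also have "\<dots> = (\<integral>\<^sup>+e. (\<integral>\<^sup>+x. (SUP i. ennreal (wprob M e x) * U i (wmap M e x)) \<partial>\<nu>)
        \<partial>count_space UNIV)"
      by (intro nn_integral_cong nn_integral_monotone_convergence_SUP[OF inc', symmetric]) measurable
    also have "\<dots> = (\<integral>\<^sup>+x. markov_op M (\<lambda>x. SUP i. U i x) x \<partial>\<nu>)"
      by (simp add: eq SUP_mult_left_ennreal)
    finally show ?case unfolding sup .
  qed
qed

definition borel_prob :: "'k::complete_space measure set" where
  "borel_prob = {\<mu>. prob_space \<mu> \<and> sets \<mu> = sets borel}"

definition invariant_measures ::
    "('k::complete_space, 'e::countable) markov_system \<Rightarrow> 'k measure set" where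
  "invariant_measures M = {\<mu> \<in> borel_prob. dual_op M \<mu> = \<mu>}"

text \<open>The averaged occupation measure on the vertex set (meaningful for \<open>n \<ge> 1\<close>).\<close>

definition occupation ::
    "('k::complete_space, 'e::countable) markov_system \<Rightarrow> 'k \<Rightarrow> nat \<Rightarrow> nat measure" where
  "occupation M x n =
     point_measure (vert M)
       (\<lambda>j. ennreal (1 / real n) * (\<Sum>k=1..n. emeasure ((dual_op M ^^ k) (return borel x)) (cell M j)))"

definition uniformly_tight ::
    "('k::complete_space, 'e::countable) markov_system \<Rightarrow> 'k \<Rightarrow> bool" where
  "uniformly_tight M x \<longleftrightarrow>
     (\<forall>\<epsilon>>0::real. \<exists>V\<subseteq>vert M. finite V \<and>
        (\<forall>n\<ge>1. emeasure (occupation M x n) (vert M - V) < ennreal \<epsilon>))"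


section \<open>The code space\<close>

text \<open>
  The one-point compactification of the discrete space \<open>E\<close> lives on \<open>'e option\<close>, with \<open>None\<close> in
  the role of infinity.  The index type \<open>'i\<close> is \<open>int\<close> for the two-sided space; for the one-sided
  space it is \<open>nat\<close>, where position \<open>k\<close> holds the letter with number \<open>k + 1\<close>.
\<close>

definition code_topology :: "('i \<Rightarrow> 'e::countable option) topology" where
  "code_topology =
     product_topology (\<lambda>_. Alexandroff_compactification (discrete_topology UNIV)) UNIV"

definition code_borel :: "('i \<Rightarrow> 'e::countable option) measure" where
  "code_borel = sigma (topspace code_topology) {U. openin code_topology U}"

primrec ini_opt :: "('k, 'e) markov_system \<Rightarrow> 'e option \<Rightarrow> nat" where
  "ini_opt M None = 1"
| "ini_opt M (Some e) = ini M e"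

primrec ter_opt :: "('k, 'e) markov_system \<Rightarrow> 'e option \<Rightarrow> nat" where
  "ter_opt M None = 1"
| "ter_opt M (Some e) = ter M e"

primrec wmap_opt :: "('k, 'e) markov_system \<Rightarrow> 'e option \<Rightarrow> 'k \<Rightarrow> 'k" where
  "wmap_opt M None = id"
| "wmap_opt M (Some e) = wmap M e"

primrec wprob_opt :: "('k, 'e) markov_system \<Rightarrow> 'e option \<Rightarrow> 'k \<Rightarrow> real" where
  "wprob_opt M None = (\<lambda>_. 0)"
| "wprob_opt M (Some e) = wprob M e"

definition cylinder :: "int \<Rightarrow> 'e option list \<Rightarrow> (int \<Rightarrow> 'e option) set" where
  "cylinder m es = {\<sigma>. \<forall>k<length es. \<sigma> (m + int k) = es ! k}"

definition cylinder_plus :: "'e option list \<Rightarrow> (nat \<Rightarrow> 'e option) set" where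
  "cylinder_plus es = {\<sigma>. \<forall>k<length es. \<sigma> k = es ! k}"

definition shift :: "(int \<Rightarrow> 'e option) \<Rightarrow> int \<Rightarrow> 'e option" where
  "shift \<sigma> = (\<lambda>n. \<sigma> (n + 1))"

definition shift_invariant :: "(int \<Rightarrow> 'e::countable option) measure set" where
  "shift_invariant =
     {\<Lambda>. prob_space \<Lambda> \<and> sets \<Lambda> = sets code_borel \<and> distr \<Lambda> code_borel shift = \<Lambda>}"

text \<open>The \<open>\<sigma>\<close>-algebra generated by the cylinders over the coordinates \<open>m, \<dots>, 0\<close> with \<open>m \<le> 0\<close>.\<close>

definition past :: "(int \<Rightarrow> 'e::countable option) measure" where
  "past = sigma UNIV {cylinder (- int l) es |l es. length es = Suc l}"

definition is_path :: "('k, 'e) markov_system \<Rightarrow> 'e list \<Rightarrow> bool" where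
  "is_path M es \<longleftrightarrow> (\<forall>k. Suc k < length es \<longrightarrow> ini M (es ! Suc k) = ter M (es ! k))"

definition SigmaG :: "('k, 'e) markov_system \<Rightarrow> (int \<Rightarrow> 'e option) set" where
  "SigmaG M = {\<sigma>. \<forall>n. \<sigma> n \<noteq> None \<and> ini_opt M (\<sigma> (n + 1)) = ter_opt M (\<sigma> n)}"

definition code_dist :: "(int \<Rightarrow> 'e option) \<Rightarrow> (int \<Rightarrow> 'e option) \<Rightarrow> real" where
  "code_dist \<sigma> \<sigma>' =
     (if \<sigma> = \<sigma>' then 0
      else (1 / 2) ^ (GREATEST k::nat. \<forall>i. \<bar>i\<bar> < int k \<longrightarrow> \<sigma> i = \<sigma>' i))"

primrec path_prob :: "('k, 'e) markov_system \<Rightarrow> 'e option list \<Rightarrow> 'k \<Rightarrow> real" where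
  "path_prob M [] x = 1"
| "path_prob M (e # es) x = wprob_opt M e x * path_prob M es (wmap_opt M e x)"

definition path_measure ::
    "('k::complete_space, 'e::countable) markov_system \<Rightarrow> 'k \<Rightarrow> (nat \<Rightarrow> 'e option) measure" where
  "path_measure M x =
     (THE P. prob_space P \<and> sets P = sets code_borel \<and>
        (\<forall>es. es \<noteq> [] \<longrightarrow> emeasure P (cylinder_plus es) = ennreal (path_prob M es x)))"

definition Phi ::
    "('k::complete_space, 'e::countable) markov_system \<Rightarrow> 'k measure \<Rightarrow> (int \<Rightarrow> 'e option) measure" where
  "Phi M \<mu> =
     (THE \<Lambda>. prob_space \<Lambda> \<and> sets \<Lambda> = sets code_borel \<and>
        (\<forall>m\<le>0. \<forall>es. es \<noteq> [] \<longrightarrow>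
           emeasure \<Lambda> (cylinder m es) = (\<integral>\<^sup>+x. ennreal (path_prob M es x) \<partial>\<mu>)))"


section \<open>The coding map\<close>

text \<open>\<open>back_comp M \<sigma> n\<close> is the composition of the maps with labels \<open>\<sigma> 0, \<sigma> (-1), \<dots>, \<sigma> (-n)\<close>, the
  last of these being applied first.\<close>

primrec back_comp :: "('k, 'e) markov_system \<Rightarrow> (int \<Rightarrow> 'e option) \<Rightarrow> nat \<Rightarrow> 'k \<Rightarrow> 'k" where
  "back_comp M \<sigma> 0 = wmap_opt M (\<sigma> 0)"
| "back_comp M \<sigma> (Suc n) = back_comp M \<sigma> n \<circ> wmap_opt M (\<sigma> (- int (Suc n)))"

definition coding_approx ::
    "('k, 'e) markov_system \<Rightarrow> (nat \<Rightarrow> 'k) \<Rightarrow> (int \<Rightarrow> 'e option) \<Rightarrow> nat \<Rightarrow> 'k" where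
  "coding_approx M xs \<sigma> n = back_comp M \<sigma> n (xs (ini_opt M (\<sigma> (- int n))))"

definition coding_domain ::
    "('k::complete_space, 'e::countable) markov_system \<Rightarrow> (nat \<Rightarrow> 'k) \<Rightarrow> (int \<Rightarrow> 'e option) set" where
  "coding_domain M xs = {\<sigma> \<in> SigmaG M. convergent (coding_approx M xs \<sigma>)}"

definition coding ::
    "('k::complete_space, 'e::countable) markov_system \<Rightarrow> (nat \<Rightarrow> 'k) \<Rightarrow> (int \<Rightarrow> 'e option) \<Rightarrow> 'k" where
  "coding M xs \<sigma> =
     (if \<sigma> \<in> coding_domain M xs then lim (coding_approx M xs \<sigma>) else xs (ter_opt M (\<sigma> 0)))"


section \<open>Equilibrium and asymptotic states\<close>

definition equilibrium_states ::
    "('k::complete_space, 'e::countable) markov_system \<Rightarrow> (nat \<Rightarrow> 'k) \<Rightarrow>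
      (int \<Rightarrow> 'e option) measure set" where
  "equilibrium_states M xs =
     {\<Lambda> \<in> shift_invariant. emeasure \<Lambda> (coding_domain M xs) = 1 \<and>
        (\<forall>e. AE \<sigma> in \<Lambda>.
           real_cond_exp \<Lambda> past (indicator (cylinder 1 [Some e])) \<sigma> = wprob M e (coding M xs \<sigma>))}"

definition T_set :: "('k, 'e) markov_system \<Rightarrow> nat \<Rightarrow> (int \<Rightarrow> 'e option) set" where
  "T_set M j = {\<sigma> \<in> SigmaG M. ter_opt M (\<sigma> 0) = j}"

definition wprob_ext ::
    "('k::complete_space, 'e::countable) markov_system \<Rightarrow> 'e \<Rightarrow> 'k \<Rightarrow> real" where
  "wprob_ext M e =
     (THE g. continuous_on (closure (cell M (ini M e))) g \<and>
        (\<forall>x\<in>cell M (ini M e). g x = wprob M e x) \<and>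
        (\<forall>x. x \<notin> closure (cell M (ini M e)) \<longrightarrow> g x = 0))"

definition asymptotic_states ::
    "('k::complete_space, 'e::countable) markov_system \<Rightarrow> (nat \<Rightarrow> 'k) \<Rightarrow>
      (int \<Rightarrow> 'e option) measure set" where
  "asymptotic_states M xs =
     {\<Lambda> \<in> shift_invariant. emeasure \<Lambda> (coding_domain M xs) = 1 \<and>
        (\<forall>e. AE \<sigma> in \<Lambda>.
           real_cond_exp \<Lambda> past (indicator (cylinder 1 [Some e])) \<sigma>
             = wprob_ext M e (coding M xs \<sigma>) * indicator (T_set M (ini M e)) \<sigma>)}"

end

theory Submission
  imports Defs "HOL-Probability.Projective_Limit"
begin

text \<open>
  The theorem rests on one estimate in mean.  Let a random path be started with law \<open>\<nu>\<close> on \<open>K\<close>, let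
  \<open>Z\<close> be the point that it has reached, and let \<open>gap x\<close> be the distance of \<open>x\<close> to the base point of
  its cell.  Contractivity and the finiteness of \<open>b\<close> give \<open>U gap \<le> a * gap + b\<close>, so \<open>gap Z\<close> stays
  bounded in mean, by some \<open>G\<close>, along the whole path.  The last \<open>n\<close> letters of the path also move a
  base point, to their \<open>word_pt\<close>.  They move it and the true point of the path by the
  same maps, starting in the same cell, so that the expected distance between \<open>Z\<close> and the \<open>word_pt\<close> is
  at most \<open>a ^ n * G\<close>.  Contraction holds only in
  mean, with the weights taken at the true point of the path; this is why approximations of the
  coding map are always compared through \<open>Z\<close> and never directly with each other
  (\<open>dist_word_pt_drop_path_sum\<close>, \<open>word_pt_distance\<close>).

  A shift-invariant measure on the code space is called a \<open>limit_state\<close> if its cylinder masses are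
  limits of the path probabilities averaged over starting laws with a common bound \<open>G\<close>.  By Fatou's
  lemma for sums over words it inherits the estimate.  Hence the approximations of the coding map
  form almost surely a Cauchy sequence, and the \<open>m\<close>-th one has expected distance at most
  \<open>a ^ (m + 1) * G\<close> from the coding \<open>F\<close>.  The true probability of the next letter is \<open>p_e\<close> at \<open>Z\<close>; by
  uniform continuity it may be replaced in mean by \<open>p_e\<close> at the approximation, which converges to
  the continuous extension of \<open>p_e\<close> at \<open>F\<close>, cut off outside \<open>T_set M (ini M e)\<close>.  So every limit state is an
  asymptotic state (\<open>limit_state_asymptotic\<close>).

  All parts follow from this.  For an invariant \<open>\<mu>\<close> the measure \<open>\<Phi>(\<mu>)\<close> is the limit state of a
  constant sequence, with \<open>G = b / (1 - a)\<close>.  That \<open>F(\<Phi>(\<mu>)) = \<mu>\<close> is tested on Lipschitz functions, for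
  which the estimate bounds the difference between the integral at \<open>Z\<close>, which has law \<open>\<mu>\<close>, and
  the integral at the approximation (\<open>distr_Phi_coding\<close>).  Markov's inequality for the distance
  between \<open>F\<close> and its approximations, at a threshold of order \<open>a ^ (m / 2)\<close>, gives the sets on which
  \<open>F\<close> is locally Hoelder continuous: two nearby codes there have a common approximation
  (\<open>Phi_Hoelder_set_compl\<close>, \<open>coding_Hoelder\<close>).

  If \<open>\<Lambda>\<close> is an equilibrium state, then \<open>p_e\<close> at \<open>F\<close> is the conditional probability of the next letter
  \<open>e\<close>, so it is almost surely positive for the letter that occurs.  Therefore \<open>F\<close> lies in the cell
  on which that letter acts continuously, and \<open>F\<close> of the shifted code is the image of \<open>F\<close> under the
  map of the letter.  Iterating this shows that the image of \<open>\<Lambda>\<close> under \<open>F\<close> is invariant and that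
  \<open>\<Phi>\<close> maps it to \<open>\<Lambda>\<close> (\<open>equilibrium_in_Phi_image\<close>).

  For the existence statement the starting laws are the Cesaro means of the orbit of the Dirac measure
  at the given point.  Tightness on the vertices and the dominating chain make the laws of the
  letters tight, so that a subsequence along which all word probabilities converge loses no mass:
  the limits are the cylinder masses of a shift-invariant measure (\<open>asymptotic_state_exists\<close>).  A
  vertex that this measure charges is the end of a letter which occurs with non-vanishing frequency
  along the orbit, hence at arbitrarily late times (\<open>limit_state_paths\<close>).
\<close>

section \<open>The Borel sets of the code space\<close>

lemma topspace_code_topology [simp]: "topspace (code_topology :: ('i \<Rightarrow> 'e::countable option) topology) = UNIV"
proof -
  have "insert None (range Some) = (UNIV :: 'e option set)"
    by (simp add: UNIV_option_conv)
  then show ?thesis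
    by (simp add: code_topology_def)
qed

lemma measurable_countable_typeI:
  fixes f :: "'s \<Rightarrow> 'b::countable"
  assumes "\<And>a. f -` {a} \<inter> space N \<in> sets N"
  shows "f \<in> N \<rightarrow>\<^sub>M count_space UNIV"
  using assms by (subst measurable_count_space_eq2_countable) auto

text \<open>
  The space of letters is compact and countable: the finite letters are isolated, and the point at
  infinity has the complements of the finite sets as neighbourhoods.  So the product topology has a
  countable base of sets that restrict finitely many coordinates, and its Borel sets are the
  product \<open>\<sigma>\<close>-algebra of the discrete one.
\<close>

lemma sets_code_borel:
  "sets (code_borel :: ('i::countable \<Rightarrow> 'e::countable option) measure)
     = sets (PiM UNIV (\<lambda>_. count_space UNIV))"
    (is "sets ?C = sets ?P")
proof -
  let ?X = "Alexandroff_compactification (discrete_topology (UNIV :: 'e set))"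
  have top: "topspace ?X = UNIV"
    by (simp add: UNIV_option_conv)
  have gen: "{U. openin (code_topology :: ('i \<Rightarrow> 'e option) topology) U} \<subseteq> Pow UNIV" by simp
  have open_Some: "openin ?X {Some e}" for e
  proof -
    have "openin (discrete_topology UNIV) {e}" by simp
    then show ?thesis
      unfolding openin_Alexandroff_compactification by (intro disjI1 exI[of _ "{e}"]) simp
  qed
  show ?thesis
  proof (rule set_eqI, rule iffI)
    fix A assume A: "A \<in> sets ?P"
    have id: "(\<lambda>\<sigma>. \<sigma>) \<in> ?C \<rightarrow>\<^sub>M ?P"
    proof (rule measurable_PiM_single')
      fix i :: 'i
      have op: "(\<lambda>\<sigma>. \<sigma> i) -` {Some e} \<in> sets ?C" for e
      proof -
        have "openin (code_topology :: ('i \<Rightarrow> 'e option) topology) {\<sigma> \<in> topspace code_topology. \<sigma> i \<in> {Some e}}"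
          using continuous_map_product_projection[of i UNIV "\<lambda>_. ?X"] open_Some
          unfolding code_topology_def[symmetric] by (intro openin_continuous_map_preimage[where Y = ?X]) auto
        then have "openin (code_topology :: ('i \<Rightarrow> 'e option) topology) ((\<lambda>\<sigma>. \<sigma> i) -` {Some e})"
          by (simp add: vimage_def)
        then show ?thesis unfolding code_borel_def by (simp add: sigma_sets.Basic)
      qed
      show "(\<lambda>\<sigma>. \<sigma> i) \<in> ?C \<rightarrow>\<^sub>M count_space UNIV"
      proof (rule measurable_countable_typeI)
        fix a :: "'e option"
        have sp: "space ?C = UNIV" by (simp add: code_borel_def)
        show "(\<lambda>\<sigma>. \<sigma> i) -` {a} \<inter> space ?C \<in> sets ?C"
        proof (cases a)
          case (Some e) then show ?thesis using op sp by simp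
        next
          case None
          have "(\<lambda>\<sigma>. \<sigma> i) -` {None} = space ?C - (\<Union>e. (\<lambda>\<sigma>. \<sigma> i) -` {Some e})"
            using sp by auto
          also have "\<dots> \<in> sets ?C"
            by (intro sets.compl_sets sets.countable_UN) (use op in auto)
          finally show ?thesis using None sp by simp
        qed
      qed
    qed simp
    have "(\<lambda>\<sigma>. \<sigma>) -` A \<inter> space ?C \<in> sets ?C"
      by (rule measurable_sets[OF id A])
    then show "A \<in> sets ?C" by (simp add: code_borel_def)
  next
    fix A assume A: "A \<in> sets ?C"
    \<comment> \<open>A countable base of the topology on the letters, and the base of the product topology that it
      generates.\<close>
    define Bs :: "'e option set set"
      where "Bs = (\<lambda>e. {Some e}) ` UNIV \<union> (\<lambda>F. insert None (Some ` (- F))) ` {F. finite F}"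
    define C :: "'i set \<Rightarrow> ('i \<Rightarrow> 'e option set) \<Rightarrow> ('i \<Rightarrow> 'e option) set"
      where "C J f = {\<sigma>. \<forall>i\<in>J. \<sigma> i \<in> f i}" for J f
    define BB where "BB = (\<Union>J\<in>{J. finite J}. C J ` (PiE J (\<lambda>_. Bs)))"
    have cBs: "countable Bs"
      unfolding Bs_def by (intro countable_Un countable_image countable_Collect_finite) auto
    have cBB: "countable BB"
      unfolding BB_def
      by (intro countable_UN countable_image countable_PiE cBs countable_Collect_finite) auto
    have BB: "b \<in> sets ?P" if "b \<in> BB" for b
    proof -
      from that obtain J f where J: "finite J" "b = C J f" unfolding BB_def by auto
      have "C J f = {\<sigma> \<in> space ?P. \<forall>i\<in>J. \<sigma> i \<in> f i}" by (auto simp: C_def space_PiM)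
      also have "\<dots> \<in> sets ?P" using J by measurable
      finally show ?thesis using J by simp
    qed
    have "U \<in> sets ?P" if U: "openin (code_topology :: ('i \<Rightarrow> 'e option) topology) U" for U
    proof -
      have "\<exists>b\<in>BB. \<sigma> \<in> b \<and> b \<subseteq> U" if \<sigma>: "\<sigma> \<in> U" for \<sigma>
      proof -
        obtain V where V: "finite {i. V i \<noteq> topspace ?X}" "\<And>i. openin ?X (V i)"
            "\<sigma> \<in> Pi\<^sub>E UNIV V" "Pi\<^sub>E UNIV V \<subseteq> U"
          using U \<sigma> unfolding code_topology_def openin_product_topology_alt by auto
        define J where "J = {i. V i \<noteq> topspace ?X}"
        have "\<exists>b\<in>Bs. \<sigma> i \<in> b \<and> b \<subseteq> V i" for i
        proof (cases "\<sigma> i")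
          case (Some e)
          then have "{Some e} \<in> Bs \<and> \<sigma> i \<in> {Some e} \<and> {Some e} \<subseteq> V i"
            using V(3) by (auto simp: Bs_def PiE_iff) (metis UNIV_I Some)
          then show ?thesis by blast
        next
          case None
          then have "None \<in> V i" using V(3) by (auto simp: PiE_iff) (metis UNIV_I None)
          then obtain F where F: "finite F" "V i = insert None (Some ` (UNIV - F))"
            using V(2)[of i] unfolding openin_Alexandroff_compactification
            by (auto simp: compactin_discrete_topology)
          then have "V i \<in> Bs" unfolding Bs_def by (auto simp: Compl_eq_Diff_UNIV)
          then show ?thesis using \<open>None \<in> V i\<close> None by auto
        qed
        then obtain f where f: "\<And>i. f i \<in> Bs" "\<And>i. \<sigma> i \<in> f i" "\<And>i. f i \<subseteq> V i" by metis
        have "C J (restrict f J) \<in> BB" unfolding BB_def J_def using V(1) f(1) by auto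
        moreover have "\<sigma> \<in> C J (restrict f J)" using f by (auto simp: C_def)
        moreover have "C J (restrict f J) \<subseteq> U"
        proof
          fix \<tau> assume \<tau>: "\<tau> \<in> C J (restrict f J)"
          have "\<tau> i \<in> V i" for i
          proof (cases "i \<in> J")
            case True then show ?thesis using \<tau> f(3) by (auto simp: C_def)
          next
            case False then show ?thesis using top by (auto simp: J_def)
          qed
          then show "\<tau> \<in> U" using V(4) by (auto simp: PiE_iff)
        qed
        ultimately show ?thesis by blast
      qed
      then have "U = \<Union>{b\<in>BB. b \<subseteq> U}" by blast
      moreover have "\<Union>{b\<in>BB. b \<subseteq> U} \<in> sets ?P"
        by (intro sets.countable_Union countable_subset[OF _ cBB]) (use BB in auto)
      ultimately show ?thesis by simp
    qed
    then have "sigma_sets (space ?P) {U. openin (code_topology :: ('i \<Rightarrow> 'e option) topology) U} \<subseteq> sets ?P"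
      by (intro sets.sigma_sets_subset) auto
    then show "A \<in> sets ?P"
      using A gen by (auto simp: code_borel_def space_PiM)
  qed
qed

lemma space_code_borel [simp]: "space code_borel = UNIV"
  by (simp add: code_borel_def)

lemma measurable_code_coordinate [measurable]:
  "(\<lambda>\<sigma>. \<sigma> i) \<in> (code_borel :: ('i::countable \<Rightarrow> 'e::countable option) measure) \<rightarrow>\<^sub>M count_space UNIV"
  using measurable_component_singleton[of i UNIV "\<lambda>_. count_space (UNIV :: 'e option set)"]
  by (simp add: measurable_cong_sets[OF sets_code_borel refl])

lemma measurable_into_code_borel:
  fixes f :: "'s \<Rightarrow> 'i::countable \<Rightarrow> 'e::countable option"
  assumes "\<And>i. (\<lambda>x. f x i) \<in> M \<rightarrow>\<^sub>M count_space UNIV"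
  shows "f \<in> M \<rightarrow>\<^sub>M code_borel"
  unfolding measurable_cong_sets[OF refl sets_code_borel]
  by (rule measurable_PiM_single') (use assms in auto)

section \<open>Sums over words\<close>

abbreviation (input) words :: "nat \<Rightarrow> 'a list set" where
  "words n \<equiv> {es. length es = n}"

lemma nn_integral_words_0:
  "(\<integral>\<^sup>+es. f es \<partial>count_space (words 0)) = f []"
  by (simp add: nn_integral_count_space_finite)

lemma nn_integral_words_Suc:
  fixes f :: "'a::countable list \<Rightarrow> ennreal"
  shows "(\<integral>\<^sup>+es. f es \<partial>count_space (words (Suc n)))
    = (\<integral>\<^sup>+e. (\<integral>\<^sup>+es. f (e # es) \<partial>count_space (words n)) \<partial>count_space UNIV)"
proof -
  have bij: "bij_betw (\<lambda>p. fst p # snd p) UNIV {es :: 'a list. es \<noteq> []}"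
    by (rule bij_betwI[where g = "\<lambda>es. (hd es, tl es)"]) auto
  have "(\<integral>\<^sup>+e. (\<integral>\<^sup>+es. f (e # es) \<partial>count_space (words n)) \<partial>count_space UNIV)
    = (\<integral>\<^sup>+e. (\<integral>\<^sup>+es. f (e # es) * indicator (words n) es \<partial>count_space UNIV) \<partial>count_space UNIV)"
    by (simp add: nn_integral_count_space_indicator)
  also have "\<dots> = (\<integral>\<^sup>+p. f (fst p # snd p) * indicator (words n) (snd p) \<partial>count_space UNIV)"
    using nn_integral_fst_count_space[of "\<lambda>p. f (fst p # snd p) * indicator (words n) (snd p)"] by simp
  also have "\<dots> = (\<integral>\<^sup>+p. (f (fst p # snd p) * indicator (words (Suc n)) (fst p # snd p)) \<partial>count_space UNIV)"
    by (intro nn_integral_cong) (simp add: indicator_def)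
  also have "\<dots> = (\<integral>\<^sup>+es. f es * indicator (words (Suc n)) es \<partial>count_space {es. es \<noteq> []})"
    by (rule nn_integral_bij_count_space[OF bij])
  also have "\<dots> = (\<integral>\<^sup>+es. f es * indicator (words (Suc n)) es \<partial>count_space UNIV)"
    by (subst nn_integral_count_space_indicator) (auto intro!: nn_integral_cong simp: indicator_def)
  also have "\<dots> = (\<integral>\<^sup>+es. f es \<partial>count_space (words (Suc n)))"
    by (simp add: nn_integral_count_space_indicator)
  finally show ?thesis ..
qed

lemma nn_integral_words_append:
  fixes f :: "'a::countable list \<Rightarrow> ennreal"
  shows "(\<integral>\<^sup>+es. f es \<partial>count_space (words (m + n)))
    = (\<integral>\<^sup>+u. (\<integral>\<^sup>+v. f (u @ v) \<partial>count_space (words n)) \<partial>count_space (words m))"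
proof (induction m arbitrary: f)
  case 0 then show ?case by (simp add: nn_integral_count_space_finite)
next
  case (Suc m) then show ?case by (simp add: nn_integral_words_Suc)
qed

lemma nn_integral_words_snoc:
  fixes f :: "'a::countable list \<Rightarrow> ennreal"
  shows "(\<integral>\<^sup>+es. f es \<partial>count_space (words (Suc n)))
    = (\<integral>\<^sup>+es. (\<integral>\<^sup>+e. f (es @ [e]) \<partial>count_space UNIV) \<partial>count_space (words n))"
proof -
  have "(\<integral>\<^sup>+v. f (u @ v) \<partial>count_space (words (Suc 0))) = (\<integral>\<^sup>+e. f (u @ [e]) \<partial>count_space UNIV)" for u
    by (subst nn_integral_words_Suc) (simp add: nn_integral_count_space_finite)
  then show ?thesis using nn_integral_words_append[of n "Suc 0" f] by simp
qed

section \<open>Measures determined by nested windows\<close>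

text \<open>
  If each window determines all earlier ones, then two of the sets \<open>X n -` {c}\<close> are disjoint or
  nested, so that they form, with the empty set, a generator stable under intersection.  This serves
  for the one-sided and the two-sided code space and for the past of a code.
\<close>

lemma measure_eqI_nested:
  fixes X :: "nat \<Rightarrow> 's \<Rightarrow> 'b::countable"
  assumes P: "sets P = sigma_sets UNIV {X n -` {c} |n c. True}"
    and Q: "sets Q = sigma_sets UNIV {X n -` {c} |n c. True}"
    and fin: "finite_measure P"
    and nested: "\<And>n x y. X (Suc n) x = X (Suc n) y \<Longrightarrow> X n x = X n y"
    and eq: "\<And>n c. emeasure P (X n -` {c}) = emeasure Q (X n -` {c})"
  shows "P = Q"
proof -
  interpret P: finite_measure P by (rule fin)
  let ?E = "{X n -` {c} |n c. True}"
  have le: "X n x = X n y" if "n \<le> m" "X m x = X m y" for n m x y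
    using that by (induction m rule: dec_induct) (auto dest: nested)
  have sig: "sigma_sets UNIV (insert {} ?E) = sigma_sets UNIV ?E"
  proof
    show "sigma_sets UNIV (insert {} ?E) \<subseteq> sigma_sets UNIV ?E"
      by (rule sigma_sets_mono) (auto intro: sigma_sets.Empty sigma_sets.Basic)
    show "sigma_sets UNIV ?E \<subseteq> sigma_sets UNIV (insert {} ?E)"
      by (rule sigma_sets_mono') auto
  qed
  have mem: "X n -` {c} \<inter> X m -` {d} \<in> insert {} ?E" if "n \<le> m" for n m c d
  proof (cases "X n -` {c} \<inter> X m -` {d} = {}")
    case False
    then obtain x where x: "X n x = c" "X m x = d" by auto
    have "X n y = c" if "X m y = d" for y
      using le[OF \<open>n \<le> m\<close>, of y x] x that by simp
    then have "X n -` {c} \<inter> X m -` {d} = X m -` {d}" by auto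
    then show ?thesis by blast
  qed simp
  show ?thesis
  proof (rule measure_eqI_generator_eq_countable[where \<Omega> = UNIV and E = "insert {} ?E"
        and A = "range (\<lambda>c. X 0 -` {c})"])
    show "Int_stable (insert {} ?E)"
    proof (rule Int_stableI)
      fix a b assume "a \<in> insert {} ?E" "b \<in> insert {} ?E"
      then show "a \<inter> b \<in> insert {} ?E"
      proof (cases "a = {} \<or> b = {}")
        case False
        then obtain n c m d where "a = X n -` {c}" "b = X m -` {d}"
          using \<open>a \<in> insert {} ?E\<close> \<open>b \<in> insert {} ?E\<close> by auto
        then show ?thesis using mem[of n m c d] mem[of m n d c] by (cases "n \<le> m") (auto simp: Int_commute)
      qed auto
    qed
    show "range (\<lambda>c. X 0 -` {c}) \<subseteq> insert {} ?E" by blast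
    show "emeasure P a = emeasure Q a" if "a \<in> insert {} ?E" for a using that eq by auto
    show "sets P = sigma_sets UNIV (insert {} ?E)" unfolding sig by (rule P)
    show "sets Q = sigma_sets UNIV (insert {} ?E)" unfolding sig by (rule Q)
  qed auto
qed

lemma sets_PiM_windows:
  fixes W :: "nat \<Rightarrow> 'i list"
  assumes "\<And>i. \<exists>n. i \<in> set (W n)"
  shows "sets (PiM UNIV (\<lambda>_. count_space (UNIV :: 'a::countable set)))
    = sigma_sets UNIV {(\<lambda>\<sigma>. map \<sigma> (W n)) -` {c} |n c. True}" (is "sets ?P = sigma_sets _ ?E")
proof
  let ?S = "sigma UNIV ?E"
  have comp: "(\<lambda>\<sigma>. \<sigma> i) \<in> ?S \<rightarrow>\<^sub>M count_space UNIV" for i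
  proof (rule measurable_countable_typeI)
    fix a :: 'a
    obtain n where n: "i \<in> set (W n)" using assms by auto
    then obtain k where k: "k < length (W n)" "W n ! k = i" by (auto simp: in_set_conv_nth)
    have "(\<lambda>\<sigma>. \<sigma> i) -` {a} \<inter> space ?S = (\<Union>c\<in>{c. length c = length (W n) \<and> c ! k = a}. (\<lambda>\<sigma>. map \<sigma> (W n)) -` {c})"
      using k by auto
    also have "\<dots> \<in> sets ?S"
      by (intro sets.countable_UN') auto
    finally show "(\<lambda>\<sigma>. \<sigma> i) -` {a} \<inter> space ?S \<in> sets ?S" .
  qed
  have id: "(\<lambda>\<sigma>. \<sigma>) \<in> ?S \<rightarrow>\<^sub>M ?P"
    by (rule measurable_PiM_single') (use comp in auto)
  show "sets ?P \<subseteq> sigma_sets UNIV ?E"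
    using measurable_sets[OF id] by auto
  have "(\<lambda>\<sigma>. map \<sigma> (W n)) -` {c} \<in> sets ?P" for n c
  proof -
    have "(\<lambda>\<sigma>. map \<sigma> (W n)) -` {c}
      = (if length c = length (W n) then {\<sigma> \<in> space ?P. \<forall>k<length (W n). \<sigma> (W n ! k) = c ! k} else {})"
      by (auto simp: list_eq_iff_nth_eq space_PiM)
    then show ?thesis by simp
  qed
  then show "sigma_sets UNIV ?E \<subseteq> sets ?P"
    using sets.sigma_sets_subset[of ?E ?P] by (auto simp: space_PiM)
qed

lemma measurable_map_window:
  fixes W :: "'i list"
  assumes "\<And>i. i \<in> set W \<Longrightarrow> (\<lambda>\<sigma>. f \<sigma> i) \<in> N \<rightarrow>\<^sub>M count_space (UNIV :: 'a::countable set)"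
  shows "(\<lambda>\<sigma>. map (f \<sigma>) W) \<in> N \<rightarrow>\<^sub>M count_space UNIV"
proof (rule measurable_countable_typeI)
  fix c :: "'a list"
  have "(\<lambda>\<sigma>. map (f \<sigma>) W) -` {c} \<inter> space N
    = (if length c = length W then {\<sigma> \<in> space N. \<forall>k\<in>{..<length W}. f \<sigma> (W ! k) = c ! k} else {})"
    by (auto simp: list_eq_iff_nth_eq)
  also have "\<dots> \<in> sets N"
    using assms by (auto intro!: sets.sets_Collect_finite_All' simp: pred_def)
  finally show "(\<lambda>\<sigma>. map (f \<sigma>) W) -` {c} \<inter> space N \<in> sets N" .
qed

lemma measurable_of_discrete [measurable]: "of_discrete \<in> borel \<rightarrow>\<^sub>M count_space UNIV"
proof (rule measurableI)
  fix A :: "'a set"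
  have "open (of_discrete -` A)" by (rule open_discrete)
  then show "of_discrete -` A \<inter> space borel \<in> sets borel" by simp
qed simp

text \<open>
  Kolmogorov's extension theorem.  The measures \<open>\<nu> n\<close> live on the full product space but only
  their marginals on the window \<open>W n\<close> matter; this avoids products over varying index sets, so
  that a finite window can be filled by padding the words on it.
\<close>

lemma kolmogorov_windows:
  fixes \<nu> :: "nat \<Rightarrow> ('i \<Rightarrow> 'a::countable) measure" and W :: "nat \<Rightarrow> 'i list"
  assumes prob: "\<And>n. prob_space (\<nu> n)"
    and sets: "\<And>n. sets (\<nu> n) = sets (PiM UNIV (\<lambda>_. count_space UNIV))"
    and mono: "\<And>n. set (W n) \<subseteq> set (W (Suc n))" and cover: "\<And>i. \<exists>n. i \<in> set (W n)"
    and cons: "\<And>n c. emeasure (\<nu> (Suc n)) {\<sigma>. map \<sigma> (W n) = c} = emeasure (\<nu> n) {\<sigma>. map \<sigma> (W n) = c}"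
  shows "\<exists>\<Lambda>. prob_space \<Lambda> \<and> sets \<Lambda> = sets (PiM UNIV (\<lambda>_. count_space UNIV)) \<and>
    (\<forall>n c. emeasure \<Lambda> {\<sigma>. map \<sigma> (W n) = c} = emeasure (\<nu> n) {\<sigma>. map \<sigma> (W n) = c})"
proof -
  let ?P = "PiM UNIV (\<lambda>_. count_space UNIV) :: ('i \<Rightarrow> 'a) measure"
  let ?D = "\<lambda>J. PiM J (\<lambda>_. borel) :: ('i \<Rightarrow> 'a discrete) measure"
  note [measurable_cong] = sets
  have sp: "space (\<nu> n) = UNIV" for n
    using sets_eq_imp_space_eq[OF sets] by (simp add: space_PiM)
  have incl: "set (W n) \<subseteq> set (W m)" if "n \<le> m" for n m
    using that by (induction m rule: dec_induct) (use mono in auto)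
  define \<phi> :: "'i set \<Rightarrow> ('i \<Rightarrow> 'a) \<Rightarrow> 'i \<Rightarrow> 'a discrete" where "\<phi> J \<sigma> = (\<lambda>i\<in>J. discrete (\<sigma> i))" for J \<sigma>
  have \<phi>[measurable]: "\<phi> J \<in> ?P \<rightarrow>\<^sub>M ?D J" for J
    unfolding \<phi>_def[abs_def]
    by (intro measurable_restrict measurable_compose[OF measurable_component_singleton[of _ UNIV]]) auto
  have win[measurable]: "(\<lambda>\<sigma>. map \<sigma> (W n)) \<in> ?P \<rightarrow>\<^sub>M count_space UNIV" for n
    by (rule measurable_map_window) simp
  have one: "distr (\<nu> (Suc n)) (?D J) (\<phi> J) = distr (\<nu> n) (?D J) (\<phi> J)" if J: "J \<subseteq> set (W n)" for J n
  proof -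
    \<comment> \<open>The coordinates in \<open>J\<close> are a function of the word seen through the window.\<close>
    define \<psi> where "\<psi> c = \<phi> J (\<lambda>i. c ! (SOME k. k < length (W n) \<and> W n ! k = i))" for c
    have \<psi>: "\<phi> J \<sigma> = \<psi> (map \<sigma> (W n))" for \<sigma>
    proof -
      have "map \<sigma> (W n) ! (SOME k. k < length (W n) \<and> W n ! k = i) = \<sigma> i" if "i \<in> J" for i
      proof -
        have "\<exists>k. k < length (W n) \<and> W n ! k = i" using that J by (auto simp: in_set_conv_nth)
        from someI_ex[OF this] show ?thesis by simp
      qed
      then show ?thesis by (auto simp: \<psi>_def \<phi>_def)
    qed
    have [measurable]: "\<psi> \<in> count_space UNIV \<rightarrow>\<^sub>M ?D J"
      by (auto simp: \<psi>_def \<phi>_def space_PiM)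
    have "distr (\<nu> (Suc n)) (count_space UNIV) (\<lambda>\<sigma>. map \<sigma> (W n)) = distr (\<nu> n) (count_space UNIV) (\<lambda>\<sigma>. map \<sigma> (W n))"
    proof (rule measure_eqI_countable[where A = UNIV])
      fix c :: "'a list"
      have "(\<lambda>\<sigma>. map \<sigma> (W n)) -` {c} = {\<sigma>. map \<sigma> (W n) = c}" by auto
      then show "emeasure (distr (\<nu> (Suc n)) (count_space UNIV) (\<lambda>\<sigma>. map \<sigma> (W n))) {c} =
        emeasure (distr (\<nu> n) (count_space UNIV) (\<lambda>\<sigma>. map \<sigma> (W n))) {c}"
        using cons[of n c] by (simp add: emeasure_distr sp)
    qed auto
    then have "distr (distr (\<nu> (Suc n)) (count_space UNIV) (\<lambda>\<sigma>. map \<sigma> (W n))) (?D J) \<psi>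
        = distr (distr (\<nu> n) (count_space UNIV) (\<lambda>\<sigma>. map \<sigma> (W n))) (?D J) \<psi>" by simp
    moreover have "(\<lambda>\<sigma>. map \<sigma> (W n)) \<in> \<nu> m \<rightarrow>\<^sub>M count_space UNIV" for m by measurable
    ultimately show ?thesis by (simp add: distr_distr comp_def \<psi>[symmetric] del: measurable_count_space_eq1)
  qed
  have steps: "distr (\<nu> m) (?D J) (\<phi> J) = distr (\<nu> n) (?D J) (\<phi> J)" if "J \<subseteq> set (W n)" "n \<le> m" for J n m
    using that(2,1)
  proof (induction m rule: dec_induct)
    case (step m)
    then show ?case using one[of J m] incl[of n m] by auto
  qed simp
  define ix where "ix J = (LEAST n. J \<subseteq> set (W n))" for J
  have ex: "\<exists>n. J \<subseteq> set (W n)" if "finite J" for J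
    using that
  proof induction
    case (insert i J)
    then obtain n where n: "J \<subseteq> set (W n)" by auto
    obtain m where m: "i \<in> set (W m)" using cover by auto
    have "insert i J \<subseteq> set (W (max n m))" using incl[of n "max n m"] incl[of m "max n m"] n m by auto
    then show ?case by blast
  qed auto
  have ix: "J \<subseteq> set (W (ix J))" if "finite J" for J
    unfolding ix_def by (rule LeastI_ex[OF ex[OF that]])
  define PJ where "PJ J = distr (\<nu> (ix J)) (?D J) (\<phi> J)" for J
  have PJ: "PJ J = distr (\<nu> n) (?D J) (\<phi> J)" if "J \<subseteq> set (W n)" for J n
  proof -
    have "finite J" using that finite_subset by blast
    from ix[OF this] show ?thesis
      unfolding PJ_def
      using steps[of J "ix J" n] steps[OF that, of "ix J"] by (cases "ix J \<le> n") auto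
  qed
  have PJ_cons: "PJ J = distr (PJ H) (?D J) (\<lambda>f. restrict f J)" if J: "J \<subseteq> H" "finite H" for J H
  proof -
    have [measurable]: "(\<lambda>f. restrict f J) \<in> ?D H \<rightarrow>\<^sub>M ?D J"
      by (intro measurable_restrict_subset J)
    have "distr (PJ H) (?D J) (\<lambda>f. restrict f J) = distr (\<nu> (ix H)) (?D J) (\<lambda>\<sigma>. restrict (\<phi> H \<sigma>) J)"
      unfolding PJ_def by (subst distr_distr) (simp_all add: comp_def)
    also have "(\<lambda>\<sigma>. restrict (\<phi> H \<sigma>) J) = \<phi> J"
      using J by (auto simp: \<phi>_def restrict_def fun_eq_iff)
    also have "distr (\<nu> (ix H)) (?D J) (\<phi> J) = PJ J"
      using J ix[of H] by (intro PJ[symmetric]) auto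
    finally show "PJ J = distr (PJ H) (?D J) (\<lambda>f. restrict f J)" ..
  qed
  have PJ_prob: "prob_space (PJ J)" for J
    unfolding PJ_def by (intro prob_space.prob_space_distr prob) measurable
  interpret K: polish_projective UNIV PJ
    unfolding polish_projective_def projective_family_def using PJ_cons PJ_prob by blast
  define \<Lambda> where "\<Lambda> = distr K.lim ?P (\<lambda>f i. of_discrete (f i))"
  have [measurable]: "(\<lambda>f i. of_discrete (f i)) \<in> ?D UNIV \<rightarrow>\<^sub>M ?P"
  proof (rule measurable_PiM_single')
    fix i :: 'i
    show "(\<lambda>f. of_discrete (f i)) \<in> ?D UNIV \<rightarrow>\<^sub>M count_space UNIV" by measurable
  qed simp
  have fm: "(\<lambda>f i. of_discrete (f i)) \<in> K.lim \<rightarrow>\<^sub>M ?P"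
    unfolding measurable_cong_sets[OF K.sets_lim refl] by measurable
  have "prob_space \<Lambda>"
    unfolding \<Lambda>_def by (rule K.P.prob_space_distr[OF fm])
  moreover have "emeasure \<Lambda> {\<sigma>. map \<sigma> (W n) = c} = emeasure (\<nu> n) {\<sigma>. map \<sigma> (W n) = c}" for n c
  proof -
    let ?J = "set (W n)"
    define Y where "Y = {f \<in> space (?D ?J). map (\<lambda>i. of_discrete (f i)) (W n) = c}"
    have [measurable]: "(\<lambda>f. of_discrete (f i)) \<in> ?D ?J \<rightarrow>\<^sub>M count_space UNIV" if "i \<in> ?J" for i
      using that by measurable
    have "(\<lambda>f. map (\<lambda>i. of_discrete (f i)) (W n)) \<in> ?D ?J \<rightarrow>\<^sub>M count_space UNIV"
      by (rule measurable_map_window) simp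
    from measurable_sets[OF this, of "{c}"] have Y: "Y \<in> sets (?D ?J)"
      by (simp add: Y_def vimage_def Int_def conj_commute)
    have set_c: "{\<sigma>. map \<sigma> (W n) = c} \<in> sets ?P"
    proof -
      have "{\<sigma>. map \<sigma> (W n) = c} = (\<lambda>\<sigma>. map \<sigma> (W n)) -` {c} \<inter> space ?P"
        by (auto simp: space_PiM)
      then show ?thesis using measurable_sets[OF win, of "{c}" n] by simp
    qed
    have "emeasure \<Lambda> {\<sigma>. map \<sigma> (W n) = c} = emeasure K.lim (prod_emb UNIV (\<lambda>_. borel) ?J Y)"
      unfolding \<Lambda>_def emeasure_distr[OF fm set_c]
      by (auto simp: prod_emb_def Y_def space_PiM intro!: arg_cong[where f = "emeasure K.lim"] cong: map_cong)
    also have "\<dots> = emeasure (PJ ?J) Y"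
      by (rule K.emeasure_lim_emb) (use Y in auto)
    also have "\<dots> = emeasure (\<nu> n) (\<phi> ?J -` Y \<inter> space (\<nu> n))"
      unfolding PJ[OF order_refl] by (rule emeasure_distr) (use Y in measurable)
    also have "\<phi> ?J -` Y \<inter> space (\<nu> n) = {\<sigma>. map \<sigma> (W n) = c}"
      by (auto simp: Y_def \<phi>_def sp space_PiM discrete_inverse cong: map_cong)
    finally show ?thesis .
  qed
  ultimately show ?thesis
    by (intro exI[of _ \<Lambda>]) (auto simp: \<Lambda>_def)
qed

lemma map_eq_iff_nth:
  "length W = length c \<Longrightarrow> map f W = c \<longleftrightarrow> (\<forall>k<length c. f (W ! k) = c ! k)"
  by (simp add: list_eq_iff_nth_eq)

lemma nn_integral_words_point:
  fixes q :: "'a list \<Rightarrow> ennreal"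
  assumes "length c = n"
  shows "(\<integral>\<^sup>+es. q es * indicator {es. es = c} es \<partial>count_space (words n)) = q c"
proof -
  have "(\<integral>\<^sup>+es. q es * indicator {es. es = c} es \<partial>count_space (words n))
      = (\<integral>\<^sup>+es. q es * indicator {c} es \<partial>count_space (words n))" by simp
  also have "\<dots> = q c * emeasure (count_space (words n)) {c}"
    by (rule nn_integral_indicator_singleton) (use assms in auto)
  finally show ?thesis using assms by simp
qed

text \<open>
  Word masses that are consistent for growing windows come from a measure.  The word seen through
  \<open>W n\<close> is distributed by \<open>q\<close> and continued arbitrarily by \<open>pad n\<close>.
\<close>

lemma measure_of_consistent_words:
  fixes q :: "'a::countable list \<Rightarrow> ennreal" and W :: "nat \<Rightarrow> 'i list" and pad :: "nat \<Rightarrow> 'a list \<Rightarrow> 'i \<Rightarrow> 'a"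
  assumes mono: "\<And>n. set (W n) \<subseteq> set (W (Suc n))" and cover: "\<And>i. \<exists>n. i \<in> set (W n)"
    and pad: "\<And>n es. length es = length (W n) \<Longrightarrow> map (pad n es) (W n) = es"
    and total: "\<And>n. (\<integral>\<^sup>+es. q es \<partial>count_space (words (length (W n)))) = 1"
    and cons: "\<And>n c. length c = length (W n) \<Longrightarrow>
      (\<integral>\<^sup>+es. q es * indicator {es. map (pad (Suc n) es) (W n) = c} es \<partial>count_space (words (length (W (Suc n))))) = q c"
  shows "\<exists>\<Lambda>. prob_space \<Lambda> \<and> sets \<Lambda> = sets (PiM UNIV (\<lambda>_. count_space UNIV)) \<and>
    (\<forall>n c. length c = length (W n) \<longrightarrow> emeasure \<Lambda> {\<sigma>. map \<sigma> (W n) = c} = q c)"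
proof -
  let ?P = "PiM UNIV (\<lambda>_. count_space UNIV) :: ('i \<Rightarrow> 'a) measure"
  define D where "D n = density (count_space UNIV) (\<lambda>es. q es * indicator (words (length (W n))) es)" for n
  define \<nu> where "\<nu> n = distr (D n) ?P (pad n)" for n
  have padm: "pad n \<in> D n \<rightarrow>\<^sub>M ?P" for n
    by (auto simp: D_def space_PiM measurable_def sets_density)
  have win: "{\<sigma>. map \<sigma> (W n) = c} \<in> sets ?P" for n c
  proof -
    have "(\<lambda>\<sigma>. map \<sigma> (W n)) \<in> ?P \<rightarrow>\<^sub>M count_space UNIV"
      by (rule measurable_map_window) simp
    from measurable_sets[OF this, of "{c}"] show ?thesis
      by (simp add: vimage_def space_PiM)
  qed
  have em: "emeasure (\<nu> m) {\<sigma>. map \<sigma> (W n) = c}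
    = (\<integral>\<^sup>+es. q es * indicator {es. map (pad m es) (W n) = c} es \<partial>count_space (words (length (W m))))" for m n c
    unfolding \<nu>_def emeasure_distr[OF padm win]
    by (simp add: D_def emeasure_density nn_integral_count_space_indicator)
       (auto intro!: nn_integral_cong simp: indicator_def)
  have "prob_space (\<nu> n)" for n
    unfolding \<nu>_def
  proof (rule prob_space.prob_space_distr[OF _ padm], rule prob_spaceI)
    show "emeasure (D n) (space (D n)) = 1"
      using total[of n] by (simp add: D_def emeasure_density nn_integral_count_space_indicator)
  qed
  moreover have "emeasure (\<nu> n) {\<sigma>. map \<sigma> (W n) = c} = (if length c = length (W n) then q c else 0)" for n c
  proof (cases "length c = length (W n)")
    case True
    have "emeasure (\<nu> n) {\<sigma>. map \<sigma> (W n) = c}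
      = (\<integral>\<^sup>+es. q es * indicator {es. es = c} es \<partial>count_space (words (length (W n))))"
      unfolding em by (intro nn_integral_cong) (simp add: pad indicator_def)
    then show ?thesis using nn_integral_words_point[OF True, of q] True by simp
  next
    case False
    then have "{\<sigma>. map \<sigma> (W n) = c} = {}" by auto
    then show ?thesis using False by simp
  qed
  moreover have "emeasure (\<nu> (Suc n)) {\<sigma>. map \<sigma> (W n) = c} = (if length c = length (W n) then q c else 0)" for n c
  proof (cases "length c = length (W n)")
    case True then show ?thesis unfolding em by (simp add: cons)
  next
    case False
    then have "{\<sigma>. map \<sigma> (W n) = c} = {}" by auto
    then show ?thesis using False by simp
  qed
  moreover have "sets (\<nu> n) = sets ?P" for n by (simp add: \<nu>_def)
  ultimately obtain \<Lambda> where "prob_space \<Lambda>" "sets \<Lambda> = sets ?P"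
      "\<And>n c. emeasure \<Lambda> {\<sigma>. map \<sigma> (W n) = c} = (if length c = length (W n) then q c else 0)"
    using kolmogorov_windows[of \<nu> W] mono cover by auto
  then show ?thesis by (intro exI[of _ \<Lambda>]) auto
qed

lemma nn_integral_words_right_consistent:
  fixes q :: "'a::countable list \<Rightarrow> ennreal"
  assumes "\<And>es. (\<integral>\<^sup>+e. q (es @ [e]) \<partial>count_space UNIV) = q es"
  shows "(\<integral>\<^sup>+es. q es \<partial>count_space (words n)) = q []"
proof (induction n)
  case 0 show ?case by (rule nn_integral_words_0)
next
  case (Suc n) then show ?case by (simp add: nn_integral_words_snoc assms)
qed

lemma one_sided_measure:
  fixes q :: "'e::countable option list \<Rightarrow> ennreal"
  assumes one: "q [] = 1" and right: "\<And>es. (\<integral>\<^sup>+e. q (es @ [e]) \<partial>count_space UNIV) = q es"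
  shows "\<exists>P. prob_space P \<and> sets P = sets code_borel \<and> (\<forall>es. emeasure P (cylinder_plus es) = q es)"
proof -
  have "\<exists>P :: (nat \<Rightarrow> 'e option) measure. prob_space P \<and> sets P = sets (PiM UNIV (\<lambda>_. count_space UNIV)) \<and>
    (\<forall>n c. length c = length [0..<n] \<longrightarrow> emeasure P {\<sigma>. map \<sigma> [0..<n] = c} = q c)"
  proof (rule measure_of_consistent_words[where pad = "\<lambda>n es i. es ! i"])
    show "\<exists>n. i \<in> set [0..<n]" for i :: nat by (rule exI[of _ "Suc i"]) simp
    show "(\<integral>\<^sup>+es. q es \<partial>count_space (words (length [0..<n]))) = 1" for n
      using nn_integral_words_right_consistent[of q] one right by simp
    fix n and c :: "'e option list" assume c: "length c = length [0..<n]"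
    have "map (\<lambda>i. (es @ [e]) ! i) [0..<n] = es" if "length es = n" for es :: "'e option list" and e
      using that by (auto simp: list_eq_iff_nth_eq nth_append)
    then have "(\<integral>\<^sup>+es. (\<integral>\<^sup>+e. q (es @ [e]) * indicator {es. map ((!) es) [0..<n] = c} (es @ [e]) \<partial>count_space UNIV) \<partial>count_space (words n))
      = (\<integral>\<^sup>+es. (\<integral>\<^sup>+e. q (es @ [e]) * indicator {es. es = c} es \<partial>count_space UNIV) \<partial>count_space (words n))"
      by (intro nn_integral_cong) (auto simp: indicator_def)
    also have "\<dots> = q c"
      using c by (simp add: nn_integral_multc right nn_integral_words_point)
    finally show "(\<integral>\<^sup>+es. q es * indicator {es. map ((!) es) [0..<n] = c} es \<partial>count_space (words (length [0..<Suc n]))) = q c"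
      by (simp add: nn_integral_words_snoc)
  qed (auto simp: map_nth)
  then obtain P :: "(nat \<Rightarrow> 'e option) measure" where P: "prob_space P"
      "sets P = sets (PiM UNIV (\<lambda>_. count_space UNIV))"
      "\<forall>n c. length c = length [0..<n] \<longrightarrow> emeasure P {\<sigma>. map \<sigma> [0..<n] = c} = q c"
    by (elim exE conjE)
  have "emeasure P (cylinder_plus c) = q c" for c
  proof -
    have "cylinder_plus c = {\<sigma>. map \<sigma> [0..<length c] = c}"
      by (simp add: cylinder_plus_def map_eq_iff_nth)
    then show ?thesis using P(3) by simp
  qed
  then show ?thesis using P(1,2) by (intro exI[of _ P]) (simp add: sets_code_borel)
qed

section \<open>Cylinders and stationary measures\<close>

lemma cylinder_eq_window: "cylinder m es = {\<sigma>. map \<sigma> [m..m + int (length es) - 1] = es}"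
  by (simp add: cylinder_def map_eq_iff_nth)

lemma measurable_window [measurable]:
  "(\<lambda>\<sigma>. map \<sigma> (W :: 'i list)) \<in> (code_borel :: ('i::countable \<Rightarrow> 'e::countable option) measure) \<rightarrow>\<^sub>M count_space UNIV"
  by (rule measurable_map_window) measurable

lemma sets_cylinder [measurable]: "cylinder m es \<in> sets (code_borel :: (int \<Rightarrow> 'e::countable option) measure)"
proof -
  have "{\<sigma> \<in> space (code_borel :: (int \<Rightarrow> 'e option) measure). map \<sigma> [m..m + int (length es) - 1] = es} \<in> sets code_borel"
    by measurable
  then show ?thesis by (simp add: cylinder_eq_window)
qed

lemma emeasure_cylinder_snoc:
  fixes \<Lambda> :: "(int \<Rightarrow> 'e::countable option) measure"
  assumes [measurable_cong]: "sets \<Lambda> = sets code_borel"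
  shows "emeasure \<Lambda> (cylinder m es) = (\<integral>\<^sup>+e. emeasure \<Lambda> (cylinder m (es @ [e])) \<partial>count_space UNIV)"
proof -
  have eq: "cylinder m (es @ [e]) = cylinder m es \<inter> {\<sigma>. \<sigma> (m + int (length es)) = e}" for e
    by (auto simp: cylinder_def nth_append less_Suc_eq)
  have "cylinder m es = (\<Union>e. cylinder m (es @ [e]))"
    unfolding eq by auto
  moreover have "emeasure \<Lambda> (\<Union>e. cylinder m (es @ [e])) = (\<integral>\<^sup>+e. emeasure \<Lambda> (cylinder m (es @ [e])) \<partial>count_space UNIV)"
  proof (rule emeasure_UN_countable)
    show "disjoint_family_on (\<lambda>e. cylinder m (es @ [e])) UNIV"
      unfolding eq by (auto simp: disjoint_family_on_def)
  qed auto
  ultimately show ?thesis by simp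
qed

lemma emeasure_cylinder_Cons:
  fixes \<Lambda> :: "(int \<Rightarrow> 'e::countable option) measure"
  assumes [measurable_cong]: "sets \<Lambda> = sets code_borel"
  shows "emeasure \<Lambda> (cylinder m es) = (\<integral>\<^sup>+e. emeasure \<Lambda> (cylinder (m - 1) (e # es)) \<partial>count_space UNIV)"
proof -
  have eq: "cylinder (m - 1) (e # es) = cylinder m es \<inter> {\<sigma>. \<sigma> (m - 1) = e}" for e
    by (auto simp: cylinder_def less_Suc_eq_0_disj)
  have "cylinder m es = (\<Union>e. cylinder (m - 1) (e # es))"
    unfolding eq by auto
  moreover have "emeasure \<Lambda> (\<Union>e. cylinder (m - 1) (e # es)) = (\<integral>\<^sup>+e. emeasure \<Lambda> (cylinder (m - 1) (e # es)) \<partial>count_space UNIV)"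
  proof (rule emeasure_UN_countable)
    show "disjoint_family_on (\<lambda>e. cylinder (m - 1) (e # es)) UNIV"
      unfolding eq by (auto simp: disjoint_family_on_def)
  qed auto
  ultimately show ?thesis by simp
qed

lemma measure_eqI_cylinders:
  fixes P Q :: "(int \<Rightarrow> 'e::countable option) measure"
  assumes "prob_space P" "sets P = sets code_borel" "sets Q = sets code_borel"
    and eq: "\<And>n es. length es = 2 * n + 1 \<Longrightarrow> emeasure P (cylinder (- int n) es) = emeasure Q (cylinder (- int n) es)"
  shows "P = Q"
proof (rule measure_eqI_nested[where X = "\<lambda>n \<sigma>. map \<sigma> [- int n..int n]"])
  have "sets (code_borel :: (int \<Rightarrow> 'e option) measure) = sigma_sets UNIV {(\<lambda>\<sigma>. map \<sigma> [- int n..int n]) -` {c} |n c. True}"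
    unfolding sets_code_borel
  proof (rule sets_PiM_windows)
    show "\<exists>n. i \<in> set [- int n..int n]" for i by (rule exI[of _ "nat \<bar>i\<bar>"]) auto
  qed
  then show "sets P = sigma_sets UNIV {(\<lambda>\<sigma>. map \<sigma> [- int n..int n]) -` {c} |n c. True}"
    and "sets Q = sigma_sets UNIV {(\<lambda>\<sigma>. map \<sigma> [- int n..int n]) -` {c} |n c. True}"
    using assms(2,3) by auto
  show "finite_measure P" using assms(1) by (rule prob_space.axioms)
  show "map x [- int n..int n] = map y [- int n..int n]"
    if "map x [- int (Suc n)..int (Suc n)] = map y [- int (Suc n)..int (Suc n)]" for n and x y :: "int \<Rightarrow> 'e option"
    using that by (auto simp: map_eq_conv)
  fix n and c :: "'e option list"
  show "emeasure P ((\<lambda>\<sigma>. map \<sigma> [- int n..int n]) -` {c}) = emeasure Q ((\<lambda>\<sigma>. map \<sigma> [- int n..int n]) -` {c})"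
  proof (cases "length c = 2 * n + 1")
    case True
    then have "(\<lambda>\<sigma>. map \<sigma> [- int n..int n]) -` {c} = cylinder (- int n) c"
      by (auto simp: cylinder_eq_window)
    then show ?thesis using eq[OF True] by simp
  next
    case False
    then have "(\<lambda>\<sigma>. map \<sigma> [- int n..int n]) -` {c} = {}" by auto
    then show ?thesis by simp
  qed
qed

lemma measurable_shift [measurable]: "shift \<in> (code_borel :: (int \<Rightarrow> 'e::countable option) measure) \<rightarrow>\<^sub>M code_borel"
  unfolding shift_def[abs_def] by (rule measurable_into_code_borel) measurable

lemma shift_cylinder: "shift -` cylinder m es = cylinder (m + 1) es"
  by (auto simp: shift_def cylinder_def algebra_simps)

text \<open>
  Consistency of the masses under adding letters on the right is what makes them a probability,
  consistency on the left is stationarity.  The extension theorem is applied to windows that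
  grow on both sides, so that both are used in each step.
\<close>

lemma stationary_measure:
  fixes q :: "'e::countable option list \<Rightarrow> ennreal"
  assumes one: "q [] = 1" and right: "\<And>es. (\<integral>\<^sup>+e. q (es @ [e]) \<partial>count_space UNIV) = q es"
    and left: "\<And>es. (\<integral>\<^sup>+e. q (e # es) \<partial>count_space UNIV) = q es"
  shows "\<exists>\<Lambda>\<in>shift_invariant. \<forall>m es. emeasure \<Lambda> (cylinder m es) = q es"
proof -
  let ?W = "\<lambda>n. [- int n..int n - 1]"
  have len: "length (?W n) = 2 * n" for n by simp
  have "\<exists>\<Lambda> :: (int \<Rightarrow> 'e option) measure. prob_space \<Lambda> \<and> sets \<Lambda> = sets (PiM UNIV (\<lambda>_. count_space UNIV)) \<and>
    (\<forall>n c. length c = length (?W n) \<longrightarrow> emeasure \<Lambda> {\<sigma>. map \<sigma> (?W n) = c} = q c)"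
  proof (rule measure_of_consistent_words[where pad = "\<lambda>n es i. es ! nat (i + int n)"])
    show "\<exists>n. i \<in> set (?W n)" for i :: int by (rule exI[of _ "nat (\<bar>i\<bar> + 1)"]) auto
    show "map (\<lambda>i. es ! nat (i + int n)) (?W n) = es" if "length es = length (?W n)"
      for n and es :: "'e option list"
      using that by (auto simp: list_eq_iff_nth_eq)
    show "(\<integral>\<^sup>+es. q es \<partial>count_space (words (length (?W n)))) = 1" for n
      using nn_integral_words_right_consistent[of q] one right by simp
    fix n and c :: "'e option list" assume c: "length c = length (?W n)"
    let ?A = "{es. map (\<lambda>i. es ! nat (i + int (Suc n))) (?W n) = c}"
    have mid: "e # es @ [e'] \<in> ?A \<longleftrightarrow> es = c" if "length es = 2 * n" for es :: "'e option list" and e e'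
    proof -
      have "map (\<lambda>i. (e # es @ [e']) ! nat (i + int (Suc n))) (?W n) = es"
        using that by (auto simp: list_eq_iff_nth_eq nth_append nth_Cons' nat_add_distrib)
      then show ?thesis by simp
    qed
    have "(\<integral>\<^sup>+es. q es * indicator ?A es \<partial>count_space (words (length (?W (Suc n)))))
      = (\<integral>\<^sup>+es. q es * indicator ?A es \<partial>count_space (words (Suc (Suc (2 * n)))))"
    proof -
      have "length (?W (Suc n)) = Suc (Suc (2 * n))" by (simp add: nat_eq_iff)
      then show ?thesis by (simp only:)
    qed
    also have "\<dots> = (\<integral>\<^sup>+e. \<integral>\<^sup>+es. (\<integral>\<^sup>+e'. q (e # es @ [e']) * indicator ?A (e # es @ [e']) \<partial>count_space UNIV) \<partial>count_space (words (2 * n)) \<partial>count_space UNIV)"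
      by (subst nn_integral_words_Suc, subst nn_integral_words_snoc) simp
    also have "\<dots> = (\<integral>\<^sup>+e. \<integral>\<^sup>+es. (\<integral>\<^sup>+e'. q ((e # es) @ [e']) * indicator {es. es = c} es \<partial>count_space UNIV) \<partial>count_space (words (2 * n)) \<partial>count_space UNIV)"
      using mid by (intro nn_integral_cong) (auto simp: indicator_def)
    also have "\<dots> = (\<integral>\<^sup>+e. \<integral>\<^sup>+es. q (e # es) * indicator {es. es = c} es \<partial>count_space (words (2 * n)) \<partial>count_space UNIV)"
      by (subst nn_integral_multc) (simp_all only: right, simp)
    also have "\<dots> = (\<integral>\<^sup>+e. q (e # c) \<partial>count_space UNIV)"
      using c by (subst nn_integral_words_point) simp_all
    also have "\<dots> = q c" by (rule left)
    finally show "(\<integral>\<^sup>+es. q es * indicator ?A es \<partial>count_space (words (length (?W (Suc n))))) = q c" .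
  qed auto
  then obtain \<Lambda> :: "(int \<Rightarrow> 'e option) measure" where L: "prob_space \<Lambda>"
      "sets \<Lambda> = sets (PiM UNIV (\<lambda>_. count_space UNIV))"
      "\<forall>n c. length c = length (?W n) \<longrightarrow> emeasure \<Lambda> {\<sigma>. map \<sigma> (?W n) = c} = q c"
    by (elim exE conjE)
  then have \<Lambda>: "prob_space \<Lambda>" "sets \<Lambda> = sets code_borel"
    and W: "\<And>n c. length c = 2 * n \<Longrightarrow> emeasure \<Lambda> {\<sigma>. map \<sigma> (?W n) = c} = q c"
    by (simp_all add: sets_code_borel)
  note [measurable_cong] = \<Lambda>(2)
  \<comment> \<open>Summing over the letters at either end transports the masses from the windows to all
    cylinders.\<close>
  have sym: "emeasure \<Lambda> (cylinder (- int n) es) = q es" if "length es = 2 * n" for n es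
    using W[OF that] that by (simp add: cylinder_eq_window)
  have right': "emeasure \<Lambda> (cylinder (- int n) es) = q es" if "length es + k = 2 * n" for n k es
    using that
  proof (induction k arbitrary: es)
    case 0 then show ?case by (simp add: sym)
  next
    case (Suc k)
    have "emeasure \<Lambda> (cylinder (- int n) es) = (\<integral>\<^sup>+e. q (es @ [e]) \<partial>count_space UNIV)"
      unfolding emeasure_cylinder_snoc[OF \<Lambda>(2), of _ es] using Suc by (intro nn_integral_cong) simp
    then show ?case by (simp add: right)
  qed
  have both: "emeasure \<Lambda> (cylinder (int k - int n) es) = q es" if "length es + k \<le> 2 * n" for n k es
    using that
  proof (induction k arbitrary: es)
    case 0 then show ?case using right'[of es "2 * n - length es" n] by simp
  next
    case (Suc k)
    have "emeasure \<Lambda> (cylinder (int (Suc k) - int n) es) = (\<integral>\<^sup>+e. q (e # es) \<partial>count_space UNIV)"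
      unfolding emeasure_cylinder_Cons[OF \<Lambda>(2), of _ es] using Suc by (intro nn_integral_cong) simp
    then show ?case by (simp add: left)
  qed
  have cyl: "emeasure \<Lambda> (cylinder m es) = q es" for m es
  proof -
    define N where "N = nat \<bar>m\<bar> + length es"
    define k where "k = nat (m + int N)"
    have "int k = m + int N" "length es + k \<le> 2 * N" by (auto simp: k_def N_def)
    then show ?thesis using both[of es k N] by simp
  qed
  have "distr \<Lambda> code_borel shift = \<Lambda>"
  proof (rule measure_eqI_cylinders)
    show "prob_space (distr \<Lambda> code_borel shift)"
      by (intro prob_space.prob_space_distr \<Lambda>) measurable
    show "emeasure (distr \<Lambda> code_borel shift) (cylinder (- int n) es) = emeasure \<Lambda> (cylinder (- int n) es)" for n es
    proof -
      have "space \<Lambda> = UNIV" using sets_eq_imp_space_eq[OF \<Lambda>(2)] by simp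
      then show ?thesis by (simp add: emeasure_distr shift_cylinder cyl)
    qed
  qed (simp_all add: \<Lambda>)
  then show ?thesis using \<Lambda> cyl by (auto simp: shift_invariant_def)
qed

section \<open>Exchanging limits and countable sums\<close>

lemma nn_integral_Fatou_bound:
  fixes f :: "nat \<Rightarrow> 's \<Rightarrow> ennreal" and C :: "nat \<Rightarrow> ennreal"
  assumes "\<And>r. f r \<in> borel_measurable N" "AE x in N. (\<lambda>r. f r x) \<longlonglongrightarrow> g x"
    and "\<And>r. (\<integral>\<^sup>+x. f r x \<partial>N) \<le> C r" "C \<longlonglongrightarrow> c"
  shows "(\<integral>\<^sup>+x. g x \<partial>N) \<le> c"
proof -
  have "(\<integral>\<^sup>+x. g x \<partial>N) = (\<integral>\<^sup>+x. liminf (\<lambda>r. f r x) \<partial>N)"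
    using assms(2) by (intro nn_integral_cong_AE) (auto elim!: eventually_mono dest!: lim_imp_Liminf[rotated])
  also have "\<dots> \<le> liminf (\<lambda>r. \<integral>\<^sup>+x. f r x \<partial>N)"
    by (rule nn_integral_liminf) (rule assms(1))
  also have "\<dots> \<le> liminf C" by (rule Liminf_mono) (simp add: assms(3))
  also have "\<dots> = c" using assms(4) by (intro lim_imp_Liminf) auto
  finally show ?thesis .
qed

lemma nn_integral_count_space_option:
  fixes f :: "'a option \<Rightarrow> ennreal"
  assumes "f None = 0"
  shows "(\<integral>\<^sup>+e. f e \<partial>count_space UNIV) = (\<integral>\<^sup>+e. f (Some e) \<partial>count_space UNIV)"
proof -
  have bij: "bij_betw Some (UNIV :: 'a set) (range Some)" by (simp add: inj_on_imp_bij_betw)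
  have "f e = f e * indicator (range Some) e" for e
    using assms by (cases e) auto
  then have "(\<integral>\<^sup>+e. f e \<partial>count_space UNIV) = (\<integral>\<^sup>+e. f e * indicator (range Some) e \<partial>count_space UNIV)"
    by simp
  also have "\<dots> = (\<integral>\<^sup>+e. f e \<partial>count_space (range Some))"
    by (simp add: nn_integral_count_space_indicator)
  also have "\<dots> = (\<integral>\<^sup>+e. f (Some e) \<partial>count_space UNIV)"
    by (rule nn_integral_bij_count_space[OF bij, symmetric])
  finally show ?thesis .
qed

lemma nn_integral_count_space_small_tail:
  fixes g :: "'a::countable \<Rightarrow> ennreal"
  assumes "(\<integral>\<^sup>+e. g e \<partial>count_space UNIV) < \<infinity>" "0 < \<epsilon>"
  shows "\<exists>B. finite B \<and> (\<integral>\<^sup>+e. g e * indicator (- B) e \<partial>count_space UNIV) < ennreal \<epsilon>"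
proof -
  let ?B = "\<lambda>n. {e :: 'a. to_nat e < n}"
  have "(\<lambda>n. \<integral>\<^sup>+e. g e * indicator (- ?B n) e \<partial>count_space UNIV) \<longlonglongrightarrow> (\<integral>\<^sup>+e. 0 \<partial>count_space (UNIV :: 'a set))"
  proof (rule nn_integral_dominated_convergence[where w = g])
    show "AE e in count_space UNIV. (\<lambda>n. g e * indicator (- ?B n) e) \<longlonglongrightarrow> 0"
    proof (rule AE_I2, rule tendsto_eventually)
      fix e :: 'a
      show "eventually (\<lambda>n. g e * indicator (- ?B n) e = 0) sequentially"
        by (intro eventually_sequentiallyI[of "Suc (to_nat e)"]) simp
    qed
    show "AE e in count_space UNIV. g e * indicator (- ?B n) e \<le> g e" for n
      by (intro AE_I2) (simp add: indicator_def)
  qed (use assms in auto)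
  then have "eventually (\<lambda>n. (\<integral>\<^sup>+e. g e * indicator (- ?B n) e \<partial>count_space UNIV) < ennreal \<epsilon>) sequentially"
    using assms(2) by (intro order_tendstoD(2)[of _ 0]) simp_all
  then obtain n where "(\<integral>\<^sup>+e. g e * indicator (- ?B n) e \<partial>count_space UNIV) < ennreal \<epsilon>"
    by (auto simp: eventually_sequentially)
  moreover have "finite (?B n)"
    using finite_vimageI[of "{..<n}" "to_nat :: 'a \<Rightarrow> nat"] by (simp add: vimage_def)
  ultimately show ?thesis by blast
qed

text \<open>
  Fatou's lemma bounds the sum of the limits from above; tightness bounds it from below, since all
  but \<open>\<epsilon>\<close> of the mass sits on a fixed finite set, over which limit and sum commute.  The errors \<open>d n\<close>
  allow totals that are only asymptotically known.
\<close>

lemma nn_integral_tight_limit: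
  fixes f :: "nat \<Rightarrow> 'a::countable \<Rightarrow> ennreal"
  assumes f: "\<And>e. (\<lambda>n. f n e) \<longlonglongrightarrow> F e"
    and tight: "\<And>\<epsilon>. 0 < \<epsilon> \<Longrightarrow> \<exists>B. finite B \<and> (\<forall>n. (\<integral>\<^sup>+e. f n e * indicator (- B) e \<partial>count_space UNIV) \<le> ennreal \<epsilon>)"
    and c: "c \<longlonglongrightarrow> C" and d: "d \<longlonglongrightarrow> (0::ennreal)"
    and le: "\<And>n. (\<integral>\<^sup>+e. f n e \<partial>count_space UNIV) \<le> c n + d n"
    and ge: "\<And>n. c n \<le> (\<integral>\<^sup>+e. f n e \<partial>count_space UNIV) + d n"
  shows "(\<integral>\<^sup>+e. F e \<partial>count_space UNIV) = C"
proof (rule antisym)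
  show "(\<integral>\<^sup>+e. F e \<partial>count_space UNIV) \<le> C"
    by (rule nn_integral_Fatou_bound[where f = f and C = "\<lambda>n. c n + d n"])
       (use f le tendsto_add[OF c d] in auto)
  show "C \<le> (\<integral>\<^sup>+e. F e \<partial>count_space UNIV)"
  proof (rule ennreal_le_epsilon)
    fix \<epsilon> :: real assume "0 < \<epsilon>"
    then obtain B where B: "finite B" "\<And>n. (\<integral>\<^sup>+e. f n e * indicator (- B) e \<partial>count_space UNIV) \<le> ennreal \<epsilon>"
      using tight by blast
    have split: "(\<integral>\<^sup>+e. h e \<partial>count_space UNIV) = sum h B + (\<integral>\<^sup>+e. h e * indicator (- B) e \<partial>count_space UNIV)"
      for h :: "'a \<Rightarrow> ennreal"
    proof -
      have "(\<integral>\<^sup>+e. h e \<partial>count_space UNIV) = (\<integral>\<^sup>+e. h e * indicator B e + h e * indicator (- B) e \<partial>count_space UNIV)"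
        by (intro nn_integral_cong) (simp add: indicator_def)
      also have "\<dots> = (\<integral>\<^sup>+e. h e * indicator B e \<partial>count_space UNIV) + (\<integral>\<^sup>+e. h e * indicator (- B) e \<partial>count_space UNIV)"
        by (rule nn_integral_add) auto
      also have "(\<integral>\<^sup>+e. h e * indicator B e \<partial>count_space UNIV) = sum h B"
        using B(1) by (simp add: nn_integral_count_space_indicator[symmetric] nn_integral_count_space_finite)
      finally show ?thesis .
    qed
    have "c n \<le> sum (f n) B + ennreal \<epsilon> + d n" for n
    proof -
      have "(\<integral>\<^sup>+e. f n e \<partial>count_space UNIV) \<le> sum (f n) B + ennreal \<epsilon>"
        unfolding split[of "f n"] by (intro add_left_mono B(2))
      then show ?thesis using ge[of n] by (meson add_right_mono order_trans)
    qed
    moreover have "(\<lambda>n. sum (f n) B + ennreal \<epsilon> + d n) \<longlonglongrightarrow> sum F B + ennreal \<epsilon> + 0"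
      by (intro tendsto_add tendsto_sum f tendsto_const d)
    ultimately have "C \<le> sum F B + ennreal \<epsilon> + 0"
      by (intro LIMSEQ_le[OF c]) auto
    also have "\<dots> \<le> (\<integral>\<^sup>+e. F e \<partial>count_space UNIV) + ennreal \<epsilon>"
      unfolding split[of F] by (simp add: add.commute add_increasing2)
    finally show "C \<le> (\<integral>\<^sup>+e. F e \<partial>count_space UNIV) + ennreal \<epsilon>" .
  qed
qed

text \<open>
  A product of countably many copies of the unit interval is compact and metrizable.
\<close>

lemma bounded_functions_convergent_subsequence:
  fixes f :: "nat \<Rightarrow> 'a::countable \<Rightarrow> real"
  assumes "\<And>n x. f n x \<in> {0..1}"
  shows "\<exists>r l. strict_mono (r :: nat \<Rightarrow> nat) \<and> (\<forall>x. (\<lambda>n. f (r n) x) \<longlonglongrightarrow> l x)"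
proof -
  have "compactin (product_topology (\<lambda>_. euclidean) UNIV) (Pi\<^sub>E UNIV (\<lambda>_ :: 'a. {0..1 :: real}))"
    unfolding compactin_PiE by simp
  then have "compact (Pi\<^sub>E UNIV (\<lambda>_ :: 'a. {0..1 :: real}))"
    by (simp add: euclidean_product_topology)
  then have "seq_compact (Pi\<^sub>E UNIV (\<lambda>_ :: 'a. {0..1 :: real}))"
    by (simp add: compact_eq_seq_compact_metric)
  moreover have "\<forall>n. f n \<in> Pi\<^sub>E UNIV (\<lambda>_. {0..1})" using assms by (auto simp: PiE_iff)
  ultimately obtain l r where r: "strict_mono (r :: nat \<Rightarrow> nat)" "(f \<circ> r) \<longlonglongrightarrow> l"
    unfolding seq_compact_def by blast
  have "(\<lambda>n. f (r n) x) \<longlonglongrightarrow> l x" for x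
  proof -
    have "continuous_on UNIV (\<lambda>h :: 'a \<Rightarrow> real. h x)" by (rule continuous_on_product_coordinates)
    from continuous_on_tendsto_compose[OF this r(2)] show ?thesis by simp
  qed
  then show ?thesis using r(1) by blast
qed

lemma borel_measurable_nn_integral_count_space:
  assumes "countable A" "\<And>i. i \<in> A \<Longrightarrow> (\<lambda>x. g x i) \<in> borel_measurable N"
  shows "(\<lambda>x. \<integral>\<^sup>+i. g x i \<partial>count_space A) \<in> borel_measurable N"
proof -
  interpret sigma_finite_measure "count_space A"
    by (rule sigma_finite_measure_count_space_countable[OF assms(1)])
  have "(\<lambda>p. g (fst p) (snd p)) \<in> borel_measurable (N \<Otimes>\<^sub>M count_space A)"
    by (rule measurable_compose_countable'[where f = "\<lambda>i p. g (fst p) i" and g = snd and I = A])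
       (use assms in \<open>auto intro: measurable_compose[OF measurable_fst]\<close>)
  then show ?thesis by (intro borel_measurable_nn_integral) (simp add: split_def)
qed

section \<open>Contraction in mean along paths\<close>

primrec path_map :: "('k, 'e) markov_system \<Rightarrow> 'e option list \<Rightarrow> 'k \<Rightarrow> 'k" where
  "path_map M [] x = x"
| "path_map M (e # es) x = path_map M es (wmap_opt M e x)"

text \<open>
  The expectation of \<open>h\<close> of the first \<open>n\<close> letters of the random path started at \<open>x\<close>.
\<close>

definition path_sum ::
    "('k, 'e) markov_system \<Rightarrow> nat \<Rightarrow> ('e option list \<Rightarrow> ennreal) \<Rightarrow> 'k \<Rightarrow> ennreal" where
  "path_sum M n h x = (\<integral>\<^sup>+es. ennreal (path_prob M es x) * h es \<partial>count_space (words n))"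

lemma path_map_append: "path_map M (u @ v) x = path_map M v (path_map M u x)"
  by (induction u arbitrary: x) auto

lemma path_prob_append: "path_prob M (u @ v) x = path_prob M u x * path_prob M v (path_map M u x)"
  by (induction u arbitrary: x) auto

locale contractive_markov_system =
  fixes M :: "('k::complete_space, 'e::countable) markov_system"
    and xs :: "nat \<Rightarrow> 'k" and a :: real
  assumes system: "countable_markov_system M"
    and base: "\<And>j. j \<in> vert M \<Longrightarrow> xs j \<in> cell M j"
    and contractive: "contractive M a"
    and uniform: "uniformly_continuous_system M"
    and bconst_finite: "bconst M xs < \<infinity>"
begin

definition vertex :: "'k \<Rightarrow> nat" where
  "vertex x = (THE j. j \<in> vert M \<and> x \<in> cell M j)"

text \<open>
  A Lyapunov function for the system; its drift is bounded in \<open>drift_one_step\<close>.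
\<close>

definition gap :: "'k \<Rightarrow> real" where
  "gap x = dist x (xs (vertex x))"

definition b :: real where
  "b = enn2real (bconst M xs)"

lemma a_pos: "0 < a" and a_less_1: "a < 1"
  using contractive by (auto simp: contractive_def)

lemma b_nonneg: "0 \<le> b"
  by (simp add: b_def)

lemma vertex_unique: "j \<in> vert M \<Longrightarrow> x \<in> cell M j \<Longrightarrow> vertex x = j"
  using system unfolding vertex_def countable_markov_system_def disjoint_family_on_def
  by (intro the_equality) blast+

lemma vertex_in: "vertex x \<in> vert M" and in_cell_vertex: "x \<in> cell M (vertex x)"
proof -
  have "x \<in> (\<Union>j\<in>vert M. cell M j)" using system by (simp add: countable_markov_system_def)
  then obtain j where "j \<in> vert M" "x \<in> cell M j" by auto
  then show "vertex x \<in> vert M" "x \<in> cell M (vertex x)" using vertex_unique by auto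
qed

lemma in_cell_iff: "j \<in> vert M \<Longrightarrow> x \<in> cell M j \<longleftrightarrow> vertex x = j"
  using vertex_unique in_cell_vertex by auto

lemma ini_in_vert: "ini M e \<in> vert M" and ter_in_vert: "ter M e \<in> vert M"
  using system by (auto simp: countable_markov_system_def)

lemma vertex_xs: "j \<in> vert M \<Longrightarrow> vertex (xs j) = j"
  using base vertex_unique by auto

lemma wprob_opt_nonneg [simp]: "0 \<le> wprob_opt M e x"
proof (cases e)
  case (Some e') then show ?thesis
    using system by (cases "x \<in> cell M (ini M e')") (auto simp: countable_markov_system_def)
qed simp

lemma wprob_opt_le_1: "wprob_opt M e x \<le> 1"
proof (cases e)
  case (Some e') then show ?thesis
    using system by (cases "x \<in> cell M (ini M e')") (auto simp: countable_markov_system_def)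
qed simp

lemma wprob_opt_supported:
  assumes "wprob_opt M e x \<noteq> 0"
  shows "e \<noteq> None" "vertex x = ini_opt M e"
proof -
  obtain e' where e: "e = Some e'" using assms by (cases e) auto
  then have "x \<in> cell M (ini M e')" using assms system by (auto simp: countable_markov_system_def)
  then show "e \<noteq> None" "vertex x = ini_opt M e" using e vertex_unique ini_in_vert by auto
qed

lemma vertex_wmap_opt:
  assumes "e \<noteq> None" "vertex x = ini_opt M e"
  shows "vertex (wmap_opt M e x) = ter_opt M e"
proof -
  obtain e' where e: "e = Some e'" using assms by (cases e) auto
  then have "x \<in> cell M (ini M e')" using assms in_cell_iff ini_in_vert by auto
  moreover have "wmap M e' ` cell M (ini M e') \<subseteq> cell M (ter M e')"
    using system by (simp add: countable_markov_system_def)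
  ultimately have "wmap M e' x \<in> cell M (ter M e')" by blast
  then show ?thesis using e vertex_unique ter_in_vert by auto
qed

lemma measurable_wmap_opt [measurable]: "wmap_opt M e \<in> borel \<rightarrow>\<^sub>M borel"
  using system by (cases e) (auto simp: countable_markov_system_def)

lemma measurable_wprob_opt [measurable]: "wprob_opt M e \<in> borel_measurable borel"
  using system by (cases e) (auto simp: countable_markov_system_def)

lemma measurable_path_map [measurable]: "path_map M es \<in> borel \<rightarrow>\<^sub>M borel"
proof (induction es)
  case (Cons e es)
  from measurable_compose[OF measurable_wmap_opt Cons] show ?case by simp
qed simp

lemma measurable_path_prob [measurable]: "path_prob M es \<in> borel_measurable borel"
proof (induction es)
  case (Cons e es)
  note [measurable] = Cons
  show ?case unfolding path_prob.simps by measurable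
qed simp

lemma path_prob_nonneg [simp]: "0 \<le> path_prob M es x"
  by (induction es arbitrary: x) auto

lemma path_prob_le_1: "path_prob M es x \<le> 1"
  by (induction es arbitrary: x) (auto intro: mult_le_one wprob_opt_le_1)

lemma measurable_vertex [measurable]: "vertex \<in> borel \<rightarrow>\<^sub>M count_space UNIV"
proof (rule measurable_countable_typeI)
  fix j
  have "vertex -` {j} = (if j \<in> vert M then cell M j else {})"
    using in_cell_iff vertex_in by auto
  then show "vertex -` {j} \<inter> space borel \<in> sets borel"
    using system by (auto simp: countable_markov_system_def)
qed

lemma measurable_dist_const: "(\<lambda>x. dist x c) \<in> borel_measurable (borel :: 'k measure)"
  by (intro borel_measurable_continuous_onI continuous_intros)

lemma measurable_gap [measurable]: "gap \<in> borel_measurable borel"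
  unfolding gap_def[abs_def]
  by (rule measurable_compose_countable[OF _ measurable_vertex]) (rule measurable_dist_const)

lemma gap_nonneg [simp]: "0 \<le> gap x" by (simp add: gap_def)

lemma nn_integral_edges:
  fixes c :: "'e option \<Rightarrow> real"
  assumes "j \<in> vert M" "x \<in> cell M j"
  shows "(\<integral>\<^sup>+e. ennreal (wprob_opt M e x * c e) \<partial>count_space UNIV)
    = (\<Sum>\<^sub>\<infinity>e\<in>{e. ini M e = j}. ennreal (wprob M e x * c (Some e)))"
proof -
  let ?A = "{e. ini M e = j}"
  have bij: "bij_betw Some ?A (Some ` ?A)" by (simp add: inj_on_imp_bij_betw)
  have 0: "wprob_opt M e x = 0" if "e \<notin> Some ` ?A" for e
  proof (rule ccontr)
    assume *: "wprob_opt M e x \<noteq> 0"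
    from wprob_opt_supported[OF *] obtain e' where "e = Some e'" "vertex x = ini M e'" by (cases e) auto
    then show False using that vertex_unique[OF assms] by auto
  qed
  have "(\<integral>\<^sup>+e. ennreal (wprob_opt M e x * c e) \<partial>count_space UNIV)
    = (\<integral>\<^sup>+e. ennreal (wprob_opt M e x * c e) * indicator (Some ` ?A) e \<partial>count_space UNIV)"
    by (intro nn_integral_cong) (simp add: indicator_def 0)
  also have "\<dots> = (\<integral>\<^sup>+e. ennreal (wprob_opt M e x * c e) \<partial>count_space (Some ` ?A))"
    by (simp add: nn_integral_count_space_indicator)
  also have "\<dots> = (\<integral>\<^sup>+e. ennreal (wprob_opt M (Some e) x * c (Some e)) \<partial>count_space ?A)"
    by (rule nn_integral_bij_count_space[OF bij, symmetric])
  finally show ?thesis by (simp add: infsum_eq_nn_integral_count_space)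
qed

lemma sum_wprob_opt: "(\<integral>\<^sup>+e. ennreal (wprob_opt M e x) \<partial>count_space UNIV) = 1"
  using nn_integral_edges[OF vertex_in in_cell_vertex, of x "\<lambda>_. 1"] system vertex_in[of x] in_cell_vertex[of x]
  by (simp add: countable_markov_system_def)

lemma contraction_one_step:
  assumes "vertex x = vertex y"
  shows "(\<integral>\<^sup>+e. ennreal (wprob_opt M e x * dist (wmap_opt M e x) (wmap_opt M e y)) \<partial>count_space UNIV)
    \<le> ennreal (a * dist x y)"
  using nn_integral_edges[OF vertex_in in_cell_vertex, of x "\<lambda>e. dist (wmap_opt M e x) (wmap_opt M e y)"]
    contractive vertex_in[of x] in_cell_vertex[of x] in_cell_vertex[of y] assms
  by (simp add: contractive_def)

lemma base_point_displacement:
  "(\<integral>\<^sup>+e. ennreal (wprob_opt M e x * dist (wmap_opt M e (xs (ini_opt M e))) (xs (ter_opt M e))) \<partial>count_space UNIV)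
    \<le> ennreal b"
proof -
  have "(\<integral>\<^sup>+e. ennreal (wprob_opt M e x * dist (wmap_opt M e (xs (ini_opt M e))) (xs (ter_opt M e))) \<partial>count_space UNIV)
    \<le> bconst M xs"
    unfolding nn_integral_edges[OF vertex_in in_cell_vertex] bconst_def
    using vertex_in[of x] in_cell_vertex[of x] by (simp add: SUP_upper2)
  also have "\<dots> = ennreal b" using bconst_finite by (simp add: b_def)
  finally show ?thesis .
qed

text \<open>
  The image of \<open>x\<close> is compared with the image of the base point of its cell, which is close to it in
  mean by contractivity; the latter is displaced from the next base point by at most \<open>b\<close> in mean.
\<close>

lemma drift_one_step:
  "(\<integral>\<^sup>+e. ennreal (wprob_opt M e x * gap (wmap_opt M e x)) \<partial>count_space UNIV) \<le> ennreal (a * gap x + b)"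
proof -
  let ?y = "xs (vertex x)"
  have "ennreal (wprob_opt M e x * gap (wmap_opt M e x))
      \<le> ennreal (wprob_opt M e x * dist (wmap_opt M e x) (wmap_opt M e ?y))
        + ennreal (wprob_opt M e x * dist (wmap_opt M e (xs (ini_opt M e))) (xs (ter_opt M e)))" for e
  proof (cases "wprob_opt M e x = 0")
    case False
    note e = wprob_opt_supported[OF False]
    have "gap (wmap_opt M e x) \<le> dist (wmap_opt M e x) (wmap_opt M e ?y)
        + dist (wmap_opt M e (xs (ini_opt M e))) (xs (ter_opt M e))"
      unfolding gap_def vertex_wmap_opt[OF e] using e(2) by (simp add: dist_triangle)
    then have "wprob_opt M e x * gap (wmap_opt M e x)
      \<le> wprob_opt M e x * dist (wmap_opt M e x) (wmap_opt M e ?y)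
        + wprob_opt M e x * dist (wmap_opt M e (xs (ini_opt M e))) (xs (ter_opt M e))"
      by (simp add: mult_left_mono flip: distrib_left)
    then show ?thesis by (simp add: ennreal_leI flip: ennreal_plus)
  qed simp
  then have "(\<integral>\<^sup>+e. ennreal (wprob_opt M e x * gap (wmap_opt M e x)) \<partial>count_space UNIV)
    \<le> (\<integral>\<^sup>+e. ennreal (wprob_opt M e x * dist (wmap_opt M e x) (wmap_opt M e ?y))
        + ennreal (wprob_opt M e x * dist (wmap_opt M e (xs (ini_opt M e))) (xs (ter_opt M e))) \<partial>count_space UNIV)"
    by (intro nn_integral_mono)
  also have "\<dots> \<le> ennreal (a * dist x ?y) + ennreal b"
    unfolding nn_integral_add[OF borel_measurable_count_space borel_measurable_count_space]
    by (intro add_mono contraction_one_step base_point_displacement) (simp add: vertex_xs vertex_in)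
  also have "\<dots> = ennreal (a * gap x + b)"
    using a_pos b_nonneg by (simp add: gap_def ennreal_plus)
  finally show ?thesis .
qed

lemma path_sum_cong:
  assumes "\<And>es. length es = n \<Longrightarrow> path_prob M es x \<noteq> 0 \<Longrightarrow> h es = h' es"
  shows "path_sum M n h x = path_sum M n h' x"
  unfolding path_sum_def
proof (intro nn_integral_cong)
  fix es :: "'e option list" assume "es \<in> space (count_space (words n))"
  then show "ennreal (path_prob M es x) * h es = ennreal (path_prob M es x) * h' es"
    using assms[of es] by (cases "path_prob M es x = 0") auto
qed

lemma path_sum_mono:
  assumes "\<And>es. length es = n \<Longrightarrow> path_prob M es x \<noteq> 0 \<Longrightarrow> h es \<le> h' es"
  shows "path_sum M n h x \<le> path_sum M n h' x"
  unfolding path_sum_def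
proof (intro nn_integral_mono)
  fix es :: "'e option list" assume "es \<in> space (count_space (words n))"
  then show "ennreal (path_prob M es x) * h es \<le> ennreal (path_prob M es x) * h' es"
    using assms[of es] by (cases "path_prob M es x = 0") (auto intro: mult_left_mono)
qed

lemma path_sum_add: "path_sum M n (\<lambda>es. h es + h' es) x = path_sum M n h x + path_sum M n h' x"
  unfolding path_sum_def distrib_left by (rule nn_integral_add) auto

lemma path_sum_cmult: "path_sum M n (\<lambda>es. c * h es) x = c * path_sum M n h x"
  unfolding path_sum_def by (simp add: nn_integral_cmult[symmetric] mult.left_commute)

lemma path_sum_0 [simp]: "path_sum M 0 h x = h []"
  unfolding path_sum_def by (simp add: nn_integral_count_space_finite)

lemma path_sum_Suc:
  "path_sum M (Suc n) h x
    = (\<integral>\<^sup>+e. ennreal (wprob_opt M e x) * path_sum M n (\<lambda>es. h (e # es)) (wmap_opt M e x) \<partial>count_space UNIV)"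
  unfolding path_sum_def nn_integral_words_Suc
  by (simp add: nn_integral_cmult[symmetric] ennreal_mult mult.assoc)

lemma path_sum_append:
  "path_sum M (m + n) h x = path_sum M m (\<lambda>u. path_sum M n (\<lambda>v. h (u @ v)) (path_map M u x)) x"
  unfolding path_sum_def nn_integral_words_append
  by (simp add: nn_integral_cmult[symmetric] ennreal_mult mult.assoc path_prob_append)

lemma path_sum_const: "path_sum M n (\<lambda>_. c) x = c"
proof (induction n arbitrary: x)
  case (Suc n)
  then show ?case by (simp add: path_sum_Suc nn_integral_multc sum_wprob_opt)
qed simp

lemma measurable_path_sum:
  assumes "\<And>es. length es = n \<Longrightarrow> (\<lambda>x. h x es) \<in> borel_measurable borel"
  shows "(\<lambda>x. path_sum M n (h x) x) \<in> borel_measurable borel"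
  unfolding path_sum_def
  by (intro borel_measurable_nn_integral_count_space borel_measurable_times_ennreal
      measurable_compose[OF measurable_path_prob measurable_ennreal]) (use assms in auto)

lemma nn_integral_path_sum:
  assumes [measurable_cong]: "sets \<nu> = sets borel"
    and h: "\<And>es. length es = n \<Longrightarrow> (\<lambda>x. h x es) \<in> borel_measurable borel"
  shows "(\<integral>\<^sup>+x. path_sum M n (h x) x \<partial>\<nu>)
    = (\<integral>\<^sup>+es. (\<integral>\<^sup>+x. ennreal (path_prob M es x) * h x es \<partial>\<nu>) \<partial>count_space (words n))"
  unfolding path_sum_def
proof (rule nn_integral_count_space_nn_integral)
  fix es :: "'e option list" assume "es \<in> words n"
  then have [measurable]: "(\<lambda>x. h x es) \<in> borel_measurable borel" using h by simp
  show "(\<lambda>x. ennreal (path_prob M es x) * h x es) \<in> borel_measurable \<nu>" by measurable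
qed auto

text \<open>
  A path can be taken from \<open>x\<close> only if each letter starts in the cell in which the previous one ends,
  and then it carries the whole cell of \<open>x\<close> through the same cells.
\<close>

lemma vertex_path_map_cong:
  assumes "path_prob M es x \<noteq> 0" "vertex y = vertex x"
  shows "vertex (path_map M es y) = vertex (path_map M es x)"
  using assms
proof (induction es arbitrary: x y)
  case (Cons e es)
  then have "wprob_opt M e x \<noteq> 0" by auto
  from wprob_opt_supported[OF this] Cons.prems(2)
  have "vertex (wmap_opt M e y) = vertex (wmap_opt M e x)"
    using vertex_wmap_opt[of e x] vertex_wmap_opt[of e y] by simp
  then show ?case using Cons by auto
qed simp

lemma vertex_path_map:
  assumes "path_prob M es x \<noteq> 0" "es \<noteq> []"
  shows "vertex x = ini_opt M (hd es)" "vertex (path_map M es x) = ter_opt M (last es)"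
proof -
  show "vertex x = ini_opt M (hd es)"
    using assms wprob_opt_supported(2)[of "hd es" x] by (cases es) auto
  show "vertex (path_map M es x) = ter_opt M (last es)"
    using assms
  proof (induction es arbitrary: x)
    case (Cons e es)
    then have "wprob_opt M e x \<noteq> 0" by auto
    from vertex_wmap_opt[OF wprob_opt_supported[OF this]] Cons show ?case by auto
  qed simp
qed

lemma contraction_path_sum:
  assumes "vertex x = vertex y"
  shows "path_sum M n (\<lambda>es. ennreal (dist (path_map M es x) (path_map M es y))) x \<le> ennreal (a ^ n * dist x y)"
  using assms
proof (induction n arbitrary: x y)
  case (Suc n)
  have "path_sum M (Suc n) (\<lambda>es. ennreal (dist (path_map M es x) (path_map M es y))) x
    \<le> (\<integral>\<^sup>+e. ennreal (a ^ n) * ennreal (wprob_opt M e x * dist (wmap_opt M e x) (wmap_opt M e y)) \<partial>count_space UNIV)"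
    unfolding path_sum_Suc
  proof (intro nn_integral_mono)
    fix e
    show "ennreal (wprob_opt M e x) * path_sum M n (\<lambda>es. ennreal (dist (path_map M (e # es) x) (path_map M (e # es) y))) (wmap_opt M e x)
      \<le> ennreal (a ^ n) * ennreal (wprob_opt M e x * dist (wmap_opt M e x) (wmap_opt M e y))"
    proof (cases "wprob_opt M e x = 0")
      case False
      have "vertex (wmap_opt M e x) = vertex (wmap_opt M e y)"
        using wprob_opt_supported[OF False] Suc.prems vertex_wmap_opt[of e x] vertex_wmap_opt[of e y] by simp
      from mult_left_mono[OF Suc.IH[OF this], of "ennreal (wprob_opt M e x)"] show ?thesis
        using a_pos by (simp add: ennreal_mult mult.left_commute)
    qed simp
  qed
  also have "\<dots> \<le> ennreal (a ^ n) * ennreal (a * dist x y)"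
    by (simp add: nn_integral_cmult mult_left_mono contraction_one_step[OF Suc.prems])
  also have "\<dots> = ennreal (a ^ Suc n * dist x y)"
    using a_pos by (simp add: ennreal_mult'[symmetric] ac_simps)
  finally show ?case .
qed simp

lemma drift_path_sum:
  "path_sum M n (\<lambda>es. ennreal (gap (path_map M es x))) x \<le> ennreal (a ^ n * gap x + b / (1 - a))"
proof -
  have "path_sum M n (\<lambda>es. ennreal (gap (path_map M es x))) x \<le> ennreal (a ^ n * gap x + b * (\<Sum>k<n. a ^ k))"
  proof (induction n arbitrary: x)
    case (Suc n)
    let ?s = "b * (\<Sum>k<n. a ^ k)"
    have s: "0 \<le> ?s" using a_pos b_nonneg by (intro mult_nonneg_nonneg sum_nonneg) auto
    have "path_sum M (Suc n) (\<lambda>es. ennreal (gap (path_map M es x))) x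
      \<le> (\<integral>\<^sup>+e. ennreal (a ^ n) * ennreal (wprob_opt M e x * gap (wmap_opt M e x)) + ennreal (wprob_opt M e x) * ennreal ?s \<partial>count_space UNIV)"
      unfolding path_sum_Suc
    proof (intro nn_integral_mono)
      fix e
      have "ennreal (wprob_opt M e x) * path_sum M n (\<lambda>es. ennreal (gap (path_map M (e # es) x))) (wmap_opt M e x)
        \<le> ennreal (wprob_opt M e x) * ennreal (a ^ n * gap (wmap_opt M e x) + ?s)"
        using Suc.IH[of "wmap_opt M e x"] by (simp add: mult_left_mono)
      also have "\<dots> = ennreal (a ^ n * (wprob_opt M e x * gap (wmap_opt M e x)) + wprob_opt M e x * ?s)"
        by (subst ennreal_mult'[symmetric]) (simp_all add: algebra_simps)
      also have "\<dots> = ennreal (a ^ n * (wprob_opt M e x * gap (wmap_opt M e x))) + ennreal (wprob_opt M e x * ?s)"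
        using s a_pos by (intro ennreal_plus) auto
      also have "\<dots> = ennreal (a ^ n) * ennreal (wprob_opt M e x * gap (wmap_opt M e x)) + ennreal (wprob_opt M e x) * ennreal ?s"
        using s a_pos by (simp only: ennreal_mult' ennreal_mult'' wprob_opt_nonneg zero_le_power less_imp_le)
      finally show "ennreal (wprob_opt M e x) * path_sum M n (\<lambda>es. ennreal (gap (path_map M (e # es) x))) (wmap_opt M e x)
        \<le> ennreal (a ^ n) * ennreal (wprob_opt M e x * gap (wmap_opt M e x)) + ennreal (wprob_opt M e x) * ennreal ?s" .
    qed
    also have "\<dots> = ennreal (a ^ n) * (\<integral>\<^sup>+e. ennreal (wprob_opt M e x * gap (wmap_opt M e x)) \<partial>count_space UNIV) + ennreal ?s"
      by (subst nn_integral_add) (simp_all add: nn_integral_cmult nn_integral_multc sum_wprob_opt)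
    also have "\<dots> \<le> ennreal (a ^ n) * ennreal (a * gap x + b) + ennreal ?s"
      by (intro add_mono mult_left_mono drift_one_step) auto
    also have "\<dots> = ennreal (a ^ Suc n * gap x + b * (\<Sum>k<Suc n. a ^ k))"
      using s a_pos b_nonneg
      by (simp add: ennreal_mult[symmetric] ennreal_plus[symmetric] algebra_simps del: ennreal_plus)
    finally show ?case .
  qed simp
  also have "\<dots> \<le> ennreal (a ^ n * gap x + b / (1 - a))"
  proof (intro ennreal_leI add_left_mono)
    have "(\<Sum>k<n. a ^ k) = (1 - a ^ n) / (1 - a)"
      using a_less_1 by (simp add: sum_gp_strict)
    also have "\<dots> \<le> 1 / (1 - a)" using a_pos a_less_1 by (intro divide_right_mono) auto
    finally have "b * (\<Sum>k<n. a ^ k) \<le> b * (1 / (1 - a))"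
      using b_nonneg by (intro mult_left_mono)
    then show "b * (\<Sum>k<n. a ^ k) \<le> b / (1 - a)" by simp
  qed
  finally show ?thesis .
qed

text \<open>
  For the word formed by the letters \<open>- n, \<dots>, 0\<close> of a code this is the \<open>n\<close>-th approximation of its
  coding.
\<close>

definition word_pt :: "'e option list \<Rightarrow> 'k" where
  "word_pt es = path_map M es (xs (ini_opt M (hd es)))"

lemma dist_word_pt_path_sum:
  assumes "0 < n"
  shows "path_sum M n (\<lambda>es. ennreal (dist (path_map M es x) (word_pt es))) x \<le> ennreal (a ^ n * gap x)"
proof -
  have "path_sum M n (\<lambda>es. ennreal (dist (path_map M es x) (word_pt es))) x
    = path_sum M n (\<lambda>es. ennreal (dist (path_map M es x) (path_map M es (xs (vertex x))))) x"
  proof (rule path_sum_cong)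
    fix es :: "'e option list" assume "length es = n" "path_prob M es x \<noteq> 0"
    then show "ennreal (dist (path_map M es x) (word_pt es)) = ennreal (dist (path_map M es x) (path_map M es (xs (vertex x))))"
      using vertex_path_map(1)[of es x] assms by (auto simp: word_pt_def)
  qed
  also have "\<dots> \<le> ennreal (a ^ n * dist x (xs (vertex x)))"
    by (rule contraction_path_sum) (simp add: vertex_xs vertex_in)
  finally show ?thesis by (simp add: gap_def)
qed

text \<open>
  The basic estimate.  Split the path after \<open>m\<close> letters.  The rest moves the point reached there and
  the base point of its cell by the same maps, and contracts their distance, which is the gap at
  that time, by the factor \<open>a ^ n\<close> in mean.
\<close>

lemma dist_word_pt_drop_path_sum:
  assumes "0 < n"
  shows "path_sum M (m + n) (\<lambda>es. ennreal (dist (path_map M es x) (word_pt (drop m es)))) x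
    \<le> ennreal (a ^ n) * path_sum M m (\<lambda>es. ennreal (gap (path_map M es x))) x"
proof -
  have "path_sum M (m + n) (\<lambda>es. ennreal (dist (path_map M es x) (word_pt (drop m es)))) x
    = path_sum M m (\<lambda>u. path_sum M n (\<lambda>v. ennreal (dist (path_map M v (path_map M u x)) (word_pt v))) (path_map M u x)) x"
    unfolding path_sum_append by (rule path_sum_cong) (simp add: path_map_append)
  also have "\<dots> \<le> path_sum M m (\<lambda>u. ennreal (a ^ n) * ennreal (gap (path_map M u x))) x"
    using dist_word_pt_path_sum[OF assms] a_pos by (intro path_sum_mono) (simp add: ennreal_mult)
  finally show ?thesis by (simp add: path_sum_cmult)
qed

text \<open>
  The starting laws for which the basic estimate is uniform in the time at which the path is split.
\<close>

definition gap_bounded :: "'k measure \<Rightarrow> real \<Rightarrow> bool" where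
  "gap_bounded \<nu> G \<longleftrightarrow> prob_space \<nu> \<and> sets \<nu> = sets borel \<and> 0 \<le> G \<and>
    (\<forall>k. (\<integral>\<^sup>+x. path_sum M k (\<lambda>es. ennreal (gap (path_map M es x))) x \<partial>\<nu>) \<le> ennreal G)"

definition word_mass :: "'k measure \<Rightarrow> 'e option list \<Rightarrow> ennreal" where
  "word_mass \<nu> es = (\<integral>\<^sup>+x. ennreal (path_prob M es x) \<partial>\<nu>)"

lemma nn_integral_path_sum_word_mass:
  assumes "sets \<nu> = sets borel"
  shows "(\<integral>\<^sup>+x. path_sum M n h x \<partial>\<nu>) = (\<integral>\<^sup>+es. word_mass \<nu> es * h es \<partial>count_space (words n))"
proof -
  note [measurable_cong] = assms
  have "(\<integral>\<^sup>+x. path_sum M n h x \<partial>\<nu>)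
    = (\<integral>\<^sup>+es. (\<integral>\<^sup>+x. ennreal (path_prob M es x) * h es \<partial>\<nu>) \<partial>count_space (words n))"
    by (rule nn_integral_path_sum[OF assms, of n "\<lambda>_. h"]) simp
  also have "\<dots> = (\<integral>\<^sup>+es. word_mass \<nu> es * h es \<partial>count_space (words n))"
    unfolding word_mass_def by (intro nn_integral_cong nn_integral_multc) measurable
  finally show ?thesis .
qed

lemma gap_bounded_tail:
  assumes \<nu>: "gap_bounded \<nu> G" and n: "0 < n"
  shows "(\<integral>\<^sup>+x. path_sum M (m + n) (\<lambda>es. ennreal (dist (path_map M es x) (word_pt (drop m es)))) x \<partial>\<nu>)
    \<le> ennreal (a ^ n * G)"
proof -
  note [measurable_cong] = \<nu>[unfolded gap_bounded_def, THEN conjunct2, THEN conjunct1]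
  have "(\<integral>\<^sup>+x. path_sum M (m + n) (\<lambda>es. ennreal (dist (path_map M es x) (word_pt (drop m es)))) x \<partial>\<nu>)
    \<le> (\<integral>\<^sup>+x. ennreal (a ^ n) * path_sum M m (\<lambda>es. ennreal (gap (path_map M es x))) x \<partial>\<nu>)"
    by (intro nn_integral_mono dist_word_pt_drop_path_sum n)
  also have "\<dots> = ennreal (a ^ n) * (\<integral>\<^sup>+x. path_sum M m (\<lambda>es. ennreal (gap (path_map M es x))) x \<partial>\<nu>)"
  proof (rule nn_integral_cmult)
    have "(\<lambda>x. path_sum M m (\<lambda>es. ennreal (gap (path_map M es x))) x) \<in> borel_measurable borel"
      by (rule measurable_path_sum) measurable
    then show "(\<lambda>x. path_sum M m (\<lambda>es. ennreal (gap (path_map M es x))) x) \<in> borel_measurable \<nu>"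
      by measurable
  qed
  also have "\<dots> \<le> ennreal (a ^ n) * ennreal G"
    using \<nu> by (intro mult_left_mono) (auto simp: gap_bounded_def)
  also have "\<dots> = ennreal (a ^ n * G)"
    using a_pos by (simp add: ennreal_mult')
  finally show ?thesis .
qed

lemma measurable_dist_path_map:
  "(\<lambda>x. ennreal (dist (path_map M es x) c)) \<in> borel_measurable borel"
  by (intro measurable_compose[OF _ measurable_ennreal] measurable_compose[OF measurable_path_map measurable_dist_const])

text \<open>
  Both points are compared with the true end point of the path.
\<close>

lemma word_pt_distance:
  assumes \<nu>: "gap_bounded \<nu> G" and n: "0 < n"
  shows "(\<integral>\<^sup>+es. word_mass \<nu> es * ennreal (dist (word_pt es) (word_pt (drop m es))) \<partial>count_space (words (m + n)))
    \<le> ennreal ((a ^ (m + n) + a ^ n) * G)"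
proof -
  have sets: "sets \<nu> = sets borel" using \<nu> by (simp add: gap_bounded_def)
  note [measurable_cong] = sets
  let ?f = "\<lambda>x. path_sum M (m + n) (\<lambda>es. ennreal (dist (path_map M es x) (word_pt (drop 0 es)))) x"
  let ?g = "\<lambda>x. path_sum M (m + n) (\<lambda>es. ennreal (dist (path_map M es x) (word_pt (drop m es)))) x"
  have [measurable]: "?f \<in> borel_measurable borel" "?g \<in> borel_measurable borel"
    by (intro measurable_path_sum measurable_dist_path_map)+
  have "(\<integral>\<^sup>+es. word_mass \<nu> es * ennreal (dist (word_pt es) (word_pt (drop m es))) \<partial>count_space (words (m + n)))
    = (\<integral>\<^sup>+x. path_sum M (m + n) (\<lambda>es. ennreal (dist (word_pt es) (word_pt (drop m es)))) x \<partial>\<nu>)"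
    by (rule nn_integral_path_sum_word_mass[OF sets, symmetric])
  also have "\<dots> \<le> (\<integral>\<^sup>+x. ?f x + ?g x \<partial>\<nu>)"
    unfolding path_sum_add[symmetric]
    by (intro nn_integral_mono path_sum_mono)
       (simp add: ennreal_leI dist_triangle3 flip: ennreal_plus)
  also have "\<dots> = (\<integral>\<^sup>+x. ?f x \<partial>\<nu>) + (\<integral>\<^sup>+x. ?g x \<partial>\<nu>)"
    by (rule nn_integral_add) measurable
  also have "\<dots> \<le> ennreal (a ^ (m + n) * G) + ennreal (a ^ n * G)"
    using gap_bounded_tail[OF \<nu>, of "m + n" 0] gap_bounded_tail[OF \<nu> n, of m] n by (intro add_mono) simp_all
  also have "\<dots> = ennreal ((a ^ (m + n) + a ^ n) * G)"
    using a_pos \<nu> by (simp add: gap_bounded_def distrib_right flip: ennreal_plus)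
  finally show ?thesis .
qed

text \<open>
  Uniform continuity in a linear form that can be integrated: where the distance exceeds the modulus
  of continuity, the second summand is already at least \<open>1\<close>.
\<close>

lemma wprob_oscillation:
  assumes "0 < \<epsilon>"
  shows "\<exists>\<delta>>0. \<forall>x y. vertex x = vertex y \<longrightarrow> \<bar>wprob M e x - wprob M e y\<bar> \<le> \<epsilon> + dist x y / \<delta>"
proof -
  obtain \<delta> where \<delta>: "\<delta> > 0"
    "\<And>x y. x \<in> cell M (ini M e) \<Longrightarrow> y \<in> cell M (ini M e) \<Longrightarrow> dist y x < \<delta> \<Longrightarrow> dist (wprob M e y) (wprob M e x) < \<epsilon>"
    using uniform assms unfolding uniformly_continuous_system_def uniformly_continuous_on_def by metis
  have "\<bar>wprob M e x - wprob M e y\<bar> \<le> \<epsilon> + dist x y / \<delta>" if v: "vertex x = vertex y" for x y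
  proof (cases "vertex x = ini M e")
    case False
    then have "wprob M e x = 0" "wprob M e y = 0"
      using wprob_opt_supported(2)[of "Some e" x] wprob_opt_supported(2)[of "Some e" y] v by auto
    then show ?thesis using \<delta> assms by simp
  next
    case True
    then have in_cell: "x \<in> cell M (ini M e)" "y \<in> cell M (ini M e)"
      using v in_cell_iff[OF ini_in_vert] by auto
    show ?thesis
    proof (cases "dist x y < \<delta>")
      case True
      then have "\<bar>wprob M e x - wprob M e y\<bar> < \<epsilon>" using \<delta>(2)[OF in_cell(2,1)] by (simp add: dist_real_def)
      moreover have "0 \<le> dist x y / \<delta>" using \<delta> by simp
      ultimately show ?thesis by linarith
    next
      case False
      have "\<bar>wprob M e x - wprob M e y\<bar> \<le> 1"
        using wprob_opt_le_1[of "Some e" x] wprob_opt_le_1[of "Some e" y] wprob_opt_nonneg[of "Some e" x] wprob_opt_nonneg[of "Some e" y] by auto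
      also have "1 \<le> dist x y / \<delta>" using False \<delta> by (simp add: field_simps)
      finally show ?thesis using assms by simp
    qed
  qed
  then show ?thesis using \<delta>(1) by auto
qed

lemma word_mass_le_1: "prob_space \<nu> \<Longrightarrow> word_mass \<nu> es \<le> 1"
proof -
  assume "prob_space \<nu>"
  have "word_mass \<nu> es \<le> (\<integral>\<^sup>+x. 1 \<partial>\<nu>)"
    unfolding word_mass_def by (intro nn_integral_mono) (simp add: path_prob_le_1)
  then show ?thesis using \<open>prob_space \<nu>\<close> by (simp add: prob_space.emeasure_space_1)
qed

text \<open>
  The probability of the letter \<open>e\<close> after the word \<open>es\<close> is an average of \<open>p_e\<close> at true end points.
  Replacing it by \<open>p_e\<close> at the \<open>word_pt\<close> costs little in total over all words of length \<open>n\<close>, by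
  the basic estimate.
\<close>

lemma word_mass_oscillation:
  assumes \<nu>: "gap_bounded \<nu> G" and n: "0 < n"
    and \<delta>: "0 < \<delta>" "0 < \<epsilon>" "\<And>x y. vertex x = vertex y \<Longrightarrow> \<bar>wprob M e x - wprob M e y\<bar> \<le> \<epsilon> + dist x y / \<delta>"
  shows "(\<integral>\<^sup>+es. ennreal \<bar>enn2real (word_mass \<nu> (es @ [Some e])) - enn2real (word_mass \<nu> es) * wprob M e (word_pt es)\<bar>
      \<partial>count_space (words n)) \<le> ennreal (\<epsilon> + a ^ n * G / \<delta>)"
proof -
  interpret \<nu>: prob_space \<nu> using \<nu> by (simp add: gap_bounded_def)
  have sets[measurable_cong]: "sets \<nu> = sets borel" and G: "0 \<le> G" using \<nu> by (simp_all add: gap_bounded_def)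
  have [measurable]: "wprob M e \<in> borel_measurable borel" using measurable_wprob_opt[of "Some e"] by simp
  have p: "0 \<le> wprob M e x" "wprob M e x \<le> 1" for x
    using wprob_opt_le_1[of "Some e" x] wprob_opt_nonneg[of "Some e" x] by simp_all
  let ?h = "\<lambda>x es. \<bar>wprob M e (path_map M es x) - wprob M e (word_pt es)\<bar>"
  have mass: "enn2real (word_mass \<nu> es) = (\<integral>x. path_prob M es x \<partial>\<nu>)" for es
    unfolding word_mass_def by (subst integral_eq_nn_integral) auto
  have int: "integrable \<nu> (path_prob M es)" for es
    by (rule \<nu>.integrable_const_bound[of _ 1]) (auto simp: path_prob_le_1)
  have "ennreal \<bar>enn2real (word_mass \<nu> (es @ [Some e])) - enn2real (word_mass \<nu> es) * wprob M e (word_pt es)\<bar>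
      \<le> (\<integral>\<^sup>+x. ennreal (path_prob M es x) * ennreal (?h x es) \<partial>\<nu>)" for es
  proof -
    have eq: "path_prob M (es @ [Some e]) x - path_prob M es x * wprob M e (word_pt es)
        = path_prob M es x * (wprob M e (path_map M es x) - wprob M e (word_pt es))" for x
      by (simp add: path_prob_append algebra_simps)
    have "enn2real (word_mass \<nu> (es @ [Some e])) - enn2real (word_mass \<nu> es) * wprob M e (word_pt es)
      = (\<integral>x. path_prob M (es @ [Some e]) x - path_prob M es x * wprob M e (word_pt es) \<partial>\<nu>)"
      unfolding mass using int by simp
    also have "\<bar>\<dots>\<bar> \<le> (\<integral>x. \<bar>path_prob M (es @ [Some e]) x - path_prob M es x * wprob M e (word_pt es)\<bar> \<partial>\<nu>)"
      by (rule integral_abs_bound)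
    also have "\<dots> = (\<integral>x. path_prob M es x * ?h x es \<partial>\<nu>)"
      unfolding eq by (simp add: abs_mult)
    finally have "ennreal \<bar>enn2real (word_mass \<nu> (es @ [Some e])) - enn2real (word_mass \<nu> es) * wprob M e (word_pt es)\<bar>
      \<le> ennreal (\<integral>x. path_prob M es x * ?h x es \<partial>\<nu>)" by (rule ennreal_leI)
    also have "\<dots> = (\<integral>\<^sup>+x. ennreal (path_prob M es x * ?h x es) \<partial>\<nu>)"
    proof (rule nn_integral_eq_integral[symmetric])
      have "\<bar>path_prob M es x * ?h x es\<bar> \<le> 1" for x
        using p[of "path_map M es x"] p[of "word_pt es"] path_prob_le_1[of es x] by (simp add: abs_mult mult_le_one)
      then show "integrable \<nu> (\<lambda>x. path_prob M es x * ?h x es)"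
        by (intro \<nu>.integrable_const_bound[of _ 1]) auto
    qed auto
    finally show ?thesis by (simp add: ennreal_mult)
  qed
  then have "(\<integral>\<^sup>+es. ennreal \<bar>enn2real (word_mass \<nu> (es @ [Some e])) - enn2real (word_mass \<nu> es) * wprob M e (word_pt es)\<bar> \<partial>count_space (words n))
    \<le> (\<integral>\<^sup>+es. (\<integral>\<^sup>+x. ennreal (path_prob M es x) * ennreal (?h x es) \<partial>\<nu>) \<partial>count_space (words n))"
    by (intro nn_integral_mono)
  also have "\<dots> = (\<integral>\<^sup>+x. path_sum M n (\<lambda>es. ennreal (?h x es)) x \<partial>\<nu>)"
    by (rule nn_integral_path_sum[OF sets, symmetric]) measurable
  also have "\<dots> \<le> (\<integral>\<^sup>+x. ennreal \<epsilon> + ennreal (1 / \<delta>) * path_sum M n (\<lambda>es. ennreal (dist (path_map M es x) (word_pt es))) x \<partial>\<nu>)"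
  proof (intro nn_integral_mono)
    fix x
    have "path_sum M n (\<lambda>es. ennreal (?h x es)) x
      \<le> path_sum M n (\<lambda>es. ennreal \<epsilon> + ennreal (1 / \<delta>) * ennreal (dist (path_map M es x) (word_pt es))) x"
    proof (rule path_sum_mono)
      fix es :: "'e option list" assume es: "length es = n" "path_prob M es x \<noteq> 0"
      then have "es \<noteq> []" using n by auto
      then have "vertex (path_map M es x) = vertex (word_pt es)"
        using vertex_path_map(1)[OF es(2)] vertex_path_map_cong[OF es(2) vertex_xs[OF vertex_in]]
        by (simp add: word_pt_def)
      from \<delta>(3)[OF this] have "ennreal (?h x es) \<le> ennreal (\<epsilon> + 1 / \<delta> * dist (path_map M es x) (word_pt es))"
        by (intro ennreal_leI) simp
      also have "\<dots> = ennreal \<epsilon> + ennreal (1 / \<delta>) * ennreal (dist (path_map M es x) (word_pt es))"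
        using \<delta>(1,2) by (subst ennreal_plus) (auto simp: ennreal_mult'[symmetric])
      finally show "ennreal (?h x es) \<le> \<dots>" .
    qed
    then show "path_sum M n (\<lambda>es. ennreal (?h x es)) x
      \<le> ennreal \<epsilon> + ennreal (1 / \<delta>) * path_sum M n (\<lambda>es. ennreal (dist (path_map M es x) (word_pt es))) x"
      by (simp add: path_sum_add path_sum_cmult path_sum_const)
  qed
  also have "\<dots> = ennreal \<epsilon> + ennreal (1 / \<delta>) * (\<integral>\<^sup>+x. path_sum M n (\<lambda>es. ennreal (dist (path_map M es x) (word_pt es))) x \<partial>\<nu>)"
  proof -
    have "(\<lambda>x. path_sum M n (\<lambda>es. ennreal (dist (path_map M es x) (word_pt es))) x) \<in> borel_measurable borel"
      by (intro measurable_path_sum measurable_dist_path_map)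
    then have [measurable]: "(\<lambda>x. path_sum M n (\<lambda>es. ennreal (dist (path_map M es x) (word_pt es))) x) \<in> borel_measurable \<nu>"
      by measurable
    show ?thesis by (simp add: nn_integral_add nn_integral_cmult \<nu>.emeasure_space_1)
  qed
  also have "\<dots> \<le> ennreal \<epsilon> + ennreal (1 / \<delta>) * ennreal (a ^ n * G)"
    using gap_bounded_tail[OF \<nu> n, of 0] by (intro add_left_mono mult_left_mono) simp_all
  also have "\<dots> = ennreal (\<epsilon> + a ^ n * G / \<delta>)"
    using \<delta>(1,2) a_pos G by (simp add: ennreal_mult'[symmetric] flip: ennreal_plus)
  finally show ?thesis .
qed

end

section \<open>The past of a code\<close>

lemma space_past [simp]: "space past = UNIV"
  by (simp add: past_def)

lemma sets_past:
  "sets (past :: (int \<Rightarrow> 'e::countable option) measure)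
    = sigma_sets UNIV {(\<lambda>\<sigma>. map \<sigma> [- int n..0]) -` {c} |n c. True}" (is "_ = sigma_sets _ ?E")
proof -
  have cyl: "cylinder (- int n) c = (\<lambda>\<sigma>. map \<sigma> [- int n..0]) -` {c}" if "length c = Suc n" for n and c :: "'e option list"
    using that by (auto simp: cylinder_eq_window)
  have "(\<lambda>\<sigma>. map \<sigma> [- int n..0]) -` {c} \<in> sigma_sets UNIV {cylinder (- int l) es |l es. length es = Suc l}"
    for n and c :: "'e option list"
  proof (cases "length c = Suc n")
    case True then show ?thesis unfolding cyl[OF True, symmetric] by (intro sigma_sets.Basic) auto
  next
    case False
    then have "(\<lambda>\<sigma>. map \<sigma> [- int n..0]) -` {c} = {}" by auto
    then show ?thesis by (simp add: sigma_sets.Empty)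
  qed
  moreover have "cylinder (- int l) es \<in> sigma_sets UNIV ?E" if "length es = Suc l" for l and es :: "'e option list"
    unfolding cyl[OF that] by (intro sigma_sets.Basic) auto
  ultimately have "sigma_sets UNIV {cylinder (- int l) es |l es. length es = Suc l} = sigma_sets UNIV ?E"
    by (intro sigma_sets_eqI) auto
  then show ?thesis by (simp add: past_def)
qed

lemma measurable_past_window [measurable]:
  "(\<lambda>\<sigma>. map \<sigma> [- int n..0]) \<in> (past :: (int \<Rightarrow> 'e::countable option) measure) \<rightarrow>\<^sub>M count_space UNIV"
  by (rule measurable_countable_typeI) (auto simp: sets_past intro!: sigma_sets.Basic)

lemma measurable_past_coordinate:
  assumes "i \<le> 0"
  shows "(\<lambda>\<sigma>. \<sigma> i) \<in> (past :: (int \<Rightarrow> 'e::countable option) measure) \<rightarrow>\<^sub>M count_space UNIV"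
proof -
  define n where "n = nat (- i)"
  have "(\<lambda>\<sigma>. hd (map \<sigma> [- int n..0])) \<in> (past :: (int \<Rightarrow> 'e option) measure) \<rightarrow>\<^sub>M count_space UNIV"
    by measurable
  moreover have "hd (map \<sigma> [- int n..0]) = \<sigma> i" for \<sigma> :: "int \<Rightarrow> 'e option"
    using assms by (simp add: n_def hd_map upto_rec1)
  ultimately show ?thesis by simp
qed

lemma sets_past_subset: "sets past \<subseteq> sets (code_borel :: (int \<Rightarrow> 'e::countable option) measure)"
proof -
  have "(\<lambda>\<sigma>. map \<sigma> [- int n..0]) -` {c} \<in> sets (code_borel :: (int \<Rightarrow> 'e option) measure)" for n c
    using measurable_sets[OF measurable_window, of "{c}" "[- int n..0]"] by simp
  then show ?thesis
    unfolding sets_past using sets.sigma_sets_subset[of "{(\<lambda>\<sigma>. map \<sigma> [- int n..0]) -` {c} |n c. True}" "code_borel :: (int \<Rightarrow> 'e option) measure"]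
    by auto
qed

lemma subalgebra_past:
  assumes "sets \<Lambda> = sets (code_borel :: (int \<Rightarrow> 'e::countable option) measure)"
  shows "subalgebra \<Lambda> past"
  using assms sets_past_subset sets_eq_imp_space_eq[OF assms] by (simp add: subalgebra_def)

lemma finite_measure_past_eqI:
  fixes P Q :: "(int \<Rightarrow> 'e::countable option) measure"
  assumes "sets P = sets past" "sets Q = sets past" "finite_measure P"
    and eq: "\<And>n es. length es = Suc n \<Longrightarrow> emeasure P (cylinder (- int n) es) = emeasure Q (cylinder (- int n) es)"
  shows "P = Q"
proof (rule measure_eqI_nested[where X = "\<lambda>n \<sigma>. map \<sigma> [- int n..0]"])
  show "map x [- int n..0] = map y [- int n..0]"
    if "map x [- int (Suc n)..0] = map y [- int (Suc n)..0]" for n and x y :: "int \<Rightarrow> 'e option"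
    using that by (auto simp: map_eq_conv)
  fix n and c :: "'e option list"
  show "emeasure P ((\<lambda>\<sigma>. map \<sigma> [- int n..0]) -` {c}) = emeasure Q ((\<lambda>\<sigma>. map \<sigma> [- int n..0]) -` {c})"
  proof (cases "length c = Suc n")
    case True
    then have "(\<lambda>\<sigma>. map \<sigma> [- int n..0]) -` {c} = cylinder (- int n) c"
      by (auto simp: cylinder_eq_window)
    then show ?thesis using eq[OF True] by simp
  next
    case False
    then have "(\<lambda>\<sigma>. map \<sigma> [- int n..0]) -` {c} = {}" by auto
    then show ?thesis by simp
  qed
qed (use assms sets_past in auto)

lemma nn_integral_window:
  fixes \<Lambda> :: "(int \<Rightarrow> 'e::countable option) measure"
  assumes [measurable_cong]: "sets \<Lambda> = sets code_borel"
  shows "(\<integral>\<^sup>+\<sigma>. h (map \<sigma> [- int n..0]) \<partial>\<Lambda>)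
    = (\<integral>\<^sup>+es. emeasure \<Lambda> (cylinder (- int n) es) * h es \<partial>count_space (words (Suc n)))"
proof -
  have "h (map \<sigma> [- int n..0]) = (\<integral>\<^sup>+es. h es * indicator (cylinder (- int n) es) \<sigma> \<partial>count_space (words (Suc n)))" for \<sigma> :: "int \<Rightarrow> 'e option"
  proof -
    have "(\<integral>\<^sup>+es. h es * indicator (cylinder (- int n) es) \<sigma> \<partial>count_space (words (Suc n)))
      = (\<integral>\<^sup>+es. h es * indicator {es. es = map \<sigma> [- int n..0]} es \<partial>count_space (words (Suc n)))"
      by (intro nn_integral_cong) (auto simp: cylinder_eq_window indicator_def)
    then show ?thesis by (simp add: nn_integral_words_point)
  qed
  then have "(\<integral>\<^sup>+\<sigma>. h (map \<sigma> [- int n..0]) \<partial>\<Lambda>)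
      = (\<integral>\<^sup>+\<sigma>. (\<integral>\<^sup>+es. h es * indicator (cylinder (- int n) es) \<sigma> \<partial>count_space (words (Suc n))) \<partial>\<Lambda>)"
    by simp
  also have "\<dots> = (\<integral>\<^sup>+es. (\<integral>\<^sup>+\<sigma>. h es * indicator (cylinder (- int n) es) \<sigma> \<partial>\<Lambda>) \<partial>count_space (words (Suc n)))"
    by (rule nn_integral_count_space_nn_integral) auto
  also have "\<dots> = (\<integral>\<^sup>+es. emeasure \<Lambda> (cylinder (- int n) es) * h es \<partial>count_space (words (Suc n)))"
    by (intro nn_integral_cong) (simp add: nn_integral_cmult_indicator mult.commute)
  finally show ?thesis .
qed

section \<open>Measurability of the coding map\<close>

lemma convergent_if_summable_dist:
  fixes f :: "nat \<Rightarrow> 'k::complete_space"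
  assumes "summable (\<lambda>n. dist (f n) (f (Suc n)))"
  shows "convergent f"
proof -
  let ?s = "\<lambda>n. \<Sum>k<n. dist (f k) (f (Suc k))"
  have le: "dist (f m) (f n) \<le> \<bar>?s m - ?s n\<bar>" if "m \<le> n" for m n
  proof -
    have "dist (f m) (f n) \<le> ?s n - ?s m"
      using that
    proof (induction n rule: dec_induct)
      case (step n)
      have "dist (f m) (f (Suc n)) \<le> dist (f m) (f n) + dist (f n) (f (Suc n))" by (rule dist_triangle)
      then show ?case using step by simp
    qed simp
    then show ?thesis by simp
  qed
  have "Cauchy ?s"
    using assms by (simp add: summable_iff_convergent convergent_Cauchy)
  have "Cauchy f"
  proof (rule metric_CauchyI)
    fix e :: real assume "0 < e"
    then obtain N where N: "\<And>m n. m \<ge> N \<Longrightarrow> n \<ge> N \<Longrightarrow> dist (?s m) (?s n) < e"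
      using \<open>Cauchy ?s\<close> unfolding Cauchy_def by blast
    have "dist (f m) (f n) < e" if "m \<ge> N" "n \<ge> N" for m n
      using N[OF that] le[of m n] le[of n m] by (cases "m \<le> n") (auto simp: dist_real_def dist_commute abs_minus_commute)
    then show "\<exists>N. \<forall>m\<ge>N. \<forall>n\<ge>N. dist (f m) (f n) < e" by blast
  qed
  then show ?thesis by (rule Cauchy_convergent)
qed

context contractive_markov_system
begin

lemma coding_approx_window: "coding_approx M xs \<sigma> n = word_pt (map \<sigma> [- int n..0])"
proof -
  have "back_comp M \<sigma> n x = path_map M (map \<sigma> [- int n..0]) x" for x
  proof (induction n arbitrary: x)
    case (Suc n)
    have "[- int (Suc n)..0] = - int (Suc n) # [- int n..0]" by (simp add: upto_rec1)
    then show ?case using Suc by simp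
  qed simp
  moreover have "hd (map \<sigma> [- int n..0]) = \<sigma> (- int n)" by (simp add: hd_map upto_rec1)
  ultimately show ?thesis by (simp add: coding_approx_def word_pt_def)
qed

lemma drop_window: "m \<le> n \<Longrightarrow> drop (n - m) (map \<sigma> [- int n..0]) = map \<sigma> [- int m..0]"
  by (auto intro!: nth_equalityI)

lemma measurable_coding_approx [measurable]:
  "(\<lambda>\<sigma>. coding_approx M xs \<sigma> n) \<in> past \<rightarrow>\<^sub>M borel"
  unfolding coding_approx_window by measurable

text \<open>
  On a space that is not separable the distance need not be jointly measurable, but the approximations
  are functions of finitely many letters and take only countably many values.
\<close>

lemma measurable_dist_coding_approx [measurable]:
  "(\<lambda>\<sigma>. dist (coding_approx M xs \<sigma> n) (coding_approx M xs \<sigma> m)) \<in> borel_measurable past"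
proof -
  have *: "(\<lambda>\<sigma>. dist (coding_approx M xs \<sigma> n) (coding_approx M xs \<sigma> m)) \<in> borel_measurable past" if "m \<le> n" for m n
  proof -
    have "dist (coding_approx M xs \<sigma> n) (coding_approx M xs \<sigma> m)
      = (\<lambda>es. dist (word_pt es) (word_pt (drop (n - m) es))) (map \<sigma> [- int n..0])" for \<sigma>
      by (simp add: coding_approx_window drop_window[OF that])
    then show ?thesis by simp measurable
  qed
  show ?thesis using *[of m n] *[of n m] by (cases "m \<le> n") (simp_all add: dist_commute)
qed

lemma measurable_convergent_coding_approx [measurable]:
  "Measurable.pred past (\<lambda>\<sigma>. convergent (coding_approx M xs \<sigma>))"
proof -
  have "convergent f \<longleftrightarrow> (\<forall>j::nat. \<exists>N. \<forall>m\<ge>N. \<forall>n\<ge>N. dist (f m) (f n) < inverse (real (Suc j)))" for f :: "nat \<Rightarrow> 'k"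
    unfolding Cauchy_convergent_iff[symmetric] by (rule metric_Cauchy_iff2)
  then show ?thesis by simp measurable
qed

text \<open>
  The coding map depends on the future, because its domain consists of codes that are admissible at
  all times.  This version is measurable with respect to the past and agrees with it on
  \<open>SigmaG M\<close>.
\<close>

definition past_coding :: "(int \<Rightarrow> 'e option) \<Rightarrow> 'k" where
  "past_coding \<sigma> = (if convergent (coding_approx M xs \<sigma>) then lim (coding_approx M xs \<sigma>) else xs (ter_opt M (\<sigma> 0)))"

lemma measurable_past_coding [measurable]: "past_coding \<in> past \<rightarrow>\<^sub>M borel"
proof (rule borel_measurable_LIMSEQ_metric)
  let ?u = "\<lambda>n \<sigma>. if convergent (coding_approx M xs \<sigma>) then coding_approx M xs \<sigma> n else xs (ter_opt M (\<sigma> 0))"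
  have [measurable]: "(\<lambda>\<sigma>. \<sigma> 0) \<in> (past :: (int \<Rightarrow> 'e option) measure) \<rightarrow>\<^sub>M count_space UNIV"
    by (rule measurable_past_coordinate) simp
  have [measurable]: "(\<lambda>\<sigma>. xs (ter_opt M (\<sigma> 0))) \<in> past \<rightarrow>\<^sub>M borel"
    by (rule measurable_compose[where g = "\<lambda>e. xs (ter_opt M e)" and N = "count_space UNIV"]) measurable
  show "?u n \<in> past \<rightarrow>\<^sub>M borel" for n by measurable
  show "(\<lambda>n. ?u n \<sigma>) \<longlonglongrightarrow> past_coding \<sigma>" for \<sigma>
    by (simp add: past_coding_def convergent_LIMSEQ_iff)
qed

lemma measurable_from_past:
  fixes f :: "(int \<Rightarrow> 'e option) \<Rightarrow> 'z"
  shows "f \<in> past \<rightarrow>\<^sub>M N \<Longrightarrow> f \<in> code_borel \<rightarrow>\<^sub>M N"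
  using sets_past_subset by (auto simp: measurable_def)

lemma sets_SigmaG [measurable]: "SigmaG M \<in> sets code_borel"
proof -
  have "{\<sigma> \<in> space (code_borel :: (int \<Rightarrow> 'e option) measure). \<forall>n. \<sigma> n \<noteq> None \<and> ini_opt M (\<sigma> (n + 1)) = ter_opt M (\<sigma> n)} \<in> sets code_borel"
    by measurable
  then show ?thesis by (simp add: SigmaG_def)
qed

lemma sets_coding_domain [measurable]: "coding_domain M xs \<in> sets code_borel"
proof -
  have [measurable]: "Measurable.pred code_borel (\<lambda>\<sigma>. convergent (coding_approx M xs \<sigma>))"
    by (rule measurable_from_past) measurable
  have "{\<sigma> \<in> space (code_borel :: (int \<Rightarrow> 'e option) measure). \<sigma> \<in> SigmaG M \<and> convergent (coding_approx M xs \<sigma>)} \<in> sets code_borel"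
    by measurable
  then show ?thesis by (simp add: coding_domain_def)
qed

lemma coding_eq_past_coding: "\<sigma> \<in> SigmaG M \<Longrightarrow> coding M xs \<sigma> = past_coding \<sigma>"
  by (simp add: coding_def past_coding_def coding_domain_def)

lemma measurable_coding [measurable]: "coding M xs \<in> code_borel \<rightarrow>\<^sub>M borel"
proof -
  have [measurable]: "past_coding \<in> code_borel \<rightarrow>\<^sub>M borel" by (rule measurable_from_past) measurable
  have [measurable]: "(\<lambda>\<sigma> :: int \<Rightarrow> 'e option. xs (ter_opt M (\<sigma> 0))) \<in> code_borel \<rightarrow>\<^sub>M borel"
    by (rule measurable_compose[OF measurable_code_coordinate[of "0 :: int"], where g = "\<lambda>e. xs (ter_opt M e)"]) simp
  have "coding M xs = (\<lambda>\<sigma>. if \<sigma> \<in> SigmaG M then past_coding \<sigma> else xs (ter_opt M (\<sigma> 0)))"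
    by (auto simp: fun_eq_iff coding_eq_past_coding) (simp add: coding_def coding_domain_def)
  then show ?thesis by simp measurable
qed

lemma coding_approx_tendsto: "\<sigma> \<in> coding_domain M xs \<Longrightarrow> coding_approx M xs \<sigma> \<longlonglongrightarrow> coding M xs \<sigma>"
  by (simp add: coding_def coding_domain_def convergent_LIMSEQ_iff)

section \<open>Limit states\<close>

text \<open>
  The common form of the measures \<open>\<Phi>(\<mu>)\<close>, where the sequence \<open>\<nu>\<close> is constant, and of the
  states obtained from averaged orbits.
\<close>

definition limit_state :: "(int \<Rightarrow> 'e option) measure \<Rightarrow> (nat \<Rightarrow> 'k measure) \<Rightarrow> real \<Rightarrow> bool" where
  "limit_state \<Lambda> \<nu> G \<longleftrightarrow> \<Lambda> \<in> shift_invariant \<and> (\<forall>r. gap_bounded (\<nu> r) G) \<and>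
    (\<forall>m es. (\<lambda>r. word_mass (\<nu> r) es) \<longlonglongrightarrow> emeasure \<Lambda> (cylinder m es))"

lemma limit_stateD:
  assumes "limit_state \<Lambda> \<nu> G"
  shows "prob_space \<Lambda>" "sets \<Lambda> = sets code_borel" "gap_bounded (\<nu> r) G" "0 \<le> G"
    "(\<lambda>r. word_mass (\<nu> r) es) \<longlonglongrightarrow> emeasure \<Lambda> (cylinder m es)"
  using assms by (auto simp: limit_state_def shift_invariant_def gap_bounded_def)

lemma word_mass_0: "(\<And>x. path_prob M es x = 0) \<Longrightarrow> word_mass \<nu> es = 0"
  by (simp add: word_mass_def)

lemma SigmaG_almost_surely:
  assumes sets[measurable_cong]: "sets \<Lambda> = sets code_borel"
    and zero: "\<And>n es. (\<And>x. path_prob M es x = 0) \<Longrightarrow> emeasure \<Lambda> (cylinder n es) = 0"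
  shows "AE \<sigma> in \<Lambda>. \<sigma> \<in> SigmaG M"
proof -
  have bad: "path_prob M [e, e'] x = 0" if "e = None \<or> ini_opt M e' \<noteq> ter_opt M e" for e e' x
  proof (rule ccontr)
    assume "path_prob M [e, e'] x \<noteq> 0"
    then have *: "wprob_opt M e x \<noteq> 0" "wprob_opt M e' (wmap_opt M e x) \<noteq> 0" by auto
    have "vertex (wmap_opt M e x) = ter_opt M e" "vertex (wmap_opt M e x) = ini_opt M e'"
      using vertex_wmap_opt[OF wprob_opt_supported[OF *(1)]] wprob_opt_supported(2)[OF *(2)] by auto
    then show False using that wprob_opt_supported(1)[OF *(1)] by auto
  qed
  have "AE \<sigma> in \<Lambda>. (e = None \<or> ini_opt M e' \<noteq> ter_opt M e) \<longrightarrow> \<sigma> \<notin> cylinder n [e, e']" for n e e'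
  proof (cases "e = None \<or> ini_opt M e' \<noteq> ter_opt M e")
    case True
    then have "emeasure \<Lambda> (cylinder n [e, e']) = 0" using bad by (intro zero) simp
    then have "cylinder n [e, e'] \<in> null_sets \<Lambda>" by (simp add: null_sets_def sets)
    from AE_not_in[OF this] show ?thesis by (rule eventually_mono) simp
  next
    case False
    show ?thesis by (rule AE_I2) (use False in blast)
  qed
  then have "AE \<sigma> in \<Lambda>. \<forall>n e e'. (e = None \<or> ini_opt M e' \<noteq> ter_opt M e) \<longrightarrow> \<sigma> \<notin> cylinder n [e, e']"
    by (simp add: AE_all_countable)
  then show ?thesis
  proof (rule AE_mp, intro AE_I2 impI)
    fix \<sigma> assume *: "\<forall>n e e'. (e = None \<or> ini_opt M e' \<noteq> ter_opt M e) \<longrightarrow> \<sigma> \<notin> cylinder n [e, e']"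
    have "\<sigma> n \<noteq> None \<and> ini_opt M (\<sigma> (n + 1)) = ter_opt M (\<sigma> n)" for n
    proof (rule ccontr)
      assume "\<not> ?thesis"
      then have "\<sigma> n = None \<or> ini_opt M (\<sigma> (n + 1)) \<noteq> ter_opt M (\<sigma> n)" by argo
      then have "\<sigma> \<notin> cylinder n [\<sigma> n, \<sigma> (n + 1)]"
        by (rule mp[OF spec[OF spec[OF spec[OF *, of n], of "\<sigma> n"], of "\<sigma> (n + 1)"]])
      then show False by (auto simp: cylinder_def less_Suc_eq)
    qed
    then show "\<sigma> \<in> SigmaG M" by (simp add: SigmaG_def)
  qed
qed

lemma limit_state_SigmaG:
  assumes "limit_state \<Lambda> \<nu> G"
  shows "AE \<sigma> in \<Lambda>. \<sigma> \<in> SigmaG M"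
proof (rule SigmaG_almost_surely)
  show "sets \<Lambda> = sets code_borel" by (rule limit_stateD[OF assms])
  fix n and es :: "'e option list" assume "\<And>x. path_prob M es x = 0"
  then have "word_mass (\<nu> r) es = 0" for r by (rule word_mass_0)
  with limit_stateD(5)[OF assms, of es n] show "emeasure \<Lambda> (cylinder n es) = 0"
    by (simp add: LIMSEQ_const_iff)
qed

text \<open>
  The estimate for the starting laws passes to the limit by Fatou's lemma for the sum over words.
\<close>

lemma limit_state_dist_approx:
  assumes \<Lambda>: "limit_state \<Lambda> \<nu> G" and "m \<le> n"
  shows "(\<integral>\<^sup>+\<sigma>. ennreal (dist (coding_approx M xs \<sigma> n) (coding_approx M xs \<sigma> m)) \<partial>\<Lambda>)
    \<le> ennreal ((a ^ Suc n + a ^ Suc m) * G)"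
proof -
  let ?h = "\<lambda>es. ennreal (dist (word_pt es) (word_pt (drop (n - m) es)))"
  have "(\<integral>\<^sup>+\<sigma>. ennreal (dist (coding_approx M xs \<sigma> n) (coding_approx M xs \<sigma> m)) \<partial>\<Lambda>)
    = (\<integral>\<^sup>+\<sigma>. ?h (map \<sigma> [- int n..0]) \<partial>\<Lambda>)"
    by (simp add: coding_approx_window drop_window[OF assms(2)])
  also have "\<dots> = (\<integral>\<^sup>+es. emeasure \<Lambda> (cylinder (- int n) es) * ?h es \<partial>count_space (words (Suc n)))"
    by (rule nn_integral_window[OF limit_stateD(2)[OF \<Lambda>]])
  also have "\<dots> \<le> ennreal ((a ^ Suc n + a ^ Suc m) * G)"
  proof (rule nn_integral_Fatou_bound[where f = "\<lambda>r es. word_mass (\<nu> r) es * ?h es" and C = "\<lambda>_. ennreal ((a ^ Suc n + a ^ Suc m) * G)"])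
    show "AE es in count_space (words (Suc n)). (\<lambda>r. word_mass (\<nu> r) es * ?h es) \<longlonglongrightarrow> emeasure \<Lambda> (cylinder (- int n) es) * ?h es"
    proof (rule AE_I2)
      fix es :: "'e option list"
      show "(\<lambda>r. word_mass (\<nu> r) es * ?h es) \<longlonglongrightarrow> emeasure \<Lambda> (cylinder (- int n) es) * ?h es"
        using ennreal_tendsto_cmult[OF ennreal_less_top limit_stateD(5)[OF \<Lambda>, of es "- int n"], of "dist (word_pt es) (word_pt (drop (n - m) es))"]
        by (simp add: mult.commute)
    qed
    show "(\<integral>\<^sup>+es. word_mass (\<nu> r) es * ?h es \<partial>count_space (words (Suc n))) \<le> ennreal ((a ^ Suc n + a ^ Suc m) * G)" for r
      using word_pt_distance[OF limit_stateD(3)[OF \<Lambda>], of "Suc m" "n - m" r] assms(2) by simp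
  qed auto
  finally show ?thesis .
qed

lemma limit_state_coding_domain:
  assumes \<Lambda>: "limit_state \<Lambda> \<nu> G"
  shows "AE \<sigma> in \<Lambda>. \<sigma> \<in> coding_domain M xs"
proof -
  note sets[measurable_cong] = limit_stateD(2)[OF \<Lambda>]
  have [measurable]: "(\<lambda>\<sigma>. dist (coding_approx M xs \<sigma> n) (coding_approx M xs \<sigma> m)) \<in> borel_measurable code_borel" for n m
    by (rule measurable_from_past) measurable
  have "(\<integral>\<^sup>+\<sigma>. (\<Sum>n. ennreal (dist (coding_approx M xs \<sigma> n) (coding_approx M xs \<sigma> (Suc n)))) \<partial>\<Lambda>)
    = (\<Sum>n. \<integral>\<^sup>+\<sigma>. ennreal (dist (coding_approx M xs \<sigma> n) (coding_approx M xs \<sigma> (Suc n))) \<partial>\<Lambda>)"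
    by (rule nn_integral_suminf) measurable
  also have "\<dots> \<le> (\<Sum>n. ennreal ((a + a ^ 2) * G * a ^ n))"
  proof (intro suminf_le)
    fix n
    have "(a ^ Suc (Suc n) + a ^ Suc n) * G = (a + a ^ 2) * G * a ^ n"
      by (simp add: power2_eq_square algebra_simps)
    then show "(\<integral>\<^sup>+\<sigma>. ennreal (dist (coding_approx M xs \<sigma> n) (coding_approx M xs \<sigma> (Suc n))) \<partial>\<Lambda>)
      \<le> ennreal ((a + a ^ 2) * G * a ^ n)"
      using limit_state_dist_approx[OF \<Lambda> le_SucI[OF order_refl], of n] by (simp only: dist_commute)
  qed auto
  also have "\<dots> < \<infinity>"
  proof -
    have "summable (\<lambda>n. (a + a ^ 2) * G * a ^ n)"
      using a_pos a_less_1 by (intro summable_mult summable_geometric) auto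
    then show ?thesis
      using a_pos limit_stateD(4)[OF \<Lambda>] by (subst suminf_ennreal2) auto
  qed
  finally have "AE \<sigma> in \<Lambda>. (\<Sum>n. ennreal (dist (coding_approx M xs \<sigma> n) (coding_approx M xs \<sigma> (Suc n)))) \<noteq> \<infinity>"
    by (intro nn_integral_PInf_AE) auto
  moreover note limit_state_SigmaG[OF \<Lambda>]
  ultimately show ?thesis
  proof eventually_elim
    case (elim \<sigma>)
    have "summable (\<lambda>n. dist (coding_approx M xs \<sigma> n) (coding_approx M xs \<sigma> (Suc n)))"
      using elim(1) by (intro summable_suminf_not_top) auto
    then show ?case using elim(2) convergent_if_summable_dist by (auto simp: coding_domain_def)
  qed
qed

lemma measurable_dist_coding [measurable]:
  "(\<lambda>\<sigma>. dist (coding M xs \<sigma>) (coding_approx M xs \<sigma> m)) \<in> borel_measurable code_borel"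
proof -
  have "(\<lambda>\<sigma>. (\<lambda>es \<sigma>. dist (coding M xs \<sigma>) (word_pt es)) (map \<sigma> [- int m..0]) \<sigma>) \<in> borel_measurable code_borel"
    by (rule measurable_compose_countable[OF measurable_compose[OF measurable_coding measurable_dist_const]]) measurable
  then show ?thesis by (simp add: coding_approx_window)
qed

lemma limit_state_dist_coding:
  assumes \<Lambda>: "limit_state \<Lambda> \<nu> G"
  shows "(\<integral>\<^sup>+\<sigma>. ennreal (dist (coding M xs \<sigma>) (coding_approx M xs \<sigma> m)) \<partial>\<Lambda>) \<le> ennreal (a ^ Suc m * G)"
proof (rule nn_integral_Fatou_bound)
  note sets[measurable_cong] = limit_stateD(2)[OF \<Lambda>]
  show "(\<lambda>\<sigma>. ennreal (dist (coding_approx M xs \<sigma> (n + m)) (coding_approx M xs \<sigma> m))) \<in> borel_measurable \<Lambda>" for n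
  proof -
    have [measurable]: "(\<lambda>\<sigma>. dist (coding_approx M xs \<sigma> (n + m)) (coding_approx M xs \<sigma> m)) \<in> borel_measurable code_borel"
      by (rule measurable_from_past) measurable
    show ?thesis by measurable
  qed
  show "AE \<sigma> in \<Lambda>. (\<lambda>n. ennreal (dist (coding_approx M xs \<sigma> (n + m)) (coding_approx M xs \<sigma> m)))
      \<longlonglongrightarrow> ennreal (dist (coding M xs \<sigma>) (coding_approx M xs \<sigma> m))"
    using limit_state_coding_domain[OF \<Lambda>]
    by eventually_elim (intro tendsto_ennrealI tendsto_dist tendsto_const LIMSEQ_ignore_initial_segment coding_approx_tendsto)
  show "(\<integral>\<^sup>+\<sigma>. ennreal (dist (coding_approx M xs \<sigma> (n + m)) (coding_approx M xs \<sigma> m)) \<partial>\<Lambda>)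
      \<le> ennreal ((a ^ Suc (n + m) + a ^ Suc m) * G)" for n
    by (rule limit_state_dist_approx[OF \<Lambda>]) simp
  have "(\<lambda>n. a ^ n) \<longlonglongrightarrow> 0" using a_pos a_less_1 by (intro LIMSEQ_realpow_zero) auto
  from LIMSEQ_ignore_initial_segment[OF this, of "Suc m"]
  have "(\<lambda>n. (a ^ Suc (n + m) + a ^ Suc m) * G) \<longlonglongrightarrow> (0 + a ^ Suc m) * G"
    by (intro tendsto_intros) simp
  then show "(\<lambda>n. ennreal ((a ^ Suc (n + m) + a ^ Suc m) * G)) \<longlonglongrightarrow> ennreal (a ^ Suc m * G)"
    by (intro tendsto_ennrealI) simp
qed

section \<open>Limit states are asymptotic states\<close>

text \<open>
  This characterizes the extension of \<open>p_e\<close> to the closure of its cell; its existence is the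
  extension theorem for uniformly continuous functions.
\<close>

lemma wprob_ext_limit:
  assumes y: "\<And>n. y n \<in> cell M (ini M e)" and x: "y \<longlonglongrightarrow> x"
  shows "(\<lambda>n. wprob M e (y n)) \<longlonglongrightarrow> wprob_ext M e x"
proof -
  let ?C = "cell M (ini M e)"
  let ?Q = "\<lambda>g. continuous_on (closure ?C) g \<and> (\<forall>x\<in>?C. g x = wprob M e x) \<and> (\<forall>x. x \<notin> closure ?C \<longrightarrow> g x = 0)"
  have "uniformly_continuous_on ?C (wprob M e)"
    using uniform by (simp add: uniformly_continuous_system_def)
  from uniformly_continuous_on_extension_on_closure[OF this]
  obtain g where g: "uniformly_continuous_on (closure ?C) g" "\<And>x. x \<in> ?C \<Longrightarrow> wprob M e x = g x"
    by metis
  let ?g = "\<lambda>x. if x \<in> closure ?C then g x else 0"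
  have "continuous_on (closure ?C) ?g"
    using uniformly_continuous_imp_continuous[OF g(1)] by (rule continuous_on_eq) simp
  moreover have "x \<in> closure ?C" if "x \<in> ?C" for x using that closure_subset by blast
  ultimately have Qg: "?Q ?g" using g(2) by simp
  have unique: "h = h'" if h: "?Q h" "?Q h'" for h h'
  proof
    fix x show "h x = h' x"
    proof (cases "x \<in> closure ?C")
      case True
      then obtain z where z: "\<And>n. z n \<in> ?C" "z \<longlonglongrightarrow> x" unfolding closure_sequential by auto
      have "(h \<circ> z) \<longlonglongrightarrow> h x" "(h' \<circ> z) \<longlonglongrightarrow> h' x"
        using h True z unfolding continuous_on_closure_sequentially by blast+
      moreover have "h \<circ> z = h' \<circ> z" using h z(1) by auto
      ultimately show ?thesis using LIMSEQ_unique by metis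
    qed (use h in simp)
  qed
  have Q: "?Q (wprob_ext M e)"
    unfolding wprob_ext_def by (rule theI[of ?Q, OF Qg]) (rule unique[OF _ Qg])
  have "x \<in> closure ?C" unfolding closure_sequential using y x by auto
  then have "(wprob_ext M e \<circ> y) \<longlonglongrightarrow> wprob_ext M e x"
    using Q y x unfolding continuous_on_closure_sequentially by blast
  moreover have "wprob_ext M e \<circ> y = (\<lambda>n. wprob M e (y n))" using Q y by auto
  ultimately show ?thesis by simp
qed

lemma vertex_coding_approx:
  assumes "\<sigma> \<in> SigmaG M"
  shows "vertex (coding_approx M xs \<sigma> n) = ter_opt M (\<sigma> 0)"
proof -
  have step: "vertex (wmap_opt M (\<sigma> i) x) = ter_opt M (\<sigma> i)" if "vertex x = ini_opt M (\<sigma> i)" for i x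
    using assms that by (intro vertex_wmap_opt) (simp_all add: SigmaG_def)
  have link: "ini_opt M (\<sigma> (i + 1)) = ter_opt M (\<sigma> i)" for i
    using assms by (simp add: SigmaG_def)
  have "vertex (path_map M (map \<sigma> [- int n..0]) x) = ter_opt M (\<sigma> 0)" if "vertex x = ini_opt M (\<sigma> (- int n))" for n x
    using that
  proof (induction n arbitrary: x)
    case 0 then show ?case using step by simp
  next
    case (Suc n)
    have "[- int (Suc n)..0] = - int (Suc n) # [- int n..0]" by (simp add: upto_rec1)
    moreover have "vertex (wmap_opt M (\<sigma> (- int (Suc n))) x) = ini_opt M (\<sigma> (- int n))"
      using step[OF Suc.prems] link[of "- int (Suc n)"] by simp
    ultimately show ?case using Suc.IH by simp
  qed
  moreover have "ini_opt M (\<sigma> i) \<in> vert M" for i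
  proof -
    have "\<sigma> i \<noteq> None" using assms by (simp add: SigmaG_def)
    then show ?thesis using ini_in_vert by auto
  qed
  moreover have "hd (map \<sigma> [- int n..0]) = \<sigma> (- int n)" by (simp add: hd_map upto_rec1)
  ultimately show ?thesis
    unfolding coding_approx_window word_pt_def by (simp add: vertex_xs)
qed

text \<open>
  The approximations of an admissible code lie in the cell in which its letter \<open>0\<close> ends, so either
  all or none of them lie in the cell of \<open>e\<close>.  Their limit may leave the cell, which is why the factor
  \<open>T_set M (ini M e)\<close> remembers it.
\<close>

lemma wprob_coding_approx_tendsto:
  assumes \<sigma>: "\<sigma> \<in> coding_domain M xs"
  shows "(\<lambda>n. wprob M e (coding_approx M xs \<sigma> n)) \<longlonglongrightarrow> wprob_ext M e (coding M xs \<sigma>) * indicator (T_set M (ini M e)) \<sigma>"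
proof -
  have G: "\<sigma> \<in> SigmaG M" using \<sigma> by (simp add: coding_domain_def)
  show ?thesis
  proof (cases "ter_opt M (\<sigma> 0) = ini M e")
    case True
    then have "coding_approx M xs \<sigma> n \<in> cell M (ini M e)" for n
      using vertex_coding_approx[OF G] in_cell_iff[OF ini_in_vert] by simp
    from wprob_ext_limit[OF this coding_approx_tendsto[OF \<sigma>]] show ?thesis
      using True G by (simp add: T_set_def)
  next
    case False
    then have "wprob M e (coding_approx M xs \<sigma> n) = 0" for n
      using vertex_coding_approx[OF G, of n] wprob_opt_supported(2)[of "Some e" "coding_approx M xs \<sigma> n"] by auto
    then show ?thesis using False by (simp add: T_set_def)
  qed
qed

lemma limit_state_oscillation:
  assumes \<Lambda>: "limit_state \<Lambda> \<nu> G"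
  shows "(\<lambda>n. \<integral>\<^sup>+es. ennreal \<bar>measure \<Lambda> (cylinder (- int n) (es @ [Some e]))
      - measure \<Lambda> (cylinder (- int n) es) * wprob M e (word_pt es)\<bar> \<partial>count_space (words (Suc n))) \<longlonglongrightarrow> 0"
proof (rule tendsto_zero_ennreal)
  fix \<eta> :: real assume \<eta>: "0 < \<eta>"
  interpret \<Lambda>: prob_space \<Lambda> by (rule limit_stateD[OF \<Lambda>])
  obtain \<delta> where \<delta>: "0 < \<delta>" "\<And>x y. vertex x = vertex y \<Longrightarrow> \<bar>wprob M e x - wprob M e y\<bar> \<le> \<eta> / 2 + dist x y / \<delta>"
    using wprob_oscillation[of "\<eta> / 2" e] \<eta> by auto
  have lim: "(\<lambda>r. enn2real (word_mass (\<nu> r) es)) \<longlonglongrightarrow> measure \<Lambda> (cylinder m es)" for m es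
    using limit_stateD(5)[OF \<Lambda>, of es m] by (intro tendsto_enn2real) (simp_all add: \<Lambda>.emeasure_eq_measure)
  have bound: "(\<integral>\<^sup>+es. ennreal \<bar>measure \<Lambda> (cylinder (- int n) (es @ [Some e]))
      - measure \<Lambda> (cylinder (- int n) es) * wprob M e (word_pt es)\<bar> \<partial>count_space (words (Suc n)))
    \<le> ennreal (\<eta> / 2 + a ^ Suc n * G / \<delta>)" for n
  proof (rule nn_integral_Fatou_bound[where C = "\<lambda>_. ennreal (\<eta> / 2 + a ^ Suc n * G / \<delta>)"])
    show "AE es in count_space (words (Suc n)).
       (\<lambda>r. ennreal \<bar>enn2real (word_mass (\<nu> r) (es @ [Some e])) - enn2real (word_mass (\<nu> r) es) * wprob M e (word_pt es)\<bar>)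
       \<longlonglongrightarrow> ennreal \<bar>measure \<Lambda> (cylinder (- int n) (es @ [Some e])) - measure \<Lambda> (cylinder (- int n) es) * wprob M e (word_pt es)\<bar>"
      by (intro AE_I2 tendsto_ennrealI tendsto_rabs tendsto_diff tendsto_mult lim tendsto_const)
    show "(\<integral>\<^sup>+es. ennreal \<bar>enn2real (word_mass (\<nu> r) (es @ [Some e])) - enn2real (word_mass (\<nu> r) es) * wprob M e (word_pt es)\<bar>
      \<partial>count_space (words (Suc n))) \<le> ennreal (\<eta> / 2 + a ^ Suc n * G / \<delta>)" for r
      by (rule word_mass_oscillation[OF limit_stateD(3)[OF \<Lambda>] _ \<delta>(1) _ \<delta>(2)]) (use \<eta> in auto)
  qed auto
  have "(\<lambda>n. a ^ n) \<longlonglongrightarrow> 0" using a_pos a_less_1 by (intro LIMSEQ_realpow_zero) auto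
  then have "(\<lambda>n. a ^ Suc n * (G / \<delta>)) \<longlonglongrightarrow> 0" by (intro tendsto_mult_left_zero LIMSEQ_Suc)
  then have "eventually (\<lambda>n. a ^ Suc n * (G / \<delta>) < \<eta> / 2) sequentially"
    using \<eta> by (intro order_tendstoD) auto
  then show "eventually (\<lambda>n. (\<integral>\<^sup>+es. ennreal \<bar>measure \<Lambda> (cylinder (- int n) (es @ [Some e]))
      - measure \<Lambda> (cylinder (- int n) es) * wprob M e (word_pt es)\<bar> \<partial>count_space (words (Suc n))) < ennreal \<eta>) sequentially"
  proof eventually_elim
    case (elim n)
    have "ennreal (\<eta> / 2 + a ^ Suc n * G / \<delta>) < ennreal \<eta>"
    proof (rule ennreal_lessI[OF \<eta>])
      have "a ^ Suc n * G / \<delta> = a ^ Suc n * (G / \<delta>)" by simp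
      then show "\<eta> / 2 + a ^ Suc n * G / \<delta> < \<eta>" using elim by linarith
    qed
    with bound[of n] show ?case by (rule le_less_trans)
  qed
qed

text \<open>
  On the event that the past ends with a given word, the conditional probability of \<open>e\<close> and \<open>p_e\<close> at
  the \<open>n\<close>-th approximation have integrals that differ by at most the total oscillation over words of
  length \<open>n + 1\<close>, which tends to \<open>0\<close>.  Such events determine a measure on the past.
\<close>

lemma limit_state_cond_exp:
  assumes \<Lambda>: "limit_state \<Lambda> \<nu> G"
  shows "AE \<sigma> in \<Lambda>. real_cond_exp \<Lambda> past (indicator (cylinder 1 [Some e])) \<sigma>
     = wprob_ext M e (coding M xs \<sigma>) * indicator (T_set M (ini M e)) \<sigma>"
proof -
  interpret \<Lambda>: prob_space \<Lambda> by (rule limit_stateD[OF \<Lambda>])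
  note sets[measurable_cong] = limit_stateD(2)[OF \<Lambda>]
  have space: "space \<Lambda> = UNIV" using sets_eq_imp_space_eq[OF sets] by simp
  have sub: "subalgebra \<Lambda> past" by (rule subalgebra_past[OF sets])
  interpret finite_measure_subalgebra \<Lambda> past by standard (rule sub)
  let ?c = "cylinder 1 [Some e]"
  define u where "u n \<sigma> = wprob M e (coding_approx M xs \<sigma> n)" for n \<sigma>
  \<comment> \<open>A limit of functions of finitely many past letters: the required conditional expectation up to
    a null set, but measurable with respect to the past.\<close>
  define H where "H \<sigma> = lim (\<lambda>n. u n \<sigma>)" for \<sigma>
  have p: "0 \<le> wprob M e x" "wprob M e x \<le> 1" for x
    using wprob_opt_le_1[of "Some e" x] wprob_opt_nonneg[of "Some e" x] by simp_all
  have [measurable]: "wprob M e \<in> borel_measurable borel" using measurable_wprob_opt[of "Some e"] by simp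
  have u_past[measurable]: "u n \<in> borel_measurable past" for n unfolding u_def by measurable
  have H_past[measurable]: "H \<in> borel_measurable past" unfolding H_def by measurable
  have [measurable]: "u n \<in> borel_measurable code_borel" for n by (rule measurable_from_past) measurable
  have [measurable]: "H \<in> borel_measurable code_borel" by (rule measurable_from_past) measurable
  have past_sets: "A \<in> sets past \<Longrightarrow> A \<in> sets \<Lambda>" for A using sets_past_subset sets by auto
  have H_ae: "AE \<sigma> in \<Lambda>. (\<lambda>n. u n \<sigma>) \<longlonglongrightarrow> H \<sigma> \<and> H \<sigma> = wprob_ext M e (coding M xs \<sigma>) * indicator (T_set M (ini M e)) \<sigma>"
    using limit_state_coding_domain[OF \<Lambda>]
  proof eventually_elim
    case (elim \<sigma>)
    from wprob_coding_approx_tendsto[OF elim, of e] show ?case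
      unfolding u_def H_def by (simp add: limI)
  qed
  have H_01: "AE \<sigma> in \<Lambda>. 0 \<le> H \<sigma> \<and> H \<sigma> \<le> 1"
    using H_ae
  proof eventually_elim
    case (elim \<sigma>)
    then have "(\<lambda>n. u n \<sigma>) \<longlonglongrightarrow> H \<sigma>" by (rule conjunct1)
    then show ?case
      by (intro conjI LIMSEQ_le_const[of "\<lambda>n. u n \<sigma>" "H \<sigma>" 0] LIMSEQ_le_const2[of "\<lambda>n. u n \<sigma>" "H \<sigma>" 1]) (auto simp: u_def p)
  qed
  define P where "P = restr_to_subalg (density \<Lambda> (indicator ?c)) past"
  define Q where "Q = restr_to_subalg (density \<Lambda> (\<lambda>\<sigma>. ennreal (H \<sigma>))) past"
  have subP: "subalgebra (density \<Lambda> f) past" for f using sub by (simp add: subalgebra_def)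
  have P: "emeasure P A = (\<integral>\<^sup>+\<sigma>. indicator ?c \<sigma> * indicator A \<sigma> \<partial>\<Lambda>)" if "A \<in> sets past" for A
    unfolding P_def emeasure_restr_to_subalg[OF subP that] using past_sets[OF that]
    by (intro emeasure_density) auto
  have Q: "emeasure Q A = (\<integral>\<^sup>+\<sigma>. ennreal (H \<sigma>) * indicator A \<sigma> \<partial>\<Lambda>)" if "A \<in> sets past" for A
    unfolding Q_def emeasure_restr_to_subalg[OF subP that] using past_sets[OF that]
    by (intro emeasure_density) auto
  have PQ: "P = Q"
  proof (rule finite_measure_past_eqI)
    show "sets P = sets past" "sets Q = sets past"
      unfolding P_def Q_def by (rule sets_restr_to_subalg[OF subP])+
    have spP: "space P = UNIV" unfolding P_def by (simp add: space_restr_to_subalg space)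
    have "emeasure P UNIV \<le> 1"
    proof -
      have "UNIV \<in> sets (past :: (int \<Rightarrow> 'e option) measure)" using sets.top[of past] by simp
      from P[OF this] have "emeasure P UNIV = emeasure \<Lambda> ?c" by simp
      then show ?thesis by (simp add: \<Lambda>.measure_le_1)
    qed
    then show "finite_measure P"
      by (intro finite_measureI) (auto simp: spP top_unique)
    fix l and v :: "'e option list" assume v: "length v = Suc l"
    let ?A = "cylinder (- int l) v"
    have A_past: "?A \<in> sets past"
    proof -
      have "?A = (\<lambda>\<sigma>. map \<sigma> [- int l..0]) -` {v}" using v by (auto simp: cylinder_eq_window)
      then show ?thesis unfolding sets_past by (intro sigma_sets.Basic) auto
    qed
    have ind: "indicator ?A \<sigma> = (indicator {es. drop (n - l) es = v} (map \<sigma> [- int n..0]) :: ennreal)" if "l \<le> n" for n \<sigma>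
    proof -
      have "\<sigma> \<in> ?A \<longleftrightarrow> map \<sigma> [- int l..0] = v" using v by (auto simp: cylinder_eq_window)
      then show ?thesis using drop_window[OF that, of \<sigma>] by (simp add: indicator_def)
    qed
    let ?osc = "\<lambda>n. \<integral>\<^sup>+es. ennreal \<bar>measure \<Lambda> (cylinder (- int n) (es @ [Some e]))
      - measure \<Lambda> (cylinder (- int n) es) * wprob M e (word_pt es)\<bar> \<partial>count_space (words (Suc n))"
    let ?\<beta> = "\<lambda>n. \<integral>\<^sup>+\<sigma>. ennreal (u n \<sigma>) * indicator ?A \<sigma> \<partial>\<Lambda>"
    \<comment> \<open>The mass of the cylinder, and below the integral of \<open>u n\<close> over it, as sums over the longer words
      that end with \<open>v\<close>.\<close>
    have alpha: "emeasure P ?A = (\<integral>\<^sup>+es. ennreal (measure \<Lambda> (cylinder (- int n) (es @ [Some e]))) * indicator {es. drop (n - l) es = v} es \<partial>count_space (words (Suc n)))"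
      if n: "l \<le> n" for n
    proof -
      have "emeasure P ?A = (\<integral>\<^sup>+\<sigma>. indicator ?A \<sigma> \<partial>density \<Lambda> (indicator ?c))"
        unfolding P[OF A_past] by (subst nn_integral_density) auto
      also have "\<dots> = (\<integral>\<^sup>+\<sigma>. indicator {es. drop (n - l) es = v} (map \<sigma> [- int n..0]) \<partial>density \<Lambda> (indicator ?c))"
        by (simp only: ind[OF n])
      also have "\<dots> = (\<integral>\<^sup>+es. emeasure (density \<Lambda> (indicator ?c)) (cylinder (- int n) es) * indicator {es. drop (n - l) es = v} es \<partial>count_space (words (Suc n)))"
        by (rule nn_integral_window) (simp add: sets)
      also have "\<dots> = (\<integral>\<^sup>+es. ennreal (measure \<Lambda> (cylinder (- int n) (es @ [Some e]))) * indicator {es. drop (n - l) es = v} es \<partial>count_space (words (Suc n)))"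
      proof (rule nn_integral_cong)
        fix es :: "'e option list" assume "es \<in> space (count_space (words (Suc n)))"
        then have "length es = Suc n" by simp
        then have "cylinder (- int n) (es @ [Some e]) = ?c \<inter> cylinder (- int n) es"
          by (auto simp: cylinder_def nth_append less_Suc_eq)
        moreover have "emeasure (density \<Lambda> (indicator ?c)) (cylinder (- int n) es) = emeasure \<Lambda> (?c \<inter> cylinder (- int n) es)"
        proof -
          have "emeasure (density \<Lambda> (indicator ?c)) (cylinder (- int n) es) = (\<integral>\<^sup>+\<sigma>. indicator ?c \<sigma> * indicator (cylinder (- int n) es) \<sigma> \<partial>\<Lambda>)"
            by (rule emeasure_density) auto
          also have "\<dots> = (\<integral>\<^sup>+\<sigma>. indicator (?c \<inter> cylinder (- int n) es) \<sigma> \<partial>\<Lambda>)"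
            by (simp only: indicator_inter_arith)
          also have "\<dots> = emeasure \<Lambda> (?c \<inter> cylinder (- int n) es)"
            by (rule nn_integral_indicator) (simp add: sets sets.Int)
          finally show ?thesis .
        qed
        ultimately show "emeasure (density \<Lambda> (indicator ?c)) (cylinder (- int n) es) * indicator {es. drop (n - l) es = v} es
          = ennreal (measure \<Lambda> (cylinder (- int n) (es @ [Some e]))) * indicator {es. drop (n - l) es = v} es"
          by (simp add: \<Lambda>.emeasure_eq_measure)
      qed
      finally show ?thesis .
    qed
    have beta: "?\<beta> n = (\<integral>\<^sup>+es. ennreal (measure \<Lambda> (cylinder (- int n) es) * wprob M e (word_pt es)) * indicator {es. drop (n - l) es = v} es \<partial>count_space (words (Suc n)))"
      if n: "l \<le> n" for n
    proof -
      have "?\<beta> n = (\<integral>\<^sup>+\<sigma>. (\<lambda>es. ennreal (wprob M e (word_pt es)) * indicator {es. drop (n - l) es = v} es) (map \<sigma> [- int n..0]) \<partial>\<Lambda>)"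
        by (simp only: ind[OF n] u_def coding_approx_window)
      also have "\<dots> = (\<integral>\<^sup>+es. emeasure \<Lambda> (cylinder (- int n) es) * (ennreal (wprob M e (word_pt es)) * indicator {es. drop (n - l) es = v} es) \<partial>count_space (words (Suc n)))"
        by (rule nn_integral_window) (simp add: sets)
      finally show ?thesis by (simp add: \<Lambda>.emeasure_eq_measure ennreal_mult' p mult.assoc)
    qed
    have le: "(\<integral>\<^sup>+es. ennreal (f es) * indicator S es \<partial>count_space W)
        \<le> (\<integral>\<^sup>+es. ennreal (g es) * indicator S es \<partial>count_space W) + (\<integral>\<^sup>+es. ennreal (d es) \<partial>count_space W)"
      if "\<And>es. f es \<le> g es + d es" "\<And>es. 0 \<le> g es" "\<And>es. 0 \<le> d es"
      for f g d :: "'e option list \<Rightarrow> real" and S W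
    proof -
      have "(\<integral>\<^sup>+es. ennreal (f es) * indicator S es \<partial>count_space W)
        \<le> (\<integral>\<^sup>+es. ennreal (g es) * indicator S es + ennreal (d es) \<partial>count_space W)"
        using that by (intro nn_integral_mono) (auto simp: indicator_def ennreal_leI simp flip: ennreal_plus)
      then show ?thesis by (simp add: nn_integral_add)
    qed
    have 1: "emeasure P ?A \<le> ?\<beta> n + ?osc n" if n: "l \<le> n" for n
      unfolding alpha[OF n] beta[OF n] by (rule le) (auto simp: p)
    have 2: "?\<beta> n \<le> emeasure P ?A + ?osc n" if n: "l \<le> n" for n
      unfolding alpha[OF n] beta[OF n] by (rule le) (auto simp: p)
    have lim: "?\<beta> \<longlonglongrightarrow> emeasure Q ?A"
      unfolding Q[OF A_past]
    proof (rule nn_integral_dominated_convergence[where w = "\<lambda>_. 1"])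
      show "AE \<sigma> in \<Lambda>. (\<lambda>n. ennreal (u n \<sigma>) * indicator ?A \<sigma>) \<longlonglongrightarrow> ennreal (H \<sigma>) * indicator ?A \<sigma>"
        using H_ae
      proof eventually_elim
        case (elim \<sigma>)
        then have "(\<lambda>n. ennreal (u n \<sigma>)) \<longlonglongrightarrow> ennreal (H \<sigma>)" by (intro tendsto_ennrealI) (rule conjunct1)
        then show ?case by (auto simp: indicator_def)
      qed
      show "AE \<sigma> in \<Lambda>. ennreal (u n \<sigma>) * indicator ?A \<sigma> \<le> 1" for n
        by (intro AE_I2) (auto simp: u_def p indicator_def)
      show "(\<integral>\<^sup>+\<sigma>. 1 \<partial>\<Lambda>) < \<infinity>" by (simp add: \<Lambda>.emeasure_space_1)
    qed measurable
    have osc: "?osc \<longlonglongrightarrow> 0" by (rule limit_state_oscillation[OF \<Lambda>])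
    have "emeasure P ?A \<le> emeasure Q ?A + 0"
      using tendsto_add[OF lim osc] 1 by (intro LIMSEQ_le_const) auto
    moreover have "emeasure Q ?A \<le> emeasure P ?A + 0"
      using lim tendsto_add[OF tendsto_const[of "emeasure P ?A"] osc] 2 by (intro LIMSEQ_le) auto
    ultimately show "emeasure P ?A = emeasure Q ?A" by simp
  qed
  have "AE \<sigma> in \<Lambda>. norm (H \<sigma>) \<le> 1" using H_01 by (rule eventually_mono) simp
  then have intH: "integrable \<Lambda> H" by (rule \<Lambda>.integrable_const_bound) measurable
  have "AE \<sigma> in \<Lambda>. real_cond_exp \<Lambda> past (indicator ?c) \<sigma> = H \<sigma>"
  proof (rule real_cond_exp_charact)
    fix A :: "(int \<Rightarrow> 'e option) set" assume A: "A \<in> sets past"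
    note [measurable] = past_sets[OF A]
    have "(\<integral>\<sigma>\<in>A. indicator ?c \<sigma> \<partial>\<Lambda>) = enn2real (emeasure P A)"
      unfolding set_lebesgue_integral_def P[OF A]
      by (subst integral_eq_nn_integral) (auto intro!: arg_cong[where f = enn2real] nn_integral_cong simp: indicator_def)
    also have "\<dots> = enn2real (\<integral>\<^sup>+\<sigma>. ennreal (indicator A \<sigma> * H \<sigma>) \<partial>\<Lambda>)"
      unfolding PQ Q[OF A] by (intro arg_cong[where f = enn2real] nn_integral_cong) (auto simp: indicator_def)
    also have "\<dots> = (\<integral>\<sigma>\<in>A. H \<sigma> \<partial>\<Lambda>)"
      unfolding set_lebesgue_integral_def
      by (subst integral_eq_nn_integral) (use H_01 in \<open>auto elim!: eventually_mono\<close>)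
    finally show "(\<integral>\<sigma>\<in>A. indicator ?c \<sigma> \<partial>\<Lambda>) = (\<integral>\<sigma>\<in>A. H \<sigma> \<partial>\<Lambda>)" .
  next
    show "integrable \<Lambda> (indicator ?c :: _ \<Rightarrow> real)"
      by (rule \<Lambda>.integrable_const_bound[of _ 1]) auto
  qed (fact intH H_past)+
  with H_ae show ?thesis by eventually_elim auto
qed

theorem limit_state_asymptotic:
  assumes \<Lambda>: "limit_state \<Lambda> \<nu> G"
  shows "\<Lambda> \<in> asymptotic_states M xs"
proof -
  interpret \<Lambda>: prob_space \<Lambda> by (rule limit_stateD[OF \<Lambda>])
  have "coding_domain M xs \<in> sets \<Lambda>" using limit_stateD(2)[OF \<Lambda>] by simp
  then have "emeasure \<Lambda> (coding_domain M xs) = 1"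
    using limit_state_coding_domain[OF \<Lambda>] by (simp add: \<Lambda>.emeasure_eq_1_AE)
  then show ?thesis
    using \<Lambda> limit_state_cond_exp[OF \<Lambda>] by (simp add: asymptotic_states_def limit_state_def)
qed

section \<open>Invariant measures\<close>

lemma markov_op_eq:
  "markov_op M f x = (\<integral>\<^sup>+e. ennreal (wprob_opt M e x) * f (wmap_opt M e x) \<partial>count_space UNIV)"
  unfolding markov_op_def
  by (subst nn_integral_count_space_option) (simp_all add: infsum_eq_nn_integral_count_space)

lemma path_sum_Suc_markov_op:
  "path_sum M (Suc n) (\<lambda>es. f (path_map M es x)) x
    = markov_op M (\<lambda>y. path_sum M n (\<lambda>es. f (path_map M es y)) y) x"
  by (simp add: path_sum_Suc markov_op_eq)

lemma measurable_path_sum_fun: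
  assumes "f \<in> borel_measurable borel"
  shows "(\<lambda>x. path_sum M n (\<lambda>es. f (path_map M es x)) x) \<in> borel_measurable borel"
  by (rule measurable_path_sum) (rule measurable_compose[OF measurable_path_map assms])

lemma invariant_measureD:
  assumes "\<mu> \<in> invariant_measures M"
  shows "prob_space \<mu>" "sets \<mu> = sets borel"
    "f \<in> borel_measurable borel \<Longrightarrow> (\<integral>\<^sup>+x. markov_op M f x \<partial>\<mu>) = (\<integral>\<^sup>+x. f x \<partial>\<mu>)"
  using assms nn_integral_dual_op[OF system, of \<mu> f] by (auto simp: invariant_measures_def borel_prob_def)

lemma invariant_path_sum:
  assumes \<mu>: "\<mu> \<in> invariant_measures M" and f: "f \<in> borel_measurable borel"
  shows "(\<integral>\<^sup>+x. path_sum M n (\<lambda>es. f (path_map M es x)) x \<partial>\<mu>) = (\<integral>\<^sup>+x. f x \<partial>\<mu>)"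
proof (induction n)
  case (Suc n)
  then show ?case
    unfolding path_sum_Suc_markov_op by (simp add: invariant_measureD(3)[OF \<mu> measurable_path_sum_fun[OF f]])
qed simp

lemma stationary_gap_nonneg: "0 \<le> b / (1 - a)"
  using b_nonneg a_less_1 by simp

text \<open>
  Integrating the drift inequality would give the bound at once if the integral were known to be
  finite.  The truncated gap is integrable, and invariance lets the drift act on it \<open>n\<close> times.
\<close>

lemma invariant_gap_integral:
  assumes \<mu>: "\<mu> \<in> invariant_measures M"
  shows "(\<integral>\<^sup>+x. ennreal (gap x) \<partial>\<mu>) \<le> ennreal (b / (1 - a))"
proof -
  interpret \<mu>: prob_space \<mu> by (rule invariant_measureD[OF \<mu>])
  note [measurable_cong] = invariant_measureD(2)[OF \<mu>]
  have trunc: "(\<integral>\<^sup>+x. ennreal (min (gap x) C) \<partial>\<mu>) \<le> ennreal (b / (1 - a))" if C: "0 \<le> C" for C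
  proof -
    have le: "(\<integral>\<^sup>+x. ennreal (min (gap x) C) \<partial>\<mu>) \<le> (\<integral>\<^sup>+x. ennreal (min (a ^ n * gap x + b / (1 - a)) C) \<partial>\<mu>)" for n
    proof -
      have "(\<integral>\<^sup>+x. ennreal (min (gap x) C) \<partial>\<mu>) = (\<integral>\<^sup>+x. path_sum M n (\<lambda>es. ennreal (min (gap (path_map M es x)) C)) x \<partial>\<mu>)"
        by (rule invariant_path_sum[OF \<mu>, symmetric]) measurable
      also have "\<dots> \<le> (\<integral>\<^sup>+x. ennreal (min (a ^ n * gap x + b / (1 - a)) C) \<partial>\<mu>)"
      proof (intro nn_integral_mono)
        fix x
        have "path_sum M n (\<lambda>es. ennreal (min (gap (path_map M es x)) C)) x \<le> path_sum M n (\<lambda>es. ennreal (gap (path_map M es x))) x"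
          by (intro path_sum_mono ennreal_leI) simp
        also note drift_path_sum[of n x]
        finally have 1: "path_sum M n (\<lambda>es. ennreal (min (gap (path_map M es x)) C)) x \<le> ennreal (a ^ n * gap x + b / (1 - a))" .
        have "path_sum M n (\<lambda>es. ennreal (min (gap (path_map M es x)) C)) x \<le> path_sum M n (\<lambda>es. ennreal C) x"
          by (intro path_sum_mono ennreal_leI) simp
        then have 2: "path_sum M n (\<lambda>es. ennreal (min (gap (path_map M es x)) C)) x \<le> ennreal C"
          by (simp add: path_sum_const)
        show "path_sum M n (\<lambda>es. ennreal (min (gap (path_map M es x)) C)) x \<le> ennreal (min (a ^ n * gap x + b / (1 - a)) C)"
          using 1 2 by (simp add: min_def)
      qed
      finally show ?thesis .
    qed
    have "(\<lambda>n. \<integral>\<^sup>+x. ennreal (min (a ^ n * gap x + b / (1 - a)) C) \<partial>\<mu>) \<longlonglongrightarrow> (\<integral>\<^sup>+x. ennreal (min (b / (1 - a)) C) \<partial>\<mu>)"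
    proof (rule nn_integral_dominated_convergence[where w = "\<lambda>_. ennreal C"])
      show "AE x in \<mu>. (\<lambda>n. ennreal (min (a ^ n * gap x + b / (1 - a)) C)) \<longlonglongrightarrow> ennreal (min (b / (1 - a)) C)"
      proof (rule AE_I2)
        fix x
        have "(\<lambda>n. a ^ n) \<longlonglongrightarrow> 0" using a_pos a_less_1 by (intro LIMSEQ_realpow_zero) auto
        then have "(\<lambda>n. min (a ^ n * gap x + b / (1 - a)) C) \<longlonglongrightarrow> min (0 * gap x + b / (1 - a)) C"
          by (intro tendsto_min tendsto_add tendsto_mult tendsto_const)
        then show "(\<lambda>n. ennreal (min (a ^ n * gap x + b / (1 - a)) C)) \<longlonglongrightarrow> ennreal (min (b / (1 - a)) C)"
          by (intro tendsto_ennrealI) simp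
      qed
      show "(\<integral>\<^sup>+x. ennreal C \<partial>\<mu>) < \<infinity>" by (simp add: \<mu>.emeasure_space_1)
    qed (auto intro!: AE_I2 ennreal_leI)
    from LIMSEQ_le_const[OF this, of "\<integral>\<^sup>+x. ennreal (min (gap x) C) \<partial>\<mu>"] le
    have "(\<integral>\<^sup>+x. ennreal (min (gap x) C) \<partial>\<mu>) \<le> (\<integral>\<^sup>+x. ennreal (min (b / (1 - a)) C) \<partial>\<mu>)" by blast
    also have "\<dots> \<le> ennreal (b / (1 - a))" by (simp add: \<mu>.emeasure_space_1 ennreal_leI)
    finally show ?thesis .
  qed
  show ?thesis
  proof (rule nn_integral_Fatou_bound[where f = "\<lambda>n x. ennreal (min (gap x) (real n))" and C = "\<lambda>_. ennreal (b / (1 - a))"])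
    show "AE x in \<mu>. (\<lambda>n. ennreal (min (gap x) (real n))) \<longlonglongrightarrow> ennreal (gap x)"
    proof (rule AE_I2, rule tendsto_eventually)
      fix x
      obtain N where "gap x \<le> real N" using real_arch_simple by blast
      then show "eventually (\<lambda>n. ennreal (min (gap x) (real n)) = ennreal (gap x)) sequentially"
        by (intro eventually_sequentiallyI[of N]) (simp add: min_def)
    qed
  qed (auto simp: trunc)
qed

lemma invariant_gap_bounded:
  assumes \<mu>: "\<mu> \<in> invariant_measures M"
  shows "gap_bounded \<mu> (b / (1 - a))"
  unfolding gap_bounded_def
  using invariant_measureD[OF \<mu>] stationary_gap_nonneg invariant_gap_integral[OF \<mu>]
    invariant_path_sum[OF \<mu>, of "\<lambda>x. ennreal (gap x)"] by simp

section \<open>The measure on the code space of an invariant measure\<close>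

lemma word_mass_snoc:
  assumes "sets \<nu> = sets borel"
  shows "(\<integral>\<^sup>+e. word_mass \<nu> (es @ [e]) \<partial>count_space UNIV) = word_mass \<nu> es"
proof -
  note [measurable_cong] = assms
  have "(\<integral>\<^sup>+e. word_mass \<nu> (es @ [e]) \<partial>count_space UNIV)
    = (\<integral>\<^sup>+x. (\<integral>\<^sup>+e. ennreal (path_prob M (es @ [e]) x) \<partial>count_space UNIV) \<partial>\<nu>)"
    unfolding word_mass_def by (rule nn_integral_count_space_nn_integral[symmetric]) auto
  also have "\<dots> = word_mass \<nu> es"
    unfolding word_mass_def
    by (intro nn_integral_cong) (simp add: path_prob_append ennreal_mult' nn_integral_cmult sum_wprob_opt)
  finally show ?thesis .
qed

lemma word_mass_Cons:
  assumes "sets \<nu> = sets borel"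
  shows "(\<integral>\<^sup>+e. word_mass \<nu> (e # es) \<partial>count_space UNIV) = (\<integral>\<^sup>+x. markov_op M (\<lambda>x. ennreal (path_prob M es x)) x \<partial>\<nu>)"
proof -
  note [measurable_cong] = assms
  have "(\<integral>\<^sup>+e. word_mass \<nu> (e # es) \<partial>count_space UNIV)
    = (\<integral>\<^sup>+x. (\<integral>\<^sup>+e. ennreal (path_prob M (e # es) x) \<partial>count_space UNIV) \<partial>\<nu>)"
    unfolding word_mass_def by (rule nn_integral_count_space_nn_integral[symmetric]) auto
  then show ?thesis by (simp add: markov_op_eq ennreal_mult')
qed

lemma word_mass_Nil: "prob_space \<nu> \<Longrightarrow> word_mass \<nu> [] = 1"
  by (simp add: word_mass_def prob_space.emeasure_space_1)

lemma Phi_eqI: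
  assumes \<Lambda>: "prob_space \<Lambda>" "sets \<Lambda> = sets code_borel"
    and cyl: "\<And>m es. emeasure \<Lambda> (cylinder m es) = word_mass \<mu> es"
  shows "Phi M \<mu> = \<Lambda>"
  unfolding Phi_def
proof (rule the_equality)
  show "prob_space \<Lambda> \<and> sets \<Lambda> = sets code_borel \<and>
     (\<forall>m\<le>0. \<forall>es. es \<noteq> [] \<longrightarrow> emeasure \<Lambda> (cylinder m es) = (\<integral>\<^sup>+x. ennreal (path_prob M es x) \<partial>\<mu>))"
    using \<Lambda> cyl by (simp add: word_mass_def)
  fix \<Lambda>' :: "(int \<Rightarrow> 'e option) measure"
  assume *: "prob_space \<Lambda>' \<and> sets \<Lambda>' = sets code_borel \<and>
     (\<forall>m\<le>0. \<forall>es. es \<noteq> [] \<longrightarrow> emeasure \<Lambda>' (cylinder m es) = (\<integral>\<^sup>+x. ennreal (path_prob M es x) \<partial>\<mu>))"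
  show "\<Lambda>' = \<Lambda>"
  proof (rule measure_eqI_cylinders)
    fix n and es :: "'e option list" assume "length es = 2 * n + 1"
    then have "es \<noteq> []" by auto
    then show "emeasure \<Lambda>' (cylinder (- int n) es) = emeasure \<Lambda> (cylinder (- int n) es)"
      using * cyl by (simp add: word_mass_def)
  qed (use * \<Lambda> in auto)
qed

lemma Phi_invariant_measure:
  assumes \<mu>: "\<mu> \<in> invariant_measures M"
  shows "Phi M \<mu> \<in> shift_invariant" "emeasure (Phi M \<mu>) (cylinder m es) = word_mass \<mu> es"
proof -
  note D = invariant_measureD[OF \<mu>]
  have "\<exists>\<Lambda>\<in>shift_invariant. \<forall>m es. emeasure \<Lambda> (cylinder m es) = word_mass \<mu> es"
  proof (rule stationary_measure)
    show "(\<integral>\<^sup>+e. word_mass \<mu> (e # es) \<partial>count_space UNIV) = word_mass \<mu> es" for es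
      unfolding word_mass_Cons[OF D(2)] unfolding word_mass_def by (rule D(3)) measurable
  qed (simp_all add: word_mass_Nil D(1) word_mass_snoc[OF D(2)])
  then obtain \<Lambda> where \<Lambda>: "\<Lambda> \<in> shift_invariant" "\<And>m es. emeasure \<Lambda> (cylinder m es) = word_mass \<mu> es" by blast
  then have "Phi M \<mu> = \<Lambda>" by (intro Phi_eqI) (auto simp: shift_invariant_def)
  then show "Phi M \<mu> \<in> shift_invariant" "emeasure (Phi M \<mu>) (cylinder m es) = word_mass \<mu> es" using \<Lambda> by auto
qed

lemma Phi_limit_state:
  assumes \<mu>: "\<mu> \<in> invariant_measures M"
  shows "limit_state (Phi M \<mu>) (\<lambda>_. \<mu>) (b / (1 - a))"
  unfolding limit_state_def using Phi_invariant_measure[OF \<mu>] invariant_gap_bounded[OF \<mu>] by simp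

section \<open>The coding map recovers the invariant measure\<close>

text \<open>
  By invariance \<open>\<mu>\<close> is the law of the end point of a path of any length, while the \<open>n\<close>-th approximation
  has under \<open>\<Phi>(\<mu>)\<close> the law of the \<open>word_pt\<close> of such a path.  For a Lipschitz function the basic
  estimate makes the two integrals differ by at most \<open>L * a ^ (n + 1) * b / (1 - a)\<close>, and the
  same bound holds between the approximation and its limit.
\<close>

lemma Phi_coding_Lipschitz:
  fixes f :: "'k \<Rightarrow> real"
  assumes \<mu>: "\<mu> \<in> invariant_measures M"
    and f: "\<And>x. 0 \<le> f x" "\<And>x y. \<bar>f x - f y\<bar> \<le> L * dist x y" "f \<in> borel_measurable borel" and L: "0 \<le> L"
  shows "(\<integral>\<^sup>+x. ennreal (f x) \<partial>\<mu>) = (\<integral>\<^sup>+\<sigma>. ennreal (f (coding M xs \<sigma>)) \<partial>Phi M \<mu>)"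
proof -
  let ?\<Lambda> = "Phi M \<mu>" and ?B = "b / (1 - a)"
  note \<Lambda> = Phi_limit_state[OF \<mu>]
  note setsL[measurable_cong] = limit_stateD(2)[OF \<Lambda>] and sets\<mu>[measurable_cong] = invariant_measureD(2)[OF \<mu>]
  note [measurable] = f(3)
  have fle: "ennreal (f x) \<le> ennreal (f y) + ennreal L * ennreal (dist x y)" for x y
  proof -
    have "f x \<le> f y + L * dist x y" using f(2)[of x y] by linarith
    then have "ennreal (f x) \<le> ennreal (f y + L * dist x y)" by (rule ennreal_leI)
    then show ?thesis using f(1) L by (simp add: ennreal_mult)
  qed
  have [measurable]: "(\<lambda>\<sigma>. coding_approx M xs \<sigma> n) \<in> code_borel \<rightarrow>\<^sub>M borel" for n
    by (rule measurable_from_past) measurable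
  have word: "(\<integral>\<^sup>+\<sigma>. ennreal (f (coding_approx M xs \<sigma> n)) \<partial>?\<Lambda>) = (\<integral>\<^sup>+x. path_sum M (Suc n) (\<lambda>es. ennreal (f (word_pt es))) x \<partial>\<mu>)" for n
  proof -
    have "(\<integral>\<^sup>+\<sigma>. ennreal (f (coding_approx M xs \<sigma> n)) \<partial>?\<Lambda>)
      = (\<integral>\<^sup>+es. emeasure ?\<Lambda> (cylinder (- int n) es) * ennreal (f (word_pt es)) \<partial>count_space (words (Suc n)))"
      unfolding coding_approx_window by (rule nn_integral_window[OF setsL, where h = "\<lambda>es. ennreal (f (word_pt es))"])
    then show ?thesis
      by (simp add: Phi_invariant_measure(2)[OF \<mu>] nn_integral_path_sum_word_mass[OF sets\<mu>])
  qed
  have inv: "(\<integral>\<^sup>+x. ennreal (f x) \<partial>\<mu>) = (\<integral>\<^sup>+x. path_sum M n (\<lambda>es. ennreal (f (path_map M es x))) x \<partial>\<mu>)" for n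
    by (rule invariant_path_sum[OF \<mu>, symmetric]) measurable
  have m1: "(\<lambda>x. path_sum M n (\<lambda>es. ennreal (dist (path_map M es x) (word_pt es))) x) \<in> borel_measurable \<mu>" for n
  proof -
    have "(\<lambda>x. path_sum M n (\<lambda>es. ennreal (dist (path_map M es x) (word_pt es))) x) \<in> borel_measurable borel"
      by (intro measurable_path_sum measurable_dist_path_map)
    then show ?thesis by measurable
  qed
  have m2: "(\<lambda>x. path_sum M n (\<lambda>es. ennreal (f (path_map M es x))) x) \<in> borel_measurable \<mu>" for n
  proof -
    have "(\<lambda>x. path_sum M n (\<lambda>es. ennreal (f (path_map M es x))) x) \<in> borel_measurable borel"
      by (rule measurable_path_sum_fun) measurable
    then show ?thesis by measurable
  qed
  have m3: "(\<lambda>x. path_sum M n (\<lambda>es. ennreal (f (word_pt es))) x) \<in> borel_measurable \<mu>" for n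
  proof -
    have "(\<lambda>x. path_sum M n (\<lambda>es. ennreal (f (word_pt es))) x) \<in> borel_measurable borel"
      by (rule measurable_path_sum) measurable
    then show ?thesis by measurable
  qed
  have tail: "(\<integral>\<^sup>+x. ennreal L * path_sum M (Suc n) (\<lambda>es. ennreal (dist (path_map M es x) (word_pt es))) x \<partial>\<mu>)
      \<le> ennreal (L * (a ^ Suc n * ?B))" for n
  proof -
    have "(\<integral>\<^sup>+x. path_sum M (Suc n) (\<lambda>es. ennreal (dist (path_map M es x) (word_pt es))) x \<partial>\<mu>) \<le> ennreal (a ^ Suc n * ?B)"
      using gap_bounded_tail[OF invariant_gap_bounded[OF \<mu>], of "Suc n" 0] by simp
    then have "ennreal L * (\<integral>\<^sup>+x. path_sum M (Suc n) (\<lambda>es. ennreal (dist (path_map M es x) (word_pt es))) x \<partial>\<mu>) \<le> ennreal L * ennreal (a ^ Suc n * ?B)"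
      by (rule mult_left_mono) simp
    then show ?thesis by (simp only: nn_integral_cmult[OF m1] ennreal_mult'[OF L])
  qed
  have coding_tail: "(\<integral>\<^sup>+\<sigma>. ennreal L * ennreal (dist (coding M xs \<sigma>) (coding_approx M xs \<sigma> n)) \<partial>?\<Lambda>)
      \<le> ennreal (L * (a ^ Suc n * ?B))" for n
  proof -
    have "ennreal L * (\<integral>\<^sup>+\<sigma>. ennreal (dist (coding M xs \<sigma>) (coding_approx M xs \<sigma> n)) \<partial>?\<Lambda>) \<le> ennreal L * ennreal (a ^ Suc n * ?B)"
      by (rule mult_left_mono[OF limit_state_dist_coding[OF \<Lambda>]]) simp
    moreover have "(\<lambda>\<sigma>. ennreal (dist (coding M xs \<sigma>) (coding_approx M xs \<sigma> n))) \<in> borel_measurable ?\<Lambda>" by measurable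
    ultimately show ?thesis by (simp only: nn_integral_cmult ennreal_mult'[OF L])
  qed
  let ?e = "\<lambda>n. ennreal (L * (a ^ Suc n * ?B))"
  let ?w = "\<lambda>n. \<integral>\<^sup>+\<sigma>. ennreal (f (coding_approx M xs \<sigma> n)) \<partial>?\<Lambda>"
  have 1: "(\<integral>\<^sup>+x. ennreal (f x) \<partial>\<mu>) \<le> ?w n + ?e n" for n
  proof -
    have "(\<integral>\<^sup>+x. ennreal (f x) \<partial>\<mu>) \<le> (\<integral>\<^sup>+x. path_sum M (Suc n) (\<lambda>es. ennreal (f (word_pt es))) x
        + ennreal L * path_sum M (Suc n) (\<lambda>es. ennreal (dist (path_map M es x) (word_pt es))) x \<partial>\<mu>)"
      unfolding inv[of "Suc n"] path_sum_cmult[symmetric] path_sum_add[symmetric]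
      by (intro nn_integral_mono path_sum_mono fle)
    also have "\<dots> \<le> ?w n + ?e n"
      unfolding word using m1 m3 tail[of n] by (subst nn_integral_add) (auto intro: add_left_mono)
    finally show ?thesis .
  qed
  have 2: "?w n \<le> (\<integral>\<^sup>+x. ennreal (f x) \<partial>\<mu>) + ?e n" for n
  proof -
    have "?w n \<le> (\<integral>\<^sup>+x. path_sum M (Suc n) (\<lambda>es. ennreal (f (path_map M es x))) x
        + ennreal L * path_sum M (Suc n) (\<lambda>es. ennreal (dist (path_map M es x) (word_pt es))) x \<partial>\<mu>)"
      unfolding word path_sum_cmult[symmetric] path_sum_add[symmetric]
      by (intro nn_integral_mono path_sum_mono) (metis fle dist_commute)
    also have "\<dots> \<le> (\<integral>\<^sup>+x. ennreal (f x) \<partial>\<mu>) + ?e n"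
      unfolding inv[of "Suc n"] using m1 m2 tail[of n] by (subst nn_integral_add) (auto intro: add_left_mono)
    finally show ?thesis .
  qed
  let ?F = "\<integral>\<^sup>+\<sigma>. ennreal (f (coding M xs \<sigma>)) \<partial>?\<Lambda>"
  have 3: "?w n \<le> ?F + ?e n" for n
  proof -
    have "?w n \<le> (\<integral>\<^sup>+\<sigma>. ennreal (f (coding M xs \<sigma>)) + ennreal L * ennreal (dist (coding M xs \<sigma>) (coding_approx M xs \<sigma> n)) \<partial>?\<Lambda>)"
      by (intro nn_integral_mono) (metis fle dist_commute)
    also have "\<dots> \<le> ?F + ?e n"
      using coding_tail[of n] by (subst nn_integral_add) (auto intro: add_left_mono)
    finally show ?thesis .
  qed
  have 4: "?F \<le> ?w n + ?e n" for n
  proof -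
    have "?F \<le> (\<integral>\<^sup>+\<sigma>. ennreal (f (coding_approx M xs \<sigma> n)) + ennreal L * ennreal (dist (coding M xs \<sigma>) (coding_approx M xs \<sigma> n)) \<partial>?\<Lambda>)"
      by (intro nn_integral_mono fle)
    also have "\<dots> \<le> ?w n + ?e n"
      using coding_tail[of n] by (subst nn_integral_add) (auto intro: add_left_mono)
    finally show ?thesis .
  qed
  have "(\<lambda>n. a ^ n) \<longlonglongrightarrow> 0" using a_pos a_less_1 by (intro LIMSEQ_realpow_zero) auto
  then have "(\<lambda>n. L * (a ^ Suc n * ?B)) \<longlonglongrightarrow> L * (0 * ?B)" by (intro tendsto_mult tendsto_const LIMSEQ_Suc)
  then have "?e \<longlonglongrightarrow> ennreal (L * (0 * ?B))" by (rule tendsto_ennrealI)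
  then have e: "?e \<longlonglongrightarrow> 0" by simp
  have close: "x \<le> y" if *: "\<And>n. x \<le> y + (?e n + ?e n)" for x y
  proof -
    have "(\<lambda>n. y + (?e n + ?e n)) \<longlonglongrightarrow> y + (0 + 0)" by (intro tendsto_add tendsto_const e)
    then have "x \<le> y + (0 + 0)" by (rule LIMSEQ_le_const) (intro exI allI impI *)
    then show ?thesis by simp
  qed
  show ?thesis
  proof (rule antisym)
    show "(\<integral>\<^sup>+x. ennreal (f x) \<partial>\<mu>) \<le> ?F"
    proof (rule close)
      fix n show "(\<integral>\<^sup>+x. ennreal (f x) \<partial>\<mu>) \<le> ?F + (?e n + ?e n)"
        using order_trans[OF 1[of n] add_right_mono[OF 3[of n], of "?e n"]] by (simp only: add.assoc)
    qed
    show "?F \<le> (\<integral>\<^sup>+x. ennreal (f x) \<partial>\<mu>)"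
    proof (rule close)
      fix n show "?F \<le> (\<integral>\<^sup>+x. ennreal (f x) \<partial>\<mu>) + (?e n + ?e n)"
        using order_trans[OF 4[of n] add_right_mono[OF 2[of n], of "?e n"]] by (simp only: add.assoc)
    qed
  qed
qed

end

text \<open>
  The indicator of a closed set is the decreasing limit of the Lipschitz functions
  \<open>max 0 (1 - n * infdist x C)\<close>.
\<close>

lemma measure_eqI_Lipschitz:
  fixes P Q :: "'k::metric_space measure"
  assumes P: "prob_space P" "sets P = sets borel" and Q: "prob_space Q" "sets Q = sets borel"
    and eq: "\<And>f L. (\<And>x. 0 \<le> f x) \<Longrightarrow> 0 \<le> L \<Longrightarrow> (\<And>x y. \<bar>f x - f y\<bar> \<le> L * dist x y) \<Longrightarrow> f \<in> borel_measurable borel \<Longrightarrow>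
      (\<integral>\<^sup>+x. ennreal (f x) \<partial>P) = (\<integral>\<^sup>+x. ennreal (f x) \<partial>Q)"
  shows "P = Q"
proof -
  have approx: "(\<lambda>n. \<integral>\<^sup>+x. ennreal (max 0 (1 - real n * infdist x C)) \<partial>R) \<longlonglongrightarrow> emeasure R C"
    if C: "closed C" "C \<noteq> {}" and R: "prob_space R" and sets[measurable_cong]: "sets R = sets borel" for C :: "'k set" and R
  proof -
    interpret R: prob_space R by (rule R)
    have [measurable]: "C \<in> sets borel" using C by simp
    have [measurable]: "(\<lambda>x. infdist x C) \<in> borel_measurable borel"
      by (intro borel_measurable_continuous_onI continuous_intros)
    have "(\<lambda>n. \<integral>\<^sup>+x. ennreal (max 0 (1 - real n * infdist x C)) \<partial>R) \<longlonglongrightarrow> (\<integral>\<^sup>+x. indicator C x \<partial>R)"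
    proof (rule nn_integral_dominated_convergence[where w = "\<lambda>_. 1"])
      show "AE x in R. (\<lambda>n. ennreal (max 0 (1 - real n * infdist x C))) \<longlonglongrightarrow> indicator C x"
      proof (rule AE_I2, rule tendsto_eventually)
        fix x
        show "eventually (\<lambda>n. ennreal (max 0 (1 - real n * infdist x C)) = indicator C x) sequentially"
        proof (cases "x \<in> C")
          case True then show ?thesis by simp
        next
          case False
          then have pos: "0 < infdist x C" using C in_closed_iff_infdist_zero[of C x] infdist_nonneg[of x C] by linarith
          obtain N where N: "1 / infdist x C \<le> real N" using real_arch_simple by blast
          show ?thesis
          proof (rule eventually_sequentiallyI[of N])
            fix n assume "N \<le> n"
            then have "1 / infdist x C \<le> real n" using N by linarith
            then have "1 \<le> real n * infdist x C" using pos by (simp add: field_simps)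
            then show "ennreal (max 0 (1 - real n * infdist x C)) = indicator C x" using False by simp
          qed
        qed
      qed
      show "AE x in R. ennreal (max 0 (1 - real n * infdist x C)) \<le> 1" for n
        by (intro AE_I2) (simp add: infdist_nonneg)
      show "(\<integral>\<^sup>+x. 1 \<partial>R) < \<infinity>" by (simp add: R.emeasure_space_1)
    qed measurable
    then show ?thesis by simp
  qed
  have closed: "emeasure P C = emeasure Q C" if C: "closed C" for C
  proof (cases "C = {}")
    case False
    have "(\<integral>\<^sup>+x. ennreal (max 0 (1 - real n * infdist x C)) \<partial>P) = (\<integral>\<^sup>+x. ennreal (max 0 (1 - real n * infdist x C)) \<partial>Q)" for n
    proof (rule eq)
      show "\<bar>max 0 (1 - real n * infdist x C) - max 0 (1 - real n * infdist y C)\<bar> \<le> real n * dist x y" for x y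
      proof -
        have "\<bar>infdist x C - infdist y C\<bar> \<le> dist x y" by (rule infdist_triangle_abs)
        then have "real n * \<bar>infdist x C - infdist y C\<bar> \<le> real n * dist x y" by (intro mult_left_mono) auto
        moreover have "real n * \<bar>infdist x C - infdist y C\<bar> = \<bar>real n * infdist x C - real n * infdist y C\<bar>"
          by (simp add: abs_mult flip: right_diff_distrib)
        ultimately show ?thesis by linarith
      qed
      have [measurable]: "(\<lambda>x. infdist x C) \<in> borel_measurable borel"
        by (intro borel_measurable_continuous_onI continuous_intros)
      show "(\<lambda>x. max 0 (1 - real n * infdist x C)) \<in> borel_measurable borel" by measurable
    qed auto
    with approx[OF C False P] approx[OF C False Q] show ?thesis by (auto intro: LIMSEQ_unique)
  qed simp
  have gen: "sets (borel :: 'k measure) = sigma_sets UNIV (Collect closed)"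
    unfolding borel_eq_closed by simp
  show ?thesis
  proof (rule measure_eqI_generator_eq_countable[where \<Omega> = UNIV and E = "Collect closed" and A = "{UNIV}"])
    show "emeasure P a \<noteq> \<infinity>" for a
      using P(1) by (simp add: prob_space.axioms finite_measure.emeasure_finite)
  qed (auto simp: gen P(2) Q(2) closed intro!: Int_stableI)
qed

context contractive_markov_system
begin

lemma distr_Phi_coding:
  assumes \<mu>: "\<mu> \<in> invariant_measures M"
  shows "distr (Phi M \<mu>) borel (coding M xs) = \<mu>"
proof (rule measure_eqI_Lipschitz[symmetric])
  note \<Lambda> = Phi_limit_state[OF \<mu>]
  note sets[measurable_cong] = limit_stateD(2)[OF \<Lambda>]
  show "prob_space (distr (Phi M \<mu>) borel (coding M xs))"
    by (intro prob_space.prob_space_distr limit_stateD(1)[OF \<Lambda>]) measurable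
  fix f :: "'k \<Rightarrow> real" and L :: real
  assume f: "\<And>x. 0 \<le> f x" "0 \<le> L" "\<And>x y. \<bar>f x - f y\<bar> \<le> L * dist x y" "f \<in> borel_measurable borel"
  note [measurable] = f(4)
  show "(\<integral>\<^sup>+x. ennreal (f x) \<partial>\<mu>) = (\<integral>\<^sup>+x. ennreal (f x) \<partial>distr (Phi M \<mu>) borel (coding M xs))"
    by (subst nn_integral_distr) (auto intro!: Phi_coding_Lipschitz[OF \<mu> f(1,3,4,2)])
qed (use invariant_measureD[OF \<mu>] in auto)

section \<open>Local Hoelder continuity of the coding map\<close>

text \<open>
  The rate \<open>sqrt a\<close> is the geometric mean between the expected rate \<open>a\<close> and no decay: it leaves a factor
  \<open>sqrt a ^ m\<close> for the probability of failure.  Controlling the distance to the limit, rather than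
  the distances between successive approximations, saves a factor \<open>1 / (1 - sqrt a)\<close>.
\<close>

definition Hoelder_set :: "nat \<Rightarrow> (int \<Rightarrow> 'e option) set" where
  "Hoelder_set k = {\<sigma> \<in> coding_domain M xs. \<forall>m\<ge>k.
     dist (coding M xs \<sigma>) (coding_approx M xs \<sigma> m) \<le> 4 * b / ((1 - sqrt a) * (1 - a)) * sqrt a ^ Suc m}"

lemma sqrt_a: "0 < sqrt a" "sqrt a < 1" "sqrt a * sqrt a = a"
  using a_pos a_less_1 by simp_all

lemma sets_Hoelder_set: "Hoelder_set k \<in> sets code_borel"
proof -
  have "{\<sigma> \<in> space (code_borel :: (int \<Rightarrow> 'e option) measure). \<sigma> \<in> coding_domain M xs \<and> (\<forall>m. m \<ge> k \<longrightarrow>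
     dist (coding M xs \<sigma>) (coding_approx M xs \<sigma> m) \<le> 4 * b / ((1 - sqrt a) * (1 - a)) * sqrt a ^ Suc m)} \<in> sets code_borel"
    by measurable
  then show ?thesis by (simp add: Hoelder_set_def)
qed

lemma Hoelder_set_mono: "Hoelder_set k \<subseteq> Hoelder_set (Suc k)"
  by (auto simp: Hoelder_set_def)

lemma Hoelder_set_SigmaG: "Hoelder_set k \<subseteq> SigmaG M"
  by (auto simp: Hoelder_set_def coding_domain_def)

lemma coding_approx_far:
  assumes \<mu>: "\<mu> \<in> invariant_measures M"
  shows "emeasure (Phi M \<mu>) {\<sigma>. \<not> dist (coding M xs \<sigma>) (coding_approx M xs \<sigma> m) \<le> 4 * b / ((1 - sqrt a) * (1 - a)) * sqrt a ^ Suc m}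
    \<le> ennreal ((1 - sqrt a) * sqrt a ^ Suc m)"
proof -
  note \<Lambda> = Phi_limit_state[OF \<mu>]
  note sets[measurable_cong] = limit_stateD(2)[OF \<Lambda>]
  interpret \<Lambda>: prob_space "Phi M \<mu>" by (rule limit_stateD[OF \<Lambda>])
  have space: "space (Phi M \<mu>) = UNIV" using sets_eq_imp_space_eq[OF sets] by simp
  let ?d = "\<lambda>\<sigma>. dist (coding M xs \<sigma>) (coding_approx M xs \<sigma> m)"
  let ?t = "4 * b / ((1 - sqrt a) * (1 - a)) * sqrt a ^ Suc m"
  note int = limit_state_dist_coding[OF \<Lambda>, of m]
  show ?thesis
  proof (cases "b = 0")
    case True
    then have "(\<integral>\<^sup>+\<sigma>. ennreal (?d \<sigma>) \<partial>Phi M \<mu>) = 0" using int by simp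
    then have "AE \<sigma> in Phi M \<mu>. ennreal (?d \<sigma>) = 0" by (subst (asm) nn_integral_0_iff_AE) auto
    then have "AE \<sigma> in Phi M \<mu>. \<not> (\<not> ?d \<sigma> \<le> ?t)" using True by (auto elim!: eventually_mono)
    then have "emeasure (Phi M \<mu>) {\<sigma> \<in> space (Phi M \<mu>). \<not> ?d \<sigma> \<le> ?t} = 0"
      by (subst (asm) AE_iff_measurable[OF _ refl]) auto
    then show ?thesis by (simp add: space)
  next
    case False
    then have b: "0 < b" using b_nonneg by simp
    define t where "t = ?t"
    have t: "0 < t" unfolding t_def using b sqrt_a a_less_1 by simp
    have "emeasure (Phi M \<mu>) {\<sigma>. \<not> ?d \<sigma> \<le> t} \<le> emeasure (Phi M \<mu>) {\<sigma> \<in> UNIV. 1 \<le> ennreal (1 / t) * ennreal (?d \<sigma>)}"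
    proof (rule emeasure_mono)
      show "{\<sigma>. \<not> ?d \<sigma> \<le> t} \<subseteq> {\<sigma> \<in> UNIV. 1 \<le> ennreal (1 / t) * ennreal (?d \<sigma>)}"
      proof
        fix \<sigma> assume "\<sigma> \<in> {\<sigma>. \<not> ?d \<sigma> \<le> t}"
        then have "1 \<le> 1 / t * ?d \<sigma>" using t by (simp add: pos_le_divide_eq)
        then have "1 \<le> ennreal (1 / t * ?d \<sigma>)" by simp
        also have "\<dots> = ennreal (1 / t) * ennreal (?d \<sigma>)" using t by (intro ennreal_mult) auto
        finally show "\<sigma> \<in> {\<sigma> \<in> UNIV. 1 \<le> ennreal (1 / t) * ennreal (?d \<sigma>)}" by simp
      qed
      have "{\<sigma> \<in> space (Phi M \<mu>). 1 \<le> ennreal (1 / t) * ennreal (?d \<sigma>)} \<in> sets (Phi M \<mu>)" by measurable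
      then show "{\<sigma> \<in> UNIV. 1 \<le> ennreal (1 / t) * ennreal (?d \<sigma>)} \<in> sets (Phi M \<mu>)" by (simp add: space)
    qed
    also have "\<dots> \<le> ennreal (1 / t) * (\<integral>\<^sup>+\<sigma>. ennreal (?d \<sigma>) * indicator UNIV \<sigma> \<partial>Phi M \<mu>)"
    proof (rule nn_integral_Markov_inequality)
      show "UNIV \<in> sets (Phi M \<mu>)" using sets.top[of "Phi M \<mu>"] by (simp add: space)
    qed measurable
    also have "\<dots> \<le> ennreal (1 / t) * ennreal (a ^ Suc m * (b / (1 - a)))"
      using int by (intro mult_left_mono) simp_all
    also have "\<dots> = ennreal (1 / t * (a ^ Suc m * (b / (1 - a))))"
      using t by (intro ennreal_mult'[symmetric]) simp
    also have "1 / t * (a ^ Suc m * (b / (1 - a))) = (1 - sqrt a) * sqrt a ^ Suc m / 4"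
    proof -
      have "(sqrt a * sqrt a) ^ Suc m = sqrt a ^ Suc m * sqrt a ^ Suc m"
        by (rule power_mult_distrib)
      then have pw: "a ^ Suc m = sqrt a ^ Suc m * sqrt a ^ Suc m" by (simp only: sqrt_a(3))
      have "1 / (4 * b / (u * v) * P) * (P * P * (b / v)) = u * P / 4" if "0 < u" "0 < v" "0 < P" for u v P
        using b that by (simp add: field_simps)
      from this[of "1 - sqrt a" "1 - a" "sqrt a ^ Suc m"] show ?thesis
        unfolding t_def pw using sqrt_a a_less_1 by (simp del: power_Suc)
    qed
    also have "ennreal ((1 - sqrt a) * sqrt a ^ Suc m / 4) \<le> ennreal ((1 - sqrt a) * sqrt a ^ Suc m)"
      using sqrt_a by (intro ennreal_leI) simp
    finally show ?thesis unfolding t_def .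
  qed
qed

lemma geometric_tail:
  assumes "0 < s" "s < 1" "0 \<le> c"
  shows "(\<Sum>i. ennreal (c * s ^ (k + i))) = ennreal (c * s ^ k / (1 - s))"
proof -
  have "(\<lambda>i. c * s ^ k * s ^ i) sums (c * s ^ k * (1 / (1 - s)))"
    using assms by (intro sums_mult geometric_sums) simp
  then have "(\<lambda>i. c * s ^ (k + i)) sums (c * s ^ k / (1 - s))"
    by (simp add: power_add mult.assoc)
  then show ?thesis using assms by (intro suminf_ennreal_eq) auto
qed

lemma Phi_Hoelder_set_compl:
  assumes \<mu>: "\<mu> \<in> invariant_measures M"
  shows "emeasure (Phi M \<mu>) (UNIV - Hoelder_set k) \<le> ennreal (sqrt a ^ k)"
proof -
  note \<Lambda> = Phi_limit_state[OF \<mu>]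
  note sets[measurable_cong] = limit_stateD(2)[OF \<Lambda>]
  have space: "space (Phi M \<mu>) = UNIV" using sets_eq_imp_space_eq[OF sets] by simp
  define far where "far m = {\<sigma>. \<not> dist (coding M xs \<sigma>) (coding_approx M xs \<sigma> m) \<le> 4 * b / ((1 - sqrt a) * (1 - a)) * sqrt a ^ Suc m}" for m
  have far[measurable]: "far m \<in> sets (Phi M \<mu>)" for m
  proof -
    have "{\<sigma> \<in> space (Phi M \<mu>). \<not> dist (coding M xs \<sigma>) (coding_approx M xs \<sigma> m) \<le> 4 * b / ((1 - sqrt a) * (1 - a)) * sqrt a ^ Suc m} \<in> sets (Phi M \<mu>)"
      by measurable
    then show ?thesis by (simp add: far_def space)
  qed
  have dom: "UNIV - coding_domain M xs \<in> null_sets (Phi M \<mu>)"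
  proof -
    have "{\<sigma> \<in> space (Phi M \<mu>). \<not> \<sigma> \<in> coding_domain M xs} \<in> sets (Phi M \<mu>)" by measurable
    from AE_iff_null[OF this] limit_state_coding_domain[OF \<Lambda>]
    have "{\<sigma> \<in> space (Phi M \<mu>). \<not> \<sigma> \<in> coding_domain M xs} \<in> null_sets (Phi M \<mu>)" by blast
    moreover have "{\<sigma> \<in> space (Phi M \<mu>). \<not> \<sigma> \<in> coding_domain M xs} = UNIV - coding_domain M xs" by (auto simp: space)
    ultimately show ?thesis by simp
  qed
  have "UNIV - Hoelder_set k \<subseteq> (\<Union>i. far (k + i)) \<union> (UNIV - coding_domain M xs)"
  proof
    fix \<sigma> assume "\<sigma> \<in> UNIV - Hoelder_set k"
    then have "\<sigma> \<notin> coding_domain M xs \<or> (\<exists>m\<ge>k. \<sigma> \<in> far m)" by (auto simp: Hoelder_set_def far_def)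
    then show "\<sigma> \<in> (\<Union>i. far (k + i)) \<union> (UNIV - coding_domain M xs)"
      by (auto simp only: le_iff_add Un_iff UN_iff Diff_iff)
  qed
  then have "emeasure (Phi M \<mu>) (UNIV - Hoelder_set k) \<le> emeasure (Phi M \<mu>) ((\<Union>i. far (k + i)) \<union> (UNIV - coding_domain M xs))"
    using dom by (intro emeasure_mono) auto
  also have "\<dots> = emeasure (Phi M \<mu>) (\<Union>i. far (k + i))"
    by (rule emeasure_Un_null_set[OF _ dom]) auto
  also have "\<dots> \<le> (\<Sum>i. emeasure (Phi M \<mu>) (far (k + i)))"
    by (rule emeasure_subadditive_countably) auto
  also have "\<dots> \<le> (\<Sum>i. ennreal ((1 - sqrt a) * sqrt a ^ (Suc k + i)))"
  proof (intro suminf_le)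
    show "emeasure (Phi M \<mu>) (far (k + i)) \<le> ennreal ((1 - sqrt a) * sqrt a ^ (Suc k + i))" for i
      using coding_approx_far[OF \<mu>, of "k + i"] unfolding far_def by simp
  qed auto
  also have "\<dots> = ennreal (sqrt a ^ Suc k)"
    using sqrt_a by (subst geometric_tail) auto
  also have "\<dots> \<le> ennreal (sqrt a ^ k)"
    using sqrt_a by (intro ennreal_leI) (simp add: mult_left_le_one_le)
  finally show ?thesis .
qed

lemma sum_Phi_Hoelder_set_compl:
  assumes \<mu>: "\<mu> \<in> invariant_measures M"
  shows "(\<Sum>k. emeasure (Phi M \<mu>) (UNIV - Hoelder_set (n + k))) \<le> ennreal (1 / (1 - sqrt a) * a powr (real n / 2))"
proof -
  have "(\<Sum>k. emeasure (Phi M \<mu>) (UNIV - Hoelder_set (n + k))) \<le> (\<Sum>k. ennreal (1 * sqrt a ^ (n + k)))"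
    using Phi_Hoelder_set_compl[OF \<mu>] by (intro suminf_le) auto
  also have "\<dots> = ennreal (1 * sqrt a ^ n / (1 - sqrt a))"
    using sqrt_a by (intro geometric_tail) auto
  also have "sqrt a ^ n = a powr (real n / 2)"
    using a_pos by (simp add: powr_half_sqrt[symmetric] powr_powr flip: powr_realpow)
  finally show ?thesis by simp
qed

text \<open>
  Codes that agree on the letters with \<open>\<bar>i\<bar> < K\<close> have the same approximation of index \<open>K - 1\<close>, and this
  index is at least \<open>k\<close>.
\<close>

lemma coding_Hoelder:
  assumes \<sigma>: "\<sigma> \<in> Hoelder_set k" "\<sigma>' \<in> Hoelder_set k" and close: "code_dist \<sigma> \<sigma>' \<le> (1 / 2) ^ (k + 1)"
  shows "dist (coding M xs \<sigma>) (coding M xs \<sigma>')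
    \<le> 8 * b / ((1 - sqrt a) * (1 - a)) * code_dist \<sigma> \<sigma>' powr (ln (sqrt a) / ln (1 / 2))"
proof (cases "\<sigma> = \<sigma>'")
  case True then show ?thesis by (simp add: code_dist_def)
next
  case False
  let ?Q = "\<lambda>k::nat. \<forall>i. \<bar>i\<bar> < int k \<longrightarrow> \<sigma> i = \<sigma>' i"
  define K where "K = (GREATEST k. ?Q k)"
  obtain i where i: "\<sigma> i \<noteq> \<sigma>' i" using False by (auto simp: fun_eq_iff)
  have "?Q K"
    unfolding K_def
  proof (rule GreatestI_nat[of ?Q 0 "nat \<bar>i\<bar>"])
    fix y assume "?Q y"
    then have "\<not> \<bar>i\<bar> < int y" using i by blast
    then show "y \<le> nat \<bar>i\<bar>" by linarith
  qed simp
  have dist: "code_dist \<sigma> \<sigma>' = (1 / 2) ^ K" using False by (simp add: code_dist_def K_def)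
  have K: "k + 1 \<le> K"
  proof (rule ccontr)
    assume "\<not> k + 1 \<le> K"
    then have "(1 / 2 :: real) ^ (k + 1) < (1 / 2) ^ K" by (intro power_strict_decreasing) auto
    then show False using close unfolding dist by linarith
  qed
  then obtain m where m: "K = Suc m" "k \<le> m" by (cases K) auto
  have "map \<sigma> [- int m..0] = map \<sigma>' [- int m..0]"
    using \<open>?Q K\<close> m(1) by (auto simp: map_eq_conv)
  then have same: "coding_approx M xs \<sigma> m = coding_approx M xs \<sigma>' m"
    unfolding coding_approx_window by (rule arg_cong)
  let ?T = "4 * b / ((1 - sqrt a) * (1 - a)) * sqrt a ^ Suc m"
  have "dist (coding M xs \<sigma>) (coding M xs \<sigma>') \<le> dist (coding M xs \<sigma>) (coding_approx M xs \<sigma> m) + dist (coding M xs \<sigma>') (coding_approx M xs \<sigma>' m)"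
    unfolding same by (rule dist_triangle2)
  also have "\<dots> \<le> ?T + ?T"
    using \<sigma> m(2) unfolding Hoelder_set_def by (intro add_mono) blast+
  also have "\<dots> = 8 * b / ((1 - sqrt a) * (1 - a)) * sqrt a ^ K"
  proof -
    have "4 * b / X * P + 4 * b / X * P = 8 * b / X * P" for X P :: real
      by (simp add: times_divide_eq_left flip: add_divide_distrib)
    then show ?thesis unfolding m(1) by blast
  qed
  also have "sqrt a ^ K = code_dist \<sigma> \<sigma>' powr (ln (sqrt a) / ln (1 / 2))"
  proof -
    have "code_dist \<sigma> \<sigma>' powr (ln (sqrt a) / ln (1 / 2)) = exp (real K * ln (sqrt a))"
      unfolding dist by (simp add: powr_def ln_realpow)
    also have "\<dots> = sqrt a ^ K" using sqrt_a by (simp add: exp_of_nat_mult)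
    finally show ?thesis ..
  qed
  finally show ?thesis .
qed

section \<open>Equilibrium states\<close>

lemma word_pt_snoc: "u \<noteq> [] \<Longrightarrow> word_pt (u @ [e]) = wmap_opt M e (word_pt u)"
  by (simp add: word_pt_def path_map_append)

text \<open>
  The approximations of the shifted code are the images of those of the code under the map of the
  letter \<open>1\<close>.  That map is continuous on its cell, and positivity of the probability places the limit
  in this cell.
\<close>

lemma coding_shift:
  assumes \<sigma>: "\<sigma> \<in> coding_domain M xs" and pos: "wprob_opt M (\<sigma> 1) (coding M xs \<sigma>) \<noteq> 0"
  shows "coding M xs (shift \<sigma>) = wmap_opt M (\<sigma> 1) (coding M xs \<sigma>)"
proof -
  have G: "\<sigma> \<in> SigmaG M" using \<sigma> by (simp add: coding_domain_def)
  have "shift \<sigma> n \<noteq> None \<and> ini_opt M (shift \<sigma> (n + 1)) = ter_opt M (shift \<sigma> n)" for n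
    using G unfolding SigmaG_def shift_def by blast
  then have G': "shift \<sigma> \<in> SigmaG M" unfolding SigmaG_def by blast
  obtain e where e: "\<sigma> 1 = Some e" using wprob_opt_supported(1)[OF pos] by auto
  let ?C = "cell M (ini M e)"
  have "vertex (coding M xs \<sigma>) = ini M e" using wprob_opt_supported(2)[OF pos] e by simp
  then have in_cell: "coding M xs \<sigma> \<in> ?C" using in_cell_iff[OF ini_in_vert] by simp
  have "ini_opt M (\<sigma> (0 + 1)) = ter_opt M (\<sigma> 0)" using G unfolding SigmaG_def by blast
  then have "ter_opt M (\<sigma> 0) = ini M e" using e by simp
  then have approx: "coding_approx M xs \<sigma> n \<in> ?C" for n
    using vertex_coding_approx[OF G, of n] in_cell_iff[OF ini_in_vert] by simp
  have step: "coding_approx M xs (shift \<sigma>) (Suc n) = wmap M e (coding_approx M xs \<sigma> n)" for n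
  proof -
    have "map (shift \<sigma>) [- int (Suc n)..0] = map \<sigma> [- int n..1]"
      by (rule nth_equalityI) (auto simp: shift_def)
    moreover have "[- int n..1] = [- int n..0] @ [1]" by (simp add: upto_rec2)
    ultimately have "map (shift \<sigma>) [- int (Suc n)..0] = map \<sigma> [- int n..0] @ [\<sigma> 1]" by simp
    then show ?thesis by (simp add: coding_approx_window word_pt_snoc e)
  qed
  have "continuous_on ?C (wmap M e)"
    using uniform by (auto simp: uniformly_continuous_system_def intro: uniformly_continuous_imp_continuous)
  then have "(\<lambda>n. wmap M e (coding_approx M xs \<sigma> n)) \<longlonglongrightarrow> wmap M e (coding M xs \<sigma>)"
    using coding_approx_tendsto[OF \<sigma>] in_cell approx
    unfolding continuous_on_sequentially comp_def by blast
  then have "(\<lambda>n. coding_approx M xs (shift \<sigma>) (Suc n)) \<longlonglongrightarrow> wmap M e (coding M xs \<sigma>)"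
    by (simp only: step)
  then have lim: "coding_approx M xs (shift \<sigma>) \<longlonglongrightarrow> wmap M e (coding M xs \<sigma>)"
    by (rule LIMSEQ_imp_Suc)
  then have "shift \<sigma> \<in> coding_domain M xs"
    using G' by (auto simp: coding_domain_def convergent_def)
  then show ?thesis using lim e by (simp add: coding_def limI)
qed

lemma cylinder_snoc_shift:
  "cylinder (1 - int (length u)) u \<inter> cylinder 1 [e] = shift -` cylinder (1 - int (length (u @ [e]))) (u @ [e])"
  unfolding shift_cylinder by (auto simp: cylinder_def nth_append less_Suc_eq)

context
  fixes \<Lambda> assumes \<Lambda>: "\<Lambda> \<in> equilibrium_states M xs"
begin

lemma equilibriumD:
  shows "prob_space \<Lambda>" "sets \<Lambda> = sets code_borel" "distr \<Lambda> code_borel shift = \<Lambda>"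
    "AE \<sigma> in \<Lambda>. real_cond_exp \<Lambda> past (indicator (cylinder 1 [Some e])) \<sigma> = wprob M e (coding M xs \<sigma>)"
  using \<Lambda> by (auto simp: equilibrium_states_def shift_invariant_def)

lemma equilibrium_coding_domain: "AE \<sigma> in \<Lambda>. \<sigma> \<in> coding_domain M xs"
proof -
  interpret prob_space \<Lambda> by (rule equilibriumD)
  have "coding_domain M xs \<in> sets \<Lambda>" using equilibriumD(2) by simp
  moreover have "prob (coding_domain M xs) = 1"
    using \<Lambda> by (simp add: equilibrium_states_def measure_def)
  ultimately show ?thesis by (simp add: prob_eq_1)
qed

lemma equilibrium_past_coding: "AE \<sigma> in \<Lambda>. past_coding \<sigma> = coding M xs \<sigma>"
  using equilibrium_coding_domain
  by eventually_elim (simp add: coding_domain_def coding_eq_past_coding)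

text \<open>
  The defining property of an equilibrium state, tested against functions of the past; it also holds
  for the point at infinity, which has probability \<open>0\<close>.
\<close>

lemma equilibrium_next_letter:
  assumes g: "g \<in> borel_measurable past" "\<And>\<sigma>. 0 \<le> g \<sigma>" "\<And>\<sigma>. g \<sigma> \<le> (1::real)"
  shows "(\<integral>\<^sup>+\<sigma>. ennreal (g \<sigma>) * indicator (cylinder 1 [e]) \<sigma> \<partial>\<Lambda>)
    = (\<integral>\<^sup>+\<sigma>. ennreal (g \<sigma>) * ennreal (wprob_opt M e (coding M xs \<sigma>)) \<partial>\<Lambda>)"
proof -
  interpret \<Lambda>: prob_space \<Lambda> by (rule equilibriumD)
  note sets[measurable_cong] = equilibriumD(2)
  show ?thesis
  proof (cases e)
    case None
    have "AE \<sigma> in \<Lambda>. \<sigma> \<notin> cylinder 1 [e]"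
      using equilibrium_coding_domain by eventually_elim (auto simp: coding_domain_def SigmaG_def cylinder_def None)
    then have "(\<integral>\<^sup>+\<sigma>. ennreal (g \<sigma>) * indicator (cylinder 1 [e]) \<sigma> \<partial>\<Lambda>) = (\<integral>\<^sup>+\<sigma>. 0 \<partial>\<Lambda>)"
      by (intro nn_integral_cong_AE) (auto elim!: eventually_mono)
    then show ?thesis by (simp add: None)
  next
    case (Some e')
    interpret finite_measure_subalgebra \<Lambda> past
      by standard (rule subalgebra_past[OF sets])
    have gm[measurable]: "g \<in> borel_measurable code_borel" by (rule measurable_from_past[OF g(1)])
    have [measurable]: "wprob M e' \<in> borel_measurable borel" using measurable_wprob_opt[of "Some e'"] by simp
    have p: "0 \<le> wprob M e' x" "wprob M e' x \<le> 1" for x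
      using wprob_opt_le_1[of "Some e'" x] wprob_opt_nonneg[of "Some e'" x] by simp_all
    let ?c = "indicator (cylinder 1 [e]) :: _ \<Rightarrow> real"
    have int1: "integrable \<Lambda> (\<lambda>\<sigma>. g \<sigma> * ?c \<sigma>)"
      by (rule \<Lambda>.integrable_const_bound[of _ 1]) (auto intro!: AE_I2 simp: indicator_def g)
    have int2: "integrable \<Lambda> (\<lambda>\<sigma>. g \<sigma> * wprob M e' (coding M xs \<sigma>))"
      by (rule \<Lambda>.integrable_const_bound[of _ 1]) (auto intro!: AE_I2 simp: abs_mult g p mult_le_one)
    have "(\<integral>\<sigma>. g \<sigma> * ?c \<sigma> \<partial>\<Lambda>) = (\<integral>\<sigma>. g \<sigma> * real_cond_exp \<Lambda> past ?c \<sigma> \<partial>\<Lambda>)"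
      by (rule real_cond_exp_intg(2)[symmetric, OF int1 g(1)]) measurable
    also have "\<dots> = (\<integral>\<sigma>. g \<sigma> * wprob M e' (coding M xs \<sigma>) \<partial>\<Lambda>)"
    proof (rule integral_cong_AE)
      have "real_cond_exp \<Lambda> past ?c \<in> borel_measurable \<Lambda>" by (rule borel_measurable_cond_exp2)
      then show "(\<lambda>\<sigma>. g \<sigma> * real_cond_exp \<Lambda> past ?c \<sigma>) \<in> borel_measurable \<Lambda>" by measurable
      show "AE \<sigma> in \<Lambda>. g \<sigma> * real_cond_exp \<Lambda> past ?c \<sigma> = g \<sigma> * wprob M e' (coding M xs \<sigma>)"
        using equilibriumD(4)[of e'] unfolding Some by eventually_elim simp
    qed measurable
    finally have eq: "(\<integral>\<sigma>. g \<sigma> * ?c \<sigma> \<partial>\<Lambda>) = (\<integral>\<sigma>. g \<sigma> * wprob M e' (coding M xs \<sigma>) \<partial>\<Lambda>)" .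
    have "(\<integral>\<^sup>+\<sigma>. ennreal (g \<sigma>) * indicator (cylinder 1 [e]) \<sigma> \<partial>\<Lambda>) = (\<integral>\<^sup>+\<sigma>. ennreal (g \<sigma> * ?c \<sigma>) \<partial>\<Lambda>)"
      by (intro nn_integral_cong) (simp add: indicator_def)
    also have "\<dots> = ennreal (\<integral>\<sigma>. g \<sigma> * ?c \<sigma> \<partial>\<Lambda>)"
      by (rule nn_integral_eq_integral[OF int1]) (simp add: g)
    also have "\<dots> = (\<integral>\<^sup>+\<sigma>. ennreal (g \<sigma> * wprob M e' (coding M xs \<sigma>)) \<partial>\<Lambda>)"
      unfolding eq by (rule nn_integral_eq_integral[OF int2, symmetric]) (simp add: g p)
    finally show ?thesis by (simp add: Some ennreal_mult g p)
  qed
qed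

lemma equilibrium_coding_shift:
  "AE \<sigma> in \<Lambda>. coding M xs (shift \<sigma>) = wmap_opt M (\<sigma> 1) (coding M xs \<sigma>)"
proof -
  note sets[measurable_cong] = equilibriumD(2)
  have [measurable]: "past_coding \<in> code_borel \<rightarrow>\<^sub>M borel" by (rule measurable_from_past) measurable
  have "AE \<sigma> in \<Lambda>. \<sigma> 1 = e \<longrightarrow> wprob_opt M e (coding M xs \<sigma>) \<noteq> 0" for e
  proof -
    \<comment> \<open>Testing against the event that \<open>e\<close> is impossible shows that \<open>e\<close> then almost surely does not
      occur.\<close>
    let ?g = "\<lambda>\<sigma>. if wprob_opt M e (past_coding \<sigma>) = 0 then 1 else 0 :: real"
    have gm: "?g \<in> borel_measurable past" by measurable
    have "(\<integral>\<^sup>+\<sigma>. ennreal (?g \<sigma>) * indicator (cylinder 1 [e]) \<sigma> \<partial>\<Lambda>)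
        = (\<integral>\<^sup>+\<sigma>. ennreal (?g \<sigma>) * ennreal (wprob_opt M e (coding M xs \<sigma>)) \<partial>\<Lambda>)"
      by (rule equilibrium_next_letter[OF gm]) auto
    also have "\<dots> = (\<integral>\<^sup>+\<sigma>. 0 \<partial>\<Lambda>)"
      using equilibrium_past_coding by (intro nn_integral_cong_AE) (auto elim!: eventually_mono)
    finally have int: "(\<integral>\<^sup>+\<sigma>. ennreal (?g \<sigma>) * indicator (cylinder 1 [e]) \<sigma> \<partial>\<Lambda>) = 0" by simp
    have "(\<lambda>\<sigma>. ennreal (?g \<sigma>) * indicator (cylinder 1 [e]) \<sigma>) \<in> borel_measurable \<Lambda>" by measurable
    from iffD1[OF nn_integral_0_iff_AE[OF this] int]
    have "AE \<sigma> in \<Lambda>. ennreal (?g \<sigma>) * indicator (cylinder 1 [e]) \<sigma> = 0" .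
    with equilibrium_past_coding show ?thesis
      by eventually_elim (auto simp: cylinder_def split: if_splits)
  qed
  then have "AE \<sigma> in \<Lambda>. \<forall>e. \<sigma> 1 = e \<longrightarrow> wprob_opt M e (coding M xs \<sigma>) \<noteq> 0"
    by (intro iffD2[OF AE_all_countable] allI)
  with equilibrium_coding_domain show ?thesis
    by eventually_elim (auto intro: coding_shift)
qed

lemma equilibrium_shift_integral:
  assumes "f \<in> borel_measurable code_borel"
  shows "(\<integral>\<^sup>+\<sigma>. f (shift \<sigma>) \<partial>\<Lambda>) = (\<integral>\<^sup>+\<sigma>. f \<sigma> \<partial>\<Lambda>)"
proof -
  note sets[measurable_cong] = equilibriumD(2)
  have "(\<integral>\<^sup>+\<sigma>. f \<sigma> \<partial>distr \<Lambda> code_borel shift) = (\<integral>\<^sup>+\<sigma>. f (shift \<sigma>) \<partial>\<Lambda>)"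
    using assms by (intro nn_integral_distr) (measurable, auto)
  then show ?thesis by (simp add: equilibriumD(3))
qed

lemma equilibrium_cylinder_shift: "emeasure \<Lambda> (cylinder m es) = emeasure \<Lambda> (cylinder 1 es)"
proof -
  note sets[measurable_cong] = equilibriumD(2)
  have one: "emeasure \<Lambda> (cylinder (k + 1) es) = emeasure \<Lambda> (cylinder k es)" for k
  proof -
    have "(\<integral>\<^sup>+\<sigma>. indicator (cylinder k es) (shift \<sigma>) \<partial>\<Lambda>) = (\<integral>\<^sup>+\<sigma>. indicator (cylinder k es) \<sigma> \<partial>\<Lambda>)"
      by (rule equilibrium_shift_integral) measurable
    moreover have "(\<lambda>\<sigma>. indicator (cylinder k es) (shift \<sigma>)) = (indicator (cylinder (k + 1) es) :: _ \<Rightarrow> ennreal)"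
      using shift_cylinder[of k es] by (auto simp: fun_eq_iff indicator_def)
    ultimately show ?thesis by (simp add: sets)
  qed
  show ?thesis
  proof (induction m rule: int_induct[where k = 1])
    case (step1 i) then show ?case using one[of i] by simp
  next
    case (step2 i) then show ?case using one[of "i - 1"] by simp
  qed simp
qed

text \<open>
  Induction on the future word \<open>es\<close>: its first letter is absorbed into the past word \<open>u\<close> by the
  equilibrium property, and shifting brings the enlarged past word back into the past.
\<close>

lemma equilibrium_cylinder:
  "(\<integral>\<^sup>+\<sigma>. indicator (cylinder (1 - int (length u)) u) \<sigma> * ennreal (path_prob M es (coding M xs \<sigma>)) \<partial>\<Lambda>)
    = emeasure \<Lambda> (cylinder 1 (u @ es))"
proof (induction es arbitrary: u)
  case Nil
  show ?case using equilibrium_cylinder_shift[of "1 - int (length u)" u] by (simp add: equilibriumD(2))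
next
  case (Cons e es)
  note sets[measurable_cong] = equilibriumD(2)
  have [measurable]: "past_coding \<in> code_borel \<rightarrow>\<^sub>M borel" by (rule measurable_from_past) measurable
  let ?u = "cylinder (1 - int (length u)) u"
  have u_past: "?u \<in> sets past"
  proof (cases u)
    case Nil then show ?thesis using sets.top[of "past :: (int \<Rightarrow> 'e option) measure"] by (simp add: cylinder_def)
  next
    case (Cons c cs)
    have "?u = (\<lambda>\<sigma>. map \<sigma> [- int (length cs)..0]) -` {u}" by (auto simp: cylinder_eq_window Cons)
    then show ?thesis unfolding sets_past by (intro sigma_sets.Basic) auto
  qed
  let ?g = "\<lambda>\<sigma>. indicator ?u \<sigma> * path_prob M es (wmap_opt M e (past_coding \<sigma>)) :: real"
  have gm: "?g \<in> borel_measurable past" using u_past by measurable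
  have "(\<integral>\<^sup>+\<sigma>. indicator ?u \<sigma> * ennreal (path_prob M (e # es) (coding M xs \<sigma>)) \<partial>\<Lambda>)
    = (\<integral>\<^sup>+\<sigma>. ennreal (?g \<sigma>) * ennreal (wprob_opt M e (coding M xs \<sigma>)) \<partial>\<Lambda>)"
    using equilibrium_past_coding
    by (intro nn_integral_cong_AE) (auto elim!: eventually_mono simp: indicator_def ennreal_mult' mult.commute)
  also have "\<dots> = (\<integral>\<^sup>+\<sigma>. ennreal (?g \<sigma>) * indicator (cylinder 1 [e]) \<sigma> \<partial>\<Lambda>)"
    by (rule equilibrium_next_letter[OF gm, symmetric]) (auto simp: indicator_def path_prob_le_1)
  also have "\<dots> = (\<integral>\<^sup>+\<sigma>. (\<lambda>\<tau>. indicator (cylinder (1 - int (length (u @ [e]))) (u @ [e])) \<tau> * ennreal (path_prob M es (coding M xs \<tau>))) (shift \<sigma>) \<partial>\<Lambda>)"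
  proof (rule nn_integral_cong_AE)
    show "AE \<sigma> in \<Lambda>. ennreal (?g \<sigma>) * indicator (cylinder 1 [e]) \<sigma>
      = (\<lambda>\<tau>. indicator (cylinder (1 - int (length (u @ [e]))) (u @ [e])) \<tau> * ennreal (path_prob M es (coding M xs \<tau>))) (shift \<sigma>)"
      using equilibrium_coding_shift equilibrium_past_coding
    proof eventually_elim
      case (elim \<sigma>)
      have iff: "shift \<sigma> \<in> cylinder (1 - int (length (u @ [e]))) (u @ [e]) \<longleftrightarrow> \<sigma> \<in> ?u \<and> \<sigma> \<in> cylinder 1 [e]"
        using cylinder_snoc_shift[of u e] by blast
      have "\<sigma> \<in> cylinder 1 [e] \<Longrightarrow> \<sigma> 1 = e" by (simp add: cylinder_def)
      then show ?case using elim iff by (auto simp: indicator_def)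
    qed
  qed
  also have "\<dots> = (\<integral>\<^sup>+\<tau>. indicator (cylinder (1 - int (length (u @ [e]))) (u @ [e])) \<tau> * ennreal (path_prob M es (coding M xs \<tau>)) \<partial>\<Lambda>)"
    by (rule equilibrium_shift_integral) measurable
  also have "\<dots> = emeasure \<Lambda> (cylinder 1 ((u @ [e]) @ es))" by (rule Cons.IH)
  finally show ?case by simp
qed

lemma equilibrium_in_Phi_image: "\<Lambda> \<in> Phi M ` invariant_measures M"
proof -
  note sets[measurable_cong] = equilibriumD(2)
  have [measurable]: "past_coding \<in> code_borel \<rightarrow>\<^sub>M borel" by (rule measurable_from_past) measurable
  define \<mu> where "\<mu> = distr \<Lambda> borel (coding M xs)"
  have int\<mu>: "(\<integral>\<^sup>+x. f x \<partial>\<mu>) = (\<integral>\<^sup>+\<sigma>. f (coding M xs \<sigma>) \<partial>\<Lambda>)" if "f \<in> borel_measurable borel" for f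
    unfolding \<mu>_def using that by (intro nn_integral_distr) (measurable, auto)
  have mass: "word_mass \<mu> es = emeasure \<Lambda> (cylinder m es)" for es m
  proof -
    have "word_mass \<mu> es = (\<integral>\<^sup>+\<sigma>. ennreal (path_prob M es (coding M xs \<sigma>)) \<partial>\<Lambda>)"
      unfolding word_mass_def by (rule int\<mu>) measurable
    also have "\<dots> = emeasure \<Lambda> (cylinder 1 es)"
      using equilibrium_cylinder[of "[]" es] by (simp add: cylinder_def)
    finally show ?thesis using equilibrium_cylinder_shift[of m es] by simp
  qed
  have prob: "prob_space \<mu>"
    unfolding \<mu>_def by (intro prob_space.prob_space_distr equilibriumD(1)) measurable
  have sets\<mu>: "sets \<mu> = sets borel" by (simp add: \<mu>_def)
  have "dual_op M \<mu> = \<mu>"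
  proof (rule measure_eqI)
    have "sigma_sets UNIV (sets (borel :: 'k measure)) = sets borel"
      using sets.sigma_sets_eq[of "borel :: 'k measure"] by simp
    then show sets_dual: "sets (dual_op M \<mu>) = sets \<mu>"
      by (simp add: dual_op_def sets\<mu> sets_measure_of)
    fix A assume "A \<in> sets (dual_op M \<mu>)"
    then have A[measurable]: "A \<in> sets borel" using sets_dual sets\<mu> by simp
    have mop: "(\<lambda>x. markov_op M (indicator A) x) \<in> borel_measurable borel"
      unfolding markov_op_eq by (rule borel_measurable_nn_integral_count_space) measurable
    have "emeasure (dual_op M \<mu>) A = (\<integral>\<^sup>+x. indicator A x \<partial>dual_op M \<mu>)"
      using sets_dual sets\<mu> by simp
    also have "\<dots> = (\<integral>\<^sup>+x. markov_op M (indicator A) x \<partial>\<mu>)"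
      by (rule nn_integral_dual_op[OF system sets\<mu>]) measurable
    also have "\<dots> = (\<integral>\<^sup>+\<sigma>. markov_op M (indicator A) (coding M xs \<sigma>) \<partial>\<Lambda>)"
      by (rule int\<mu>[OF mop])
    also have "\<dots> = (\<integral>\<^sup>+e. (\<integral>\<^sup>+\<sigma>. ennreal (wprob_opt M e (coding M xs \<sigma>)) * indicator A (wmap_opt M e (coding M xs \<sigma>)) \<partial>\<Lambda>) \<partial>count_space UNIV)"
      unfolding markov_op_eq by (rule nn_integral_count_space_nn_integral) auto
    also have "\<dots> = (\<integral>\<^sup>+e. (\<integral>\<^sup>+\<sigma>. indicator A (coding M xs (shift \<sigma>)) * indicator {e} (\<sigma> 1) \<partial>\<Lambda>) \<partial>count_space UNIV)"
    proof (rule nn_integral_cong)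
      fix e :: "'e option"
      let ?g = "\<lambda>\<sigma>. indicator A (wmap_opt M e (past_coding \<sigma>)) :: real"
      have gm: "?g \<in> borel_measurable past" by measurable
      have "(\<integral>\<^sup>+\<sigma>. ennreal (wprob_opt M e (coding M xs \<sigma>)) * indicator A (wmap_opt M e (coding M xs \<sigma>)) \<partial>\<Lambda>)
        = (\<integral>\<^sup>+\<sigma>. ennreal (?g \<sigma>) * ennreal (wprob_opt M e (coding M xs \<sigma>)) \<partial>\<Lambda>)"
        using equilibrium_past_coding
        by (intro nn_integral_cong_AE) (auto elim!: eventually_mono simp: indicator_def)
      also have "\<dots> = (\<integral>\<^sup>+\<sigma>. ennreal (?g \<sigma>) * indicator (cylinder 1 [e]) \<sigma> \<partial>\<Lambda>)"
        by (rule equilibrium_next_letter[OF gm, symmetric]) auto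
      also have "\<dots> = (\<integral>\<^sup>+\<sigma>. indicator A (coding M xs (shift \<sigma>)) * indicator {e} (\<sigma> 1) \<partial>\<Lambda>)"
      proof (rule nn_integral_cong_AE)
        show "AE \<sigma> in \<Lambda>. ennreal (?g \<sigma>) * indicator (cylinder 1 [e]) \<sigma> = indicator A (coding M xs (shift \<sigma>)) * indicator {e} (\<sigma> 1)"
          using equilibrium_coding_shift equilibrium_past_coding
          by eventually_elim (auto simp: indicator_def cylinder_def)
      qed
      finally show "(\<integral>\<^sup>+\<sigma>. ennreal (wprob_opt M e (coding M xs \<sigma>)) * indicator A (wmap_opt M e (coding M xs \<sigma>)) \<partial>\<Lambda>)
        = (\<integral>\<^sup>+\<sigma>. indicator A (coding M xs (shift \<sigma>)) * indicator {e} (\<sigma> 1) \<partial>\<Lambda>)" .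
    qed
    also have "\<dots> = (\<integral>\<^sup>+\<sigma>. (\<integral>\<^sup>+e. indicator A (coding M xs (shift \<sigma>)) * indicator {e} (\<sigma> 1) \<partial>count_space UNIV) \<partial>\<Lambda>)"
      by (rule nn_integral_count_space_nn_integral[symmetric]) auto
    also have "\<dots> = (\<integral>\<^sup>+\<sigma>. indicator A (coding M xs (shift \<sigma>)) \<partial>\<Lambda>)"
    proof (rule nn_integral_cong)
      fix \<sigma> :: "int \<Rightarrow> 'e option"
      have "(\<integral>\<^sup>+e. indicator {e} (\<sigma> 1) \<partial>count_space UNIV) = (\<integral>\<^sup>+e. indicator {\<sigma> 1} e \<partial>count_space UNIV)"
        by (intro nn_integral_cong) (auto simp: indicator_def)
      also have "\<dots> = 1" by simp
      finally show "(\<integral>\<^sup>+e. indicator A (coding M xs (shift \<sigma>)) * indicator {e} (\<sigma> 1) \<partial>count_space UNIV) = (indicator A (coding M xs (shift \<sigma>)) :: ennreal)"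
        by (simp add: nn_integral_cmult)
    qed
    also have "\<dots> = (\<integral>\<^sup>+\<sigma>. indicator A (coding M xs \<sigma>) \<partial>\<Lambda>)"
      by (rule equilibrium_shift_integral[where f = "\<lambda>\<sigma>. indicator A (coding M xs \<sigma>)"]) measurable
    also have "\<dots> = (\<integral>\<^sup>+x. indicator A x \<partial>\<mu>)" by (rule int\<mu>[symmetric]) measurable
    also have "\<dots> = emeasure \<mu> A" using A sets\<mu> by simp
    finally show "emeasure (dual_op M \<mu>) A = emeasure \<mu> A" .
  qed
  then have "\<mu> \<in> invariant_measures M"
    using prob sets\<mu> by (simp add: invariant_measures_def borel_prob_def)
  moreover have "Phi M \<mu> = \<Lambda>"
    by (rule Phi_eqI[OF equilibriumD(1,2)]) (rule mass[symmetric])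
  ultimately show ?thesis by auto
qed

end

section \<open>The one-sided path measure\<close>

lemma path_measure_cylinder:
  assumes "es \<noteq> []"
  shows "emeasure (path_measure M x) (cylinder_plus es) = ennreal (path_prob M es x)"
proof -
  let ?Q = "\<lambda>P :: (nat \<Rightarrow> 'e option) measure. prob_space P \<and> sets P = sets code_borel \<and>
    (\<forall>es. es \<noteq> [] \<longrightarrow> emeasure P (cylinder_plus es) = ennreal (path_prob M es x))"
  have "\<exists>P. prob_space P \<and> sets P = sets code_borel \<and> (\<forall>es. emeasure P (cylinder_plus es) = ennreal (path_prob M es x))"
    by (rule one_sided_measure) (simp_all add: path_prob_append ennreal_mult' nn_integral_cmult sum_wprob_opt)
  then obtain P where P: "?Q P" by blast
  have unique: "P' = P" if P': "?Q P'" for P'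
  proof (rule measure_eqI_nested[where X = "\<lambda>n \<sigma>. map \<sigma> [0..<Suc n]"])
    have "sets (code_borel :: (nat \<Rightarrow> 'e option) measure) = sigma_sets UNIV {(\<lambda>\<sigma>. map \<sigma> [0..<Suc n]) -` {c} |n c. True}"
      unfolding sets_code_borel
    proof (rule sets_PiM_windows)
      show "\<exists>n. i \<in> set [0..<Suc n]" for i by (rule exI[of _ i]) auto
    qed
    then show "sets P' = sigma_sets UNIV {(\<lambda>\<sigma>. map \<sigma> [0..<Suc n]) -` {c} |n c. True}"
      and "sets P = sigma_sets UNIV {(\<lambda>\<sigma>. map \<sigma> [0..<Suc n]) -` {c} |n c. True}"
      using P P' by auto
    show "finite_measure P'" using P' by (simp add: prob_space.axioms)
    show "map \<sigma> [0..<Suc n] = map \<tau> [0..<Suc n]" if "map \<sigma> [0..<Suc (Suc n)] = map \<tau> [0..<Suc (Suc n)]"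
      for n and \<sigma> \<tau> :: "nat \<Rightarrow> 'e option"
      using that by simp
    fix n and c :: "'e option list"
    show "emeasure P' ((\<lambda>\<sigma>. map \<sigma> [0..<Suc n]) -` {c}) = emeasure P ((\<lambda>\<sigma>. map \<sigma> [0..<Suc n]) -` {c})"
    proof (cases "length c = Suc n")
      case True
      then have "(\<lambda>\<sigma>. map \<sigma> [0..<Suc n]) -` {c} = cylinder_plus c"
        by (simp add: cylinder_plus_def vimage_def map_eq_iff_nth del: upt_Suc)
      moreover have "c \<noteq> []" using True by auto
      ultimately show ?thesis using P P' by simp
    next
      case False
      then have "(\<lambda>\<sigma>. map \<sigma> [0..<Suc n]) -` {c} = {}" by auto
      then show ?thesis by simp
    qed
  qed
  have "path_measure M x = P"
    unfolding path_measure_def by (rule the_equality[where P = ?Q, OF P unique])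
  then show ?thesis using P assms by simp
qed

lemma path_prob_is_path:
  assumes "path_prob M w x \<noteq> 0"
  shows "\<exists>es. w = map Some es \<and> is_path M es \<and> (es \<noteq> [] \<longrightarrow> vertex x = ini M (hd es))"
  using assms
proof (induction w arbitrary: x)
  case Nil then show ?case by (simp add: is_path_def)
next
  case (Cons o' w)
  then have nz: "wprob_opt M o' x \<noteq> 0" "path_prob M w (wmap_opt M o' x) \<noteq> 0" by auto
  obtain e where e: "o' = Some e" using wprob_opt_supported(1)[OF nz(1)] by auto
  obtain es where es: "w = map Some es" "is_path M es" "es \<noteq> [] \<longrightarrow> vertex (wmap_opt M o' x) = ini M (hd es)"
    using Cons.IH[OF nz(2)] by auto
  have "vertex (wmap_opt M o' x) = ter M e" "vertex x = ini M e"
    using vertex_wmap_opt[OF wprob_opt_supported[OF nz(1)]] wprob_opt_supported(2)[OF nz(1)] e by auto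
  moreover have "is_path M (e # es)"
    unfolding is_path_def
  proof (intro allI impI)
    fix k assume k: "Suc k < length (e # es)"
    show "ini M ((e # es) ! Suc k) = ter M ((e # es) ! k)"
    proof (cases k)
      case 0
      then have "es \<noteq> []" using k by auto
      then show ?thesis using 0 es(3) \<open>vertex (wmap_opt M o' x) = ter M e\<close> by (simp add: hd_conv_nth)
    next
      case (Suc k') then show ?thesis using es(2) k by (simp add: is_path_def)
    qed
  qed
  ultimately show ?case using es e by (intro exI[of _ "e # es"]) auto
qed

section \<open>Averaged orbits\<close>

text \<open>
  The value at \<open>x\<close> of the \<open>k\<close>-th iterate of the Markov operator at \<open>f\<close>.
\<close>

definition orbit_mean :: "'k \<Rightarrow> nat \<Rightarrow> ('k \<Rightarrow> ennreal) \<Rightarrow> ennreal" where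
  "orbit_mean x k f = path_sum M k (\<lambda>es. f (path_map M es x)) x"

text \<open>
  The Cesaro mean of the iterates \<open>1, \<dots>, n + 1\<close> of the dual operator at the Dirac measure of \<open>x\<close>.
  Realizing it as the image of a measure on words makes its integrals finite sums of path sums.
\<close>

definition averaged_law :: "'k \<Rightarrow> nat \<Rightarrow> 'k measure" where
  "averaged_law x n = distr
     (density (count_space UNIV) (\<lambda>es. \<Sum>k=1..Suc n. ennreal (1 / real (Suc n)) * (ennreal (path_prob M es x) * indicator (words k) es)))
     borel (\<lambda>es. path_map M es x)"

lemma sets_averaged_law [simp, measurable_cong]: "sets (averaged_law x n) = sets borel"
  by (simp add: averaged_law_def)

lemma nn_integral_averaged_law:
  assumes "f \<in> borel_measurable borel"
  shows "(\<integral>\<^sup>+y. f y \<partial>averaged_law x n) = ennreal (1 / real (Suc n)) * (\<Sum>k=1..Suc n. orbit_mean x k f)"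
proof -
  have "(\<integral>\<^sup>+y. f y \<partial>averaged_law x n)
    = (\<integral>\<^sup>+es. (\<Sum>k=1..Suc n. ennreal (1 / real (Suc n)) * (ennreal (path_prob M es x) * indicator (words k) es)) * f (path_map M es x) \<partial>count_space UNIV)"
    unfolding averaged_law_def using assms
    by (subst nn_integral_distr) (auto simp: nn_integral_density)
  also have "\<dots> = (\<integral>\<^sup>+es. (\<Sum>k=1..Suc n. ennreal (1 / real (Suc n)) * (ennreal (path_prob M es x) * f (path_map M es x) * indicator (words k) es)) \<partial>count_space UNIV)"
    unfolding sum_distrib_right by (intro nn_integral_cong sum.cong refl) (simp only: ac_simps)
  also have "\<dots> = (\<Sum>k=1..Suc n. \<integral>\<^sup>+es. ennreal (1 / real (Suc n)) * (ennreal (path_prob M es x) * f (path_map M es x) * indicator (words k) es) \<partial>count_space UNIV)"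
    by (rule nn_integral_sum) auto
  also have "\<dots> = (\<Sum>k=1..Suc n. ennreal (1 / real (Suc n)) * orbit_mean x k f)"
    by (intro sum.cong refl)
       (simp add: nn_integral_cmult orbit_mean_def path_sum_def nn_integral_count_space_indicator)
  finally show ?thesis by (simp only: sum_distrib_left)
qed

lemma orbit_mean_const: "orbit_mean x k (\<lambda>_. c) = c"
  by (simp add: orbit_mean_def path_sum_const)

lemma orbit_mean_mono: "(\<And>y. f y \<le> g y) \<Longrightarrow> orbit_mean x k f \<le> orbit_mean x k g"
  unfolding orbit_mean_def by (rule path_sum_mono)

lemma orbit_mean_path_sum:
  "orbit_mean x k (\<lambda>y. path_sum M l (\<lambda>es. f (path_map M es y)) y) = orbit_mean x (k + l) f"
  unfolding orbit_mean_def path_sum_append by (simp add: path_map_append)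

lemma orbit_mean_markov_op: "orbit_mean x k (markov_op M f) = orbit_mean x (Suc k) f"
  using orbit_mean_path_sum[of x k 1 f] by (simp add: path_sum_Suc_markov_op)

lemma inverse_mult_const_sum: "ennreal (1 / real (Suc n)) * (\<Sum>k=1..Suc n. c) = c"
proof -
  have "ennreal (1 / real (Suc n)) * of_nat (Suc n) = ennreal (1 / real (Suc n)) * ennreal (real (Suc n))"
    by (simp only: ennreal_of_nat_eq_real_of_nat)
  also have "\<dots> = ennreal (1 / real (Suc n) * real (Suc n))" by (rule ennreal_mult[symmetric]) auto
  also have "\<dots> = 1" by simp
  finally have "ennreal (1 / real (Suc n)) * of_nat (Suc n) * c = c" by simp
  moreover have "(\<Sum>k=1..Suc n. c) = of_nat (Suc n) * c" by (simp del: of_nat_Suc)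
  ultimately show ?thesis by (simp only: mult.assoc)
qed

lemma prob_space_averaged_law: "prob_space (averaged_law x n)"
proof
  have "emeasure (averaged_law x n) (space (averaged_law x n)) = (\<integral>\<^sup>+y. 1 \<partial>averaged_law x n)" by simp
  also have "\<dots> = 1"
    by (subst nn_integral_averaged_law) (simp_all only: orbit_mean_const inverse_mult_const_sum, simp)
  finally show "emeasure (averaged_law x n) (space (averaged_law x n)) = 1" .
qed

lemma averaged_law_gap_bounded: "gap_bounded (averaged_law x n) (gap x + b / (1 - a))"
  unfolding gap_bounded_def
proof (intro conjI allI)
  show "prob_space (averaged_law x n)" by (rule prob_space_averaged_law)
  show "0 \<le> gap x + b / (1 - a)" using stationary_gap_nonneg by simp
  fix l
  have "(\<integral>\<^sup>+y. path_sum M l (\<lambda>es. ennreal (gap (path_map M es y))) y \<partial>averaged_law x n)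
    = ennreal (1 / real (Suc n)) * (\<Sum>k=1..Suc n. orbit_mean x (k + l) (\<lambda>y. ennreal (gap y)))"
    using measurable_path_sum_fun[of "\<lambda>y. ennreal (gap y)" l]
    by (subst nn_integral_averaged_law) (simp_all add: orbit_mean_path_sum[of x _ l "\<lambda>y. ennreal (gap y)"])
  also have "\<dots> \<le> ennreal (1 / real (Suc n)) * (\<Sum>k=1..Suc n. ennreal (gap x + b / (1 - a)))"
  proof (intro mult_left_mono sum_mono)
    fix k
    have "orbit_mean x (k + l) (\<lambda>y. ennreal (gap y)) \<le> ennreal (a ^ (k + l) * gap x + b / (1 - a))"
      unfolding orbit_mean_def by (rule drift_path_sum)
    also have "\<dots> \<le> ennreal (gap x + b / (1 - a))"
      using a_pos a_less_1 by (intro ennreal_leI add_right_mono) (simp add: mult_left_le_one_le power_le_one)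
    finally show "orbit_mean x (k + l) (\<lambda>y. ennreal (gap y)) \<le> ennreal (gap x + b / (1 - a))" .
  qed simp
  also have "\<dots> = ennreal (gap x + b / (1 - a))" by (rule inverse_mult_const_sum)
  finally show "(\<integral>\<^sup>+y. path_sum M l (\<lambda>es. ennreal (gap (path_map M es y))) y \<partial>averaged_law x n) \<le> ennreal (gap x + b / (1 - a))" .
qed simp

text \<open>
  Shifting the window of averaging by \<open>l\<close> leaves it inside the window of length \<open>n + 1 + l\<close>, whose mean
  has a weight smaller by the factor \<open>l + 1\<close> at most.
\<close>

lemma averaged_law_path_sum_le:
  assumes f: "f \<in> borel_measurable borel"
  shows "(\<integral>\<^sup>+y. path_sum M l (\<lambda>es. f (path_map M es y)) y \<partial>averaged_law x n)
    \<le> ennreal (real (Suc l)) * (\<integral>\<^sup>+y. f y \<partial>averaged_law x (n + l))"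
proof -
  have "(\<integral>\<^sup>+y. path_sum M l (\<lambda>es. f (path_map M es y)) y \<partial>averaged_law x n)
    = ennreal (1 / real (Suc n)) * (\<Sum>k=1..Suc n. orbit_mean x (k + l) f)"
    by (subst nn_integral_averaged_law[OF measurable_path_sum_fun[OF f]]) (simp add: orbit_mean_path_sum)
  also have "(\<Sum>k=1..Suc n. orbit_mean x (k + l) f) = (\<Sum>k=1+l..Suc n+l. orbit_mean x k f)"
    by (rule sum.shift_bounds_cl_nat_ivl[symmetric])
  also have "\<dots> \<le> (\<Sum>k=1..Suc (n + l). orbit_mean x k f)"
    by (rule sum_mono2) auto
  also have "ennreal (1 / real (Suc n)) * \<dots> \<le> (ennreal (real (Suc l)) * ennreal (1 / real (Suc (n + l)))) * \<dots>"
  proof (rule mult_right_mono)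
    have "real (Suc (n + l)) \<le> real (Suc l) * real (Suc n)" by (simp add: algebra_simps)
    then have "1 / real (Suc n) \<le> real (Suc l) * (1 / real (Suc (n + l)))"
      by (simp add: field_simps)
    then have "ennreal (1 / real (Suc n)) \<le> ennreal (real (Suc l) * (1 / real (Suc (n + l))))" by (rule ennreal_leI)
    also have "\<dots> = ennreal (real (Suc l)) * ennreal (1 / real (Suc (n + l)))" by (rule ennreal_mult) auto
    finally show "ennreal (1 / real (Suc n)) \<le> ennreal (real (Suc l)) * ennreal (1 / real (Suc (n + l)))" .
  qed simp
  also have "\<dots> = ennreal (real (Suc l)) * (\<integral>\<^sup>+y. f y \<partial>averaged_law x (n + l))"
    by (simp add: nn_integral_averaged_law[OF f] mult.assoc)
  finally show ?thesis by (simp add: mult_left_mono)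
qed

text \<open>
  The two means differ in the first and the last summand only.
\<close>

lemma averaged_law_almost_invariant:
  assumes f: "f \<in> borel_measurable borel" "\<And>y. f y \<le> 1"
  shows "(\<integral>\<^sup>+y. markov_op M f y \<partial>averaged_law x n) \<le> (\<integral>\<^sup>+y. f y \<partial>averaged_law x n) + ennreal (1 / real (Suc n))"
    and "(\<integral>\<^sup>+y. f y \<partial>averaged_law x n) \<le> (\<integral>\<^sup>+y. markov_op M f y \<partial>averaged_law x n) + ennreal (1 / real (Suc n))"
proof -
  let ?U = "\<lambda>k. orbit_mean x k f" and ?c = "ennreal (1 / real (Suc n))"
  have m: "markov_op M f \<in> borel_measurable borel"
    using measurable_path_sum_fun[OF f(1), of 1] by (simp add: path_sum_Suc_markov_op)
  have le1: "?U k \<le> 1" for k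
    using orbit_mean_mono[of f "\<lambda>_. 1" x k] f(2) by (simp add: orbit_mean_const)
  have "(\<Sum>k=1..Suc n. ?U (Suc k)) = (\<Sum>k=Suc 1..Suc (Suc n). ?U k)"
    by (rule sum.shift_bounds_cl_Suc_ivl[symmetric])
  also have "\<dots> = (\<Sum>k=Suc 1..Suc n. ?U k) + ?U (Suc (Suc n))"
    by (subst sum.cl_ivl_Suc) simp
  finally have shift: "(\<Sum>k=1..Suc n. ?U (Suc k)) = (\<Sum>k=Suc 1..Suc n. ?U k) + ?U (Suc (Suc n))" .
  have head: "(\<Sum>k=1..Suc n. ?U k) = ?U 1 + (\<Sum>k=Suc 1..Suc n. ?U k)"
    by (rule sum.atLeast_Suc_atMost) simp
  have "(\<Sum>k=1..Suc n. ?U (Suc k)) \<le> (\<Sum>k=1..Suc n. ?U k) + 1"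
    unfolding shift head using le1[of "Suc (Suc n)"] by (intro add_mono) (simp_all add: add_increasing)
  then have "?c * (\<Sum>k=1..Suc n. ?U (Suc k)) \<le> ?c * ((\<Sum>k=1..Suc n. ?U k) + 1)" by (rule mult_left_mono) simp
  then show "(\<integral>\<^sup>+y. markov_op M f y \<partial>averaged_law x n) \<le> (\<integral>\<^sup>+y. f y \<partial>averaged_law x n) + ?c"
    unfolding nn_integral_averaged_law[OF m] nn_integral_averaged_law[OF f(1)] orbit_mean_markov_op
    by (simp add: distrib_left)
  have "(\<Sum>k=1..Suc n. ?U k) \<le> (\<Sum>k=1..Suc n. ?U (Suc k)) + 1"
    unfolding shift head using le1[of 1]
    by (metis add.commute add_mono le_iff_add order_refl)
  then have "?c * (\<Sum>k=1..Suc n. ?U k) \<le> ?c * ((\<Sum>k=1..Suc n. ?U (Suc k)) + 1)" by (rule mult_left_mono) simp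
  then show "(\<integral>\<^sup>+y. f y \<partial>averaged_law x n) \<le> (\<integral>\<^sup>+y. markov_op M f y \<partial>averaged_law x n) + ?c"
    unfolding nn_integral_averaged_law[OF m] nn_integral_averaged_law[OF f(1)] orbit_mean_markov_op
    by (simp add: distrib_left)
qed

lemma nn_integral_dual_op_power:
  assumes "f \<in> borel_measurable borel"
  shows "sets ((dual_op M ^^ k) (return borel x)) = sets borel"
    "(\<integral>\<^sup>+y. f y \<partial>(dual_op M ^^ k) (return borel x)) = orbit_mean x k f"
proof -
  have s: "sets (dual_op M \<nu>) = sets borel" for \<nu> :: "'k measure"
    using sets.sigma_sets_eq[of "borel :: 'k measure"] by (simp add: dual_op_def sets_measure_of)
  have sk: "sets ((dual_op M ^^ k) (return borel x)) = sets borel" for k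
    by (cases k) (simp_all add: s)
  show "sets ((dual_op M ^^ k) (return borel x)) = sets borel" by (rule sk)
  show "(\<integral>\<^sup>+y. f y \<partial>(dual_op M ^^ k) (return borel x)) = orbit_mean x k f"
    using assms
  proof (induction k arbitrary: f)
    case 0 then show ?case by (simp add: nn_integral_return orbit_mean_def)
  next
    case (Suc k)
    have "markov_op M f \<in> borel_measurable borel"
      using measurable_path_sum_fun[OF Suc.prems, of 1] by (simp add: path_sum_Suc_markov_op)
    from Suc.IH[OF this] show ?case
      using nn_integral_dual_op[OF system sk Suc.prems] by (simp add: orbit_mean_markov_op)
  qed
qed

lemma emeasure_occupation:
  assumes V: "V \<subseteq> vert M"
  shows "emeasure (occupation M x (Suc n)) (vert M - V) = emeasure (averaged_law x n) {y. vertex y \<notin> V}"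
proof -
  have cell: "cell M j \<in> sets borel" if "j \<in> vert M" for j
    using system that by (simp add: countable_markov_system_def)
  have weight: "ennreal (1 / real (Suc n)) * (\<Sum>k=1..Suc n. emeasure ((dual_op M ^^ k) (return borel x)) (cell M j))
    = emeasure (averaged_law x n) (cell M j)" if j: "j \<in> vert M" for j
  proof -
    have "emeasure ((dual_op M ^^ k) (return borel x)) (cell M j) = orbit_mean x k (indicator (cell M j))" for k
      using nn_integral_dual_op_power[of "indicator (cell M j)" k x] cell[OF j] by simp
    moreover have "emeasure (averaged_law x n) (cell M j) = ennreal (1 / real (Suc n)) * (\<Sum>k=1..Suc n. orbit_mean x k (indicator (cell M j)))"
      using nn_integral_averaged_law[of "indicator (cell M j)" x n] cell[OF j] by simp
    ultimately show ?thesis by simp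
  qed
  have "emeasure (occupation M x (Suc n)) (vert M - V)
    = (\<integral>\<^sup>+j. ennreal (1 / real (Suc n)) * (\<Sum>k=1..Suc n. emeasure ((dual_op M ^^ k) (return borel x)) (cell M j)) * indicator (vert M - V) j \<partial>count_space (vert M))"
    unfolding occupation_def point_measure_def by (subst emeasure_density) auto
  also have "\<dots> = (\<integral>\<^sup>+j. emeasure (averaged_law x n) (cell M j) * indicator (vert M - V) j \<partial>count_space (vert M))"
    by (intro nn_integral_cong) (simp only: weight space_count_space)
  also have "\<dots> = (\<integral>\<^sup>+j. emeasure (averaged_law x n) (cell M j) \<partial>count_space (vert M - V))"
    by (subst (1 2) nn_integral_count_space_indicator) (auto intro!: nn_integral_cong simp: indicator_def)
  also have "\<dots> = emeasure (averaged_law x n) (\<Union>j\<in>vert M - V. cell M j)"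
    using system cell
    by (intro emeasure_UN_countable[symmetric]) (auto simp: countable_markov_system_def disjoint_family_on_def)
  also have "(\<Union>j\<in>vert M - V. cell M j) = {y. vertex y \<notin> V}"
    using in_cell_iff vertex_in by auto
  finally show ?thesis .
qed

section \<open>Tightness of the letters\<close>

text \<open>
  The probability that the next letter lies outside \<open>B\<close>.
\<close>

definition tail_prob :: "'e option set \<Rightarrow> 'k \<Rightarrow> ennreal" where
  "tail_prob B x = (\<integral>\<^sup>+e. ennreal (wprob_opt M e x) * indicator (- B) e \<partial>count_space UNIV)"

lemma measurable_tail_prob [measurable]: "tail_prob B \<in> borel_measurable borel"
  unfolding tail_prob_def[abs_def] by (rule borel_measurable_nn_integral_count_space) measurable

lemma tail_prob_le_1: "tail_prob B x \<le> 1"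
  unfolding tail_prob_def sum_wprob_opt[of x, symmetric]
  by (intro nn_integral_mono) (simp add: indicator_def)

lemma cell_tail_prob:
  assumes dom: "dominating_chain M" and j: "j \<in> vert M" and "0 < \<epsilon>"
  shows "\<exists>B. finite B \<and> (\<forall>x. vertex x = j \<longrightarrow> tail_prob B x \<le> ennreal \<epsilon>)"
proof -
  let ?s = "\<lambda>e. (SUP x\<in>cell M j. ennreal (wprob M e x)) * indicator {e. ini M e = j} e"
  have "(\<integral>\<^sup>+e. ?s e \<partial>count_space UNIV) = (\<Sum>\<^sub>\<infinity>e\<in>{e. ini M e = j}. SUP x\<in>cell M j. ennreal (wprob M e x))"
    by (simp add: infsum_eq_nn_integral_count_space nn_integral_count_space_indicator)
  also have "\<dots> < \<infinity>" using dom j by (simp add: dominating_chain_def)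
  finally obtain B where B: "finite B" "(\<integral>\<^sup>+e. ?s e * indicator (- B) e \<partial>count_space UNIV) < ennreal \<epsilon>"
    using nn_integral_count_space_small_tail[OF _ \<open>0 < \<epsilon>\<close>, of ?s] by blast
  have "tail_prob (Some ` B) x \<le> ennreal \<epsilon>" if x: "vertex x = j" for x
  proof -
    have "tail_prob (Some ` B) x = (\<integral>\<^sup>+e. ennreal (wprob_opt M (Some e) x) * indicator (- Some ` B) (Some e) \<partial>count_space UNIV)"
      unfolding tail_prob_def by (rule nn_integral_count_space_option) simp
    also have "\<dots> \<le> (\<integral>\<^sup>+e. ?s e * indicator (- B) e \<partial>count_space UNIV)"
    proof (intro nn_integral_mono)
      fix e
      have xj: "x \<in> cell M j" using in_cell_iff[OF j] x by simp
      have ind: "indicator (- Some ` B) (Some e) = (indicator (- B) e :: ennreal)" by (auto simp: indicator_def)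
      have "ennreal (wprob_opt M (Some e) x) \<le> ?s e"
      proof (cases "ini M e = j")
        case True
        then show ?thesis using SUP_upper[OF xj, of "\<lambda>x. ennreal (wprob M e x)"] by simp
      next
        case False
        then have "wprob_opt M (Some e) x = 0" using wprob_opt_supported(2)[of "Some e" x] x by auto
        then show ?thesis by simp
      qed
      then show "ennreal (wprob_opt M (Some e) x) * indicator (- Some ` B) (Some e) \<le> ?s e * indicator (- B) e"
        unfolding ind by (rule mult_right_mono) simp
    qed
    finally show ?thesis using B(2) by simp
  qed
  then show ?thesis using B(1) by (intro exI[of _ "Some ` B"]) auto
qed

lemma tail_prob_antimono: "B \<subseteq> B' \<Longrightarrow> tail_prob B' x \<le> tail_prob B x"
  unfolding tail_prob_def by (intro nn_integral_mono mult_left_mono) (auto simp: indicator_def)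

text \<open>
  Up to \<open>\<epsilon> / 2\<close> the averaged laws charge finitely many cells only.  In each of these the dominating
  chain allows finitely many letters to be chosen that leave out at most \<open>\<epsilon> / 2\<close> of the
  probability, at all points of the cell at once.
\<close>

lemma letters_tight:
  assumes dom: "dominating_chain M" and tight: "uniformly_tight M x" and "0 < \<epsilon>"
  shows "\<exists>B. finite B \<and> (\<forall>n. (\<integral>\<^sup>+y. tail_prob B y \<partial>averaged_law x n) \<le> ennreal \<epsilon>)"
proof -
  obtain V where V: "V \<subseteq> vert M" "finite V"
    "\<And>n. n \<ge> 1 \<Longrightarrow> emeasure (occupation M x n) (vert M - V) < ennreal (\<epsilon> / 2)"
    using tight \<open>0 < \<epsilon>\<close> unfolding uniformly_tight_def by (metis half_gt_zero)
  have "\<forall>j\<in>V. \<exists>B. finite B \<and> (\<forall>x. vertex x = j \<longrightarrow> tail_prob B x \<le> ennreal (\<epsilon> / 2))"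
    using cell_tail_prob[OF dom] V(1) \<open>0 < \<epsilon>\<close> by auto
  then obtain C where C: "\<And>j. j \<in> V \<Longrightarrow> finite (C j)"
      "\<And>j x. j \<in> V \<Longrightarrow> vertex x = j \<Longrightarrow> tail_prob (C j) x \<le> ennreal (\<epsilon> / 2)"
    by metis
  let ?B = "\<Union>j\<in>V. C j"
  have le: "tail_prob ?B y \<le> ennreal (\<epsilon> / 2) + indicator {y. vertex y \<notin> V} y" for y
  proof (cases "vertex y \<in> V")
    case True
    have "tail_prob ?B y \<le> tail_prob (C (vertex y)) y" using True by (intro tail_prob_antimono) auto
    also have "\<dots> \<le> ennreal (\<epsilon> / 2)" using C(2)[OF True] by simp
    finally show ?thesis using True by simp
  next
    case False
    then show ?thesis using tail_prob_le_1[of ?B y] by (simp add: add_increasing)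
  qed
  have "(\<integral>\<^sup>+y. tail_prob ?B y \<partial>averaged_law x n) \<le> ennreal \<epsilon>" for n
  proof -
    interpret prob_space "averaged_law x n" by (rule prob_space_averaged_law)
    have [measurable]: "{y. vertex y \<notin> V} \<in> sets borel"
    proof -
      have "{y \<in> space borel. vertex y \<notin> V} \<in> sets borel" by measurable
      then show ?thesis by simp
    qed
    have "(\<integral>\<^sup>+y. tail_prob ?B y \<partial>averaged_law x n) \<le> (\<integral>\<^sup>+y. ennreal (\<epsilon> / 2) + indicator {y. vertex y \<notin> V} y \<partial>averaged_law x n)"
      by (intro nn_integral_mono le)
    also have "\<dots> = ennreal (\<epsilon> / 2) + emeasure (averaged_law x n) {y. vertex y \<notin> V}"
      by (subst nn_integral_add) (simp_all add: emeasure_space_1)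
    also have "\<dots> \<le> ennreal (\<epsilon> / 2) + ennreal (\<epsilon> / 2)"
      using V(3)[of "Suc n"] emeasure_occupation[OF V(1), of x n] by (intro add_left_mono) simp
    also have "\<dots> = ennreal \<epsilon>" using \<open>0 < \<epsilon>\<close> by (simp flip: ennreal_plus)
    finally show ?thesis .
  qed
  moreover have "finite ?B" using V(2) C(1) by auto
  ultimately show ?thesis by blast
qed

lemma word_mass_snoc_tail:
  assumes "length es = l"
  shows "(\<integral>\<^sup>+e. word_mass (averaged_law x n) (es @ [e]) * indicator (- B) e \<partial>count_space UNIV)
    \<le> ennreal (real (Suc l)) * (\<integral>\<^sup>+y. tail_prob B y \<partial>averaged_law x (n + l))"
proof -
  have "(\<integral>\<^sup>+e. word_mass (averaged_law x n) (es @ [e]) * indicator (- B) e \<partial>count_space UNIV)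
    = (\<integral>\<^sup>+e. (\<integral>\<^sup>+y. ennreal (path_prob M (es @ [e]) y) * indicator (- B) e \<partial>averaged_law x n) \<partial>count_space UNIV)"
    unfolding word_mass_def by (intro nn_integral_cong nn_integral_multc[symmetric]) measurable
  also have "\<dots> = (\<integral>\<^sup>+y. (\<integral>\<^sup>+e. ennreal (path_prob M (es @ [e]) y) * indicator (- B) e \<partial>count_space UNIV) \<partial>averaged_law x n)"
    by (rule nn_integral_count_space_nn_integral[symmetric]) auto
  also have "\<dots> = (\<integral>\<^sup>+y. ennreal (path_prob M es y) * tail_prob B (path_map M es y) \<partial>averaged_law x n)"
    by (intro nn_integral_cong)
       (simp add: tail_prob_def path_prob_append ennreal_mult' nn_integral_cmult[symmetric] mult.assoc)
  also have "\<dots> \<le> (\<integral>\<^sup>+y. path_sum M l (\<lambda>es. tail_prob B (path_map M es y)) y \<partial>averaged_law x n)"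
    unfolding path_sum_def using assms by (intro nn_integral_mono nn_integral_ge_point) simp
  also have "\<dots> \<le> ennreal (real (Suc l)) * (\<integral>\<^sup>+y. tail_prob B y \<partial>averaged_law x (n + l))"
    by (rule averaged_law_path_sum_le) measurable
  finally show ?thesis .
qed

lemma word_mass_Cons_tail:
  "(\<integral>\<^sup>+e. word_mass (averaged_law x n) (e # es) * indicator (- B) e \<partial>count_space UNIV)
    \<le> (\<integral>\<^sup>+y. tail_prob B y \<partial>averaged_law x n)"
proof -
  have "(\<integral>\<^sup>+e. word_mass (averaged_law x n) (e # es) * indicator (- B) e \<partial>count_space UNIV)
    = (\<integral>\<^sup>+e. (\<integral>\<^sup>+y. ennreal (path_prob M (e # es) y) * indicator (- B) e \<partial>averaged_law x n) \<partial>count_space UNIV)"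
    unfolding word_mass_def by (intro nn_integral_cong nn_integral_multc[symmetric]) measurable
  also have "\<dots> = (\<integral>\<^sup>+y. (\<integral>\<^sup>+e. ennreal (path_prob M (e # es) y) * indicator (- B) e \<partial>count_space UNIV) \<partial>averaged_law x n)"
    by (rule nn_integral_count_space_nn_integral[symmetric]) auto
  also have "\<dots> \<le> (\<integral>\<^sup>+y. tail_prob B y \<partial>averaged_law x n)"
    unfolding tail_prob_def
    by (intro nn_integral_mono mult_right_mono ennreal_leI) (simp_all add: path_prob_le_1 mult_left_le)
  finally show ?thesis .
qed

section \<open>Existence of an asymptotic state\<close>

text \<open>
  Tightness of the letters, at either end of a word, excludes a loss of mass in the limit of the word
  masses.  Consistency on the right holds already for the averaged laws, on the left only up to the
  error of almost invariance.
\<close>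

lemma asymptotic_state_exists:
  assumes dom: "dominating_chain M" and tight: "uniformly_tight M x"
  shows "\<exists>\<Lambda> r. strict_mono (r :: nat \<Rightarrow> nat) \<and> limit_state \<Lambda> (\<lambda>n. averaged_law x (r n)) (gap x + b / (1 - a))"
proof -
  let ?q = "\<lambda>n. word_mass (averaged_law x n)"
  have q1: "?q n es \<le> 1" for n es by (rule word_mass_le_1[OF prob_space_averaged_law])
  have "enn2real (?q n es) \<in> {0..1}" for n es
    using enn2real_mono[OF q1] by simp
  then obtain r l where r: "strict_mono (r :: nat \<Rightarrow> nat)" and l: "\<And>es. (\<lambda>n. enn2real (?q (r n) es)) \<longlonglongrightarrow> l es"
    using bounded_functions_convergent_subsequence[of "\<lambda>n es. enn2real (?q n es)"] by blast
  define q where "q es = ennreal (l es)" for es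
  have lim: "(\<lambda>n. ?q (r n) es) \<longlonglongrightarrow> q es" for es
  proof -
    have "ennreal (enn2real (?q n es)) = ?q n es" for n
      using q1[of n es] by (intro ennreal_enn2real) (auto simp: less_top[symmetric] top_unique intro: le_less_trans)
    then show ?thesis using tendsto_ennrealI[OF l[of es]] by (simp add: q_def)
  qed
  have lt: "\<exists>B. finite B \<and> (\<forall>n. (\<integral>\<^sup>+y. tail_prob B y \<partial>averaged_law x n) \<le> ennreal \<epsilon>)" if "0 < \<epsilon>" for \<epsilon>
    by (rule letters_tight[OF dom tight that])
  have one: "q [] = 1"
    using lim[of "[]"] by (simp add: word_mass_Nil[OF prob_space_averaged_law] LIMSEQ_const_iff)
  have right: "(\<integral>\<^sup>+e. q (es @ [e]) \<partial>count_space UNIV) = q es" for es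
  proof (rule nn_integral_tight_limit[where f = "\<lambda>n e. ?q (r n) (es @ [e])" and c = "\<lambda>n. ?q (r n) es" and d = "\<lambda>_. 0"])
    fix \<epsilon> :: real assume "0 < \<epsilon>"
    let ?l = "length es"
    have "0 < \<epsilon> / real (Suc ?l)" using \<open>0 < \<epsilon>\<close> by simp
    from lt[OF this] obtain B where B: "finite B" "\<And>n. (\<integral>\<^sup>+y. tail_prob B y \<partial>averaged_law x n) \<le> ennreal (\<epsilon> / real (Suc ?l))"
      by blast
    have "(\<integral>\<^sup>+e. ?q n (es @ [e]) * indicator (- B) e \<partial>count_space UNIV) \<le> ennreal \<epsilon>" for n
    proof -
      have "(\<integral>\<^sup>+e. ?q n (es @ [e]) * indicator (- B) e \<partial>count_space UNIV)
        \<le> ennreal (real (Suc ?l)) * ennreal (\<epsilon> / real (Suc ?l))"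
        by (rule order_trans[OF word_mass_snoc_tail[OF refl] mult_left_mono[OF B(2)]]) simp
      also have "\<dots> = ennreal (real (Suc ?l) * (\<epsilon> / real (Suc ?l)))" by (rule ennreal_mult'[symmetric]) simp
      finally show ?thesis by simp
    qed
    then show "\<exists>B. finite B \<and> (\<forall>n. (\<integral>\<^sup>+e. ?q (r n) (es @ [e]) * indicator (- B) e \<partial>count_space UNIV) \<le> ennreal \<epsilon>)"
      using B(1) by blast
  qed (simp_all add: lim word_mass_snoc)
  have left: "(\<integral>\<^sup>+e. q (e # es) \<partial>count_space UNIV) = q es" for es
  proof (rule nn_integral_tight_limit[where f = "\<lambda>n e. ?q (r n) (e # es)" and c = "\<lambda>n. ?q (r n) es"
        and d = "\<lambda>n. ennreal (1 / real (Suc (r n)))"])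
    fix \<epsilon> :: real assume "0 < \<epsilon>"
    from lt[OF this] obtain B where B: "finite B" "\<And>n. (\<integral>\<^sup>+y. tail_prob B y \<partial>averaged_law x n) \<le> ennreal \<epsilon>"
      by blast
    have "(\<integral>\<^sup>+e. ?q n (e # es) * indicator (- B) e \<partial>count_space UNIV) \<le> ennreal \<epsilon>" for n
      by (rule order_trans[OF word_mass_Cons_tail B(2)])
    then show "\<exists>B. finite B \<and> (\<forall>n. (\<integral>\<^sup>+e. ?q (r n) (e # es) * indicator (- B) e \<partial>count_space UNIV) \<le> ennreal \<epsilon>)"
      using B(1) by blast
  next
    have "(\<lambda>n. 1 / real (Suc (r n))) \<longlonglongrightarrow> 0"
      using LIMSEQ_subseq_LIMSEQ[OF LIMSEQ_inverse_real_of_nat r] by (simp add: comp_def inverse_eq_divide)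
    from tendsto_ennrealI[OF this] show "(\<lambda>n. ennreal (1 / real (Suc (r n)))) \<longlonglongrightarrow> 0"
      by (simp only: ennreal_0)
  next
    fix n
    let ?f = "\<lambda>y. ennreal (path_prob M es y)"
    have f: "?f \<in> borel_measurable borel" "\<And>y. ?f y \<le> 1" by (simp_all add: path_prob_le_1)
    show "(\<integral>\<^sup>+e. ?q (r n) (e # es) \<partial>count_space UNIV) \<le> ?q (r n) es + ennreal (1 / real (Suc (r n)))"
      unfolding word_mass_Cons[OF sets_averaged_law] unfolding word_mass_def
      by (rule averaged_law_almost_invariant(1)[OF f])
    show "?q (r n) es \<le> (\<integral>\<^sup>+e. ?q (r n) (e # es) \<partial>count_space UNIV) + ennreal (1 / real (Suc (r n)))"
      unfolding word_mass_Cons[OF sets_averaged_law] unfolding word_mass_def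
      by (rule averaged_law_almost_invariant(2)[OF f])
  qed (rule lim)+
  obtain \<Lambda> where "\<Lambda> \<in> shift_invariant" "\<And>m es. emeasure \<Lambda> (cylinder m es) = q es"
    using stationary_measure[OF one right left] by blast
  then have "limit_state \<Lambda> (\<lambda>n. averaged_law x (r n)) (gap x + b / (1 - a))"
    unfolding limit_state_def using lim averaged_law_gap_bounded by simp
  then show ?thesis using r by blast
qed

text \<open>
  Some letter that ends in \<open>j\<close> has positive mass.  If it could not occur after \<open>n\<close> or more steps
  from \<open>x\<close>, its frequency in the mean over \<open>N\<close> steps would be at most \<open>n / N\<close> and vanish in the limit.
\<close>

lemma limit_state_paths:
  assumes \<Lambda>: "limit_state \<Lambda> (\<lambda>n. averaged_law x (r n)) G" and r: "strict_mono (r :: nat \<Rightarrow> nat)"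
    and pos: "emeasure \<Lambda> (T_set M j) > 0"
  shows "\<exists>k\<ge>n. \<exists>es :: 'e list. length es = k \<and> is_path M es \<and> ter M (last es) = j \<and>
    emeasure (path_measure M x) (cylinder_plus (map Some es)) > 0"
proof -
  note sets[measurable_cong] = limit_stateD(2)[OF \<Lambda>]
  have "\<exists>e. ter M e = j \<and> emeasure \<Lambda> (cylinder 0 [Some e]) \<noteq> 0"
  proof (rule ccontr)
    assume *: "\<not> ?thesis"
    have sub: "T_set M j \<subseteq> (\<Union>e\<in>{e. ter M e = j}. cylinder 0 [Some e])"
    proof
      fix \<sigma> assume \<sigma>: "\<sigma> \<in> T_set M j"
      then obtain e where e: "\<sigma> 0 = Some e" by (auto simp: T_set_def SigmaG_def)
      then have "ter M e = j" "\<sigma> \<in> cylinder 0 [Some e]" using \<sigma> by (auto simp: T_set_def cylinder_def)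
      then show "\<sigma> \<in> (\<Union>e\<in>{e. ter M e = j}. cylinder 0 [Some e])" by auto
    qed
    have null: "(\<Union>e\<in>{e. ter M e = j}. cylinder 0 [Some e]) \<in> null_sets \<Lambda>"
      using * by (intro null_sets_UN') (auto simp: null_sets_def sets)
    have "emeasure \<Lambda> (T_set M j) \<le> 0"
      using emeasure_mono[OF sub null_setsD2[OF null]] null_setsD1[OF null] by simp
    then show False using pos by simp
  qed
  then obtain e where e: "ter M e = j" "emeasure \<Lambda> (cylinder 0 [Some e]) \<noteq> 0" by blast
  let ?f = "\<lambda>y. ennreal (wprob_opt M (Some e) y)"
  have fm: "?f \<in> borel_measurable borel" by (intro measurable_compose[OF measurable_wprob_opt measurable_ennreal])
  have "\<exists>k\<ge>n. orbit_mean x k ?f \<noteq> 0"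
  proof (rule ccontr)
    assume "\<not> ?thesis"
    then have zero: "orbit_mean x k ?f = 0" if "k \<ge> n" for k using that by blast
    have le1: "orbit_mean x k ?f \<le> 1" for k
    proof -
      have "orbit_mean x k ?f \<le> orbit_mean x k (\<lambda>_. 1)"
        by (rule orbit_mean_mono) (metis ennreal_leI ennreal_1 wprob_opt_le_1)
      then show ?thesis by (simp only: orbit_mean_const)
    qed
    have bound: "word_mass (averaged_law x N) [Some e] \<le> ennreal (real n * (1 / real (Suc N)))" for N
    proof -
      have "word_mass (averaged_law x N) [Some e] = ennreal (1 / real (Suc N)) * (\<Sum>k=1..Suc N. orbit_mean x k ?f)"
        unfolding word_mass_def using nn_integral_averaged_law[OF fm] by simp
      also have "(\<Sum>k=1..Suc N. orbit_mean x k ?f) = (\<Sum>k\<in>{1..Suc N} \<inter> {..<n}. orbit_mean x k ?f)"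
        by (rule sum.mono_neutral_right) (auto intro!: zero simp del: wprob_opt.simps)
      also have "\<dots> \<le> (\<Sum>k\<in>{1..Suc N} \<inter> {..<n}. 1)" by (intro sum_mono le1)
      also have "\<dots> \<le> (\<Sum>k\<in>{..<n}. 1)" by (rule sum_mono2) auto
      also have "\<dots> = of_nat n" by simp
      finally have "word_mass (averaged_law x N) [Some e] \<le> ennreal (1 / real (Suc N)) * of_nat n"
        by (simp add: mult_left_mono)
      also have "\<dots> = ennreal (real n * (1 / real (Suc N)))"
        by (subst ennreal_mult') (simp_all add: ennreal_of_nat_eq_real_of_nat mult.commute)
      finally show ?thesis .
    qed
    have "(\<lambda>N. 1 / real (Suc (r N))) \<longlonglongrightarrow> 0"
      using LIMSEQ_subseq_LIMSEQ[OF LIMSEQ_inverse_real_of_nat r] by (simp add: comp_def inverse_eq_divide)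
    then have "(\<lambda>N. real n * (1 / real (Suc (r N)))) \<longlonglongrightarrow> real n * 0" by (intro tendsto_mult tendsto_const)
    from tendsto_ennrealI[OF this] have "(\<lambda>N. ennreal (real n * (1 / real (Suc (r N))))) \<longlonglongrightarrow> 0"
      by (simp only: mult_zero_right ennreal_0)
    then have "emeasure \<Lambda> (cylinder 0 [Some e]) \<le> 0"
      using limit_stateD(5)[OF \<Lambda>, of "[Some e]" 0] bound by (intro LIMSEQ_le) auto
    then show False using e(2) by simp
  qed
  then obtain k where k: "k \<ge> n" "orbit_mean x k ?f \<noteq> 0" by blast
  have "\<exists>u. length u = k \<and> path_prob M (u @ [Some e]) x \<noteq> 0"
  proof (rule ccontr)
    assume "\<not> ?thesis"
    then have "path_prob M u x = 0 \<or> wprob_opt M (Some e) (path_map M u x) = 0" if "length u = k" for u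
      using that by (auto simp: path_prob_append)
    then have "orbit_mean x k ?f = path_sum M k (\<lambda>_. 0) x"
      unfolding orbit_mean_def by (intro path_sum_cong) force
    then show False using k(2) by (simp add: path_sum_const)
  qed
  then obtain u where u: "length u = k" "path_prob M (u @ [Some e]) x \<noteq> 0" by blast
  obtain es where es: "u @ [Some e] = map Some es" "is_path M es" using path_prob_is_path[OF u(2)] by blast
  have "length es = Suc k" using arg_cong[OF es(1), of length] u(1) by simp
  moreover have "last es = e"
  proof -
    have "es \<noteq> []" using es(1) by auto
    then have "Some (last es) = last (map Some es)" by (simp add: last_map)
    then show ?thesis using es(1) by (metis last_snoc option.inject)
  qed
  moreover have "emeasure (path_measure M x) (cylinder_plus (map Some es)) > 0"
    unfolding es(1)[symmetric] using u(2) path_prob_nonneg[of "u @ [Some e]" x]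
    by (subst path_measure_cylinder) (auto simp: less_le)
  ultimately show ?thesis using k(1) es(2) e(1) by (intro exI[of _ "Suc k"]) auto
qed

end

theorem theorem5:
  fixes M :: "('k::complete_space, 'e::countable) markov_system"
    and xs :: "nat \<Rightarrow> 'k" and a :: real
  assumes "countable_markov_system M"
    and "\<And>j. j \<in> vert M \<Longrightarrow> xs j \<in> cell M j"
    and "contractive M a"
    and "uniformly_continuous_system M"
    and "bconst M xs < \<infinity>"
  shows
    "(\<forall>x0. dominating_chain M \<and> uniformly_tight M x0 \<longrightarrow>
        (\<exists>\<Lambda>\<in>asymptotic_states M xs. \<forall>j\<in>vert M. emeasure \<Lambda> (T_set M j) > 0 \<longrightarrow>
           (\<forall>n\<ge>1. \<exists>k\<ge>n. \<exists>es :: 'e list. length es = k \<and> is_path M es \<and> ter M (last es) = j \<and>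
              emeasure (path_measure M x0) (cylinder_plus (map Some es)) > 0)))
     \<and> (equilibrium_states M xs \<subseteq> Phi M ` invariant_measures M
        \<and> Phi M ` invariant_measures M \<subseteq> asymptotic_states M xs
        \<and> (\<forall>\<mu>\<in>invariant_measures M. distr (Phi M \<mu>) borel (coding M xs) = \<mu>))
     \<and> (\<exists>Q :: nat \<Rightarrow> (int \<Rightarrow> 'e option) set.
          (\<forall>k\<ge>1. Q k \<in> sets code_borel \<and> Q k \<subseteq> SigmaG M \<and> Q k \<subseteq> Q (Suc k))
          \<and> (\<forall>\<mu>\<in>invariant_measures M. \<forall>n\<ge>1.
               (\<Sum>k. emeasure (Phi M \<mu>) (UNIV - Q (n + k)))
                 \<le> ennreal (1 / (1 - sqrt a) * a powr (real n / 2)))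
          \<and> (\<forall>k\<ge>1. \<forall>\<sigma>\<in>Q k. \<forall>\<sigma>'\<in>Q k. code_dist \<sigma> \<sigma>' \<le> (1 / 2) ^ (k + 1) \<longrightarrow>
               dist (coding M xs \<sigma>) (coding M xs \<sigma>')
                 \<le> 8 * enn2real (bconst M xs) / ((1 - sqrt a) * (1 - a))
                    * code_dist \<sigma> \<sigma>' powr (ln (sqrt a) / ln (1 / 2))))"
proof (intro conjI)
  interpret contractive_markov_system M xs a
    by (rule contractive_markov_system.intro) (use assms in auto)
  show "\<forall>x0. dominating_chain M \<and> uniformly_tight M x0 \<longrightarrow>
        (\<exists>\<Lambda>\<in>asymptotic_states M xs. \<forall>j\<in>vert M. emeasure \<Lambda> (T_set M j) > 0 \<longrightarrow>
           (\<forall>n\<ge>1. \<exists>k\<ge>n. \<exists>es :: 'e list. length es = k \<and> is_path M es \<and> ter M (last es) = j \<and>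
              emeasure (path_measure M x0) (cylinder_plus (map Some es)) > 0))"
  proof (intro allI impI)
    fix x0 assume "dominating_chain M \<and> uniformly_tight M x0"
    then obtain \<Lambda> r where r: "strict_mono (r :: nat \<Rightarrow> nat)"
      and \<Lambda>: "limit_state \<Lambda> (\<lambda>n. averaged_law x0 (r n)) (gap x0 + b / (1 - a))"
      using asymptotic_state_exists by blast
    show "\<exists>\<Lambda>\<in>asymptotic_states M xs. \<forall>j\<in>vert M. emeasure \<Lambda> (T_set M j) > 0 \<longrightarrow>
       (\<forall>n\<ge>1. \<exists>k\<ge>n. \<exists>es :: 'e list. length es = k \<and> is_path M es \<and> ter M (last es) = j \<and>
          emeasure (path_measure M x0) (cylinder_plus (map Some es)) > 0)"
    proof (intro bexI ballI allI impI)
      show "\<Lambda> \<in> asymptotic_states M xs" by (rule limit_state_asymptotic[OF \<Lambda>])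
      fix j n assume "emeasure \<Lambda> (T_set M j) > 0"
      then show "\<exists>k\<ge>n. \<exists>es :: 'e list. length es = k \<and> is_path M es \<and> ter M (last es) = j \<and>
          emeasure (path_measure M x0) (cylinder_plus (map Some es)) > 0"
        by (rule limit_state_paths[OF \<Lambda> r])
    qed
  qed
  show "equilibrium_states M xs \<subseteq> Phi M ` invariant_measures M"
    using equilibrium_in_Phi_image by blast
  show "Phi M ` invariant_measures M \<subseteq> asymptotic_states M xs"
    using limit_state_asymptotic[OF Phi_limit_state] by blast
  show "\<forall>\<mu>\<in>invariant_measures M. distr (Phi M \<mu>) borel (coding M xs) = \<mu>"
    using distr_Phi_coding by blast
  show "\<exists>Q :: nat \<Rightarrow> (int \<Rightarrow> 'e option) set.
          (\<forall>k\<ge>1. Q k \<in> sets code_borel \<and> Q k \<subseteq> SigmaG M \<and> Q k \<subseteq> Q (Suc k))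
          \<and> (\<forall>\<mu>\<in>invariant_measures M. \<forall>n\<ge>1.
               (\<Sum>k. emeasure (Phi M \<mu>) (UNIV - Q (n + k)))
                 \<le> ennreal (1 / (1 - sqrt a) * a powr (real n / 2)))
          \<and> (\<forall>k\<ge>1. \<forall>\<sigma>\<in>Q k. \<forall>\<sigma>'\<in>Q k. code_dist \<sigma> \<sigma>' \<le> (1 / 2) ^ (k + 1) \<longrightarrow>
               dist (coding M xs \<sigma>) (coding M xs \<sigma>')
                 \<le> 8 * enn2real (bconst M xs) / ((1 - sqrt a) * (1 - a))
                    * code_dist \<sigma> \<sigma>' powr (ln (sqrt a) / ln (1 / 2)))"
    unfolding b_def[symmetric]
    using sets_Hoelder_set Hoelder_set_SigmaG Hoelder_set_mono sum_Phi_Hoelder_set_compl coding_Hoelder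
    by (intro exI[of _ Hoelder_set] conjI ballI allI impI)
qed

end
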